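(* Let $d\geq 1$, $k\geq 0$ and $0\leq m\leq k$ be integers and $\Omega=B^d$. There is a constant $C=C(d,k)$ such that for every $f\in\mathcal{K}_1(\mathbb{P}_k^d)$ and every integer $n\geq 1$, \[ \inf_{f_n\in\Sigma_n(\mathbb{P}_k^d)}\|f-f_n\|_{W^m(L_\infty(\Omega))}\leq C\|f\|_{\mathcal{K}_1(\mathbb{P}_k^d)}\, n^{-\frac12-\frac{2(k-m)+1}{2d}}. \] Moreover, if $f\in B_1(\mathbb{P}_k^d)$, then $f_n$ achieving this bound can be taken in $\Sigma_n^1(\mathbb{P}_k^d)$.
   Context: $B^d=\{x\in\mathbb{R}^d:|x|\leq1\}$, $S^{d-1}$ the unit sphere in $\mathbb{R}^d$. $\sigma_k(t)=t^k$ for $t\geq0$, $\sigma_k(t)=0$ for $t<0$ (with $0^0=1$). The dictionary is $\mathbb{P}_k^d=\{x\mapsto\sigma_k(\omega\cdot x+b):\omega\in S^{d-1},\ b\in[-1,1]\}\subset W^k(L_\infty(\Omega))$, where $\|g\|_{W^m(L_\infty(\Omega))}=\sup_{|\alpha|\leq m}\|D^\alpha g\|_{L_\infty(\Omega)}$. $\Sigma_n(\mathbb{D})=\{\sum_{i=1}^n a_id_i: a_i\in\mathbb{R}, d_i\in\mathbb{D}\}$ and $\Sigma_n^M(\mathbb{D})$ is the subset with $\sum_i|a_i|\leq M$. $B_1(\mathbb{D})$ is the closure (in $W^k(L_\infty(\Omega))$) of $\bigcup_{n\geq1}\Sigma_n^1(\mathbb{D})$, the variation norm is $\|f\|_{\mathcal{K}_1(\mathbb{D})}=\inf\{s>0: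 f\in sB_1(\mathbb{D})\}$, and $\mathcal{K}_1(\mathbb{D})$ is the space of $f$ with finite variation norm. *)

theory Defs
  imports "HOL-Analysis.Analysis" "HOL-Probability.Essential_Supremum"
begin

definition sigma_k :: "nat \<Rightarrow> real \<Rightarrow> real" where
  "sigma_k k t = (if t \<ge> 0 then t ^ k else 0)"

definition pd :: "'d::finite \<Rightarrow> (real^'d \<Rightarrow> real) \<Rightarrow> real^'d \<Rightarrow> real" where
  "pd i f x = frechet_derivative f (at x) (axis i 1)"

primrec iter_pd :: "'d::finite list \<Rightarrow> (real^'d \<Rightarrow> real) \<Rightarrow> real^'d \<Rightarrow> real" where
  "iter_pd [] f = f"
| "iter_pd (i # is) f = pd i (iter_pd is f)"

definition test_fun :: "(real^'d::finite \<Rightarrow> real) \<Rightarrow> bool" where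
  "test_fun \<phi> \<longleftrightarrow> (\<forall>is x. iter_pd is \<phi> differentiable (at x)) \<and>
     (\<exists>K. compact K \<and> K \<subseteq> ball 0 1 \<and> (\<forall>x. x \<notin> K \<longrightarrow> \<phi> x = 0))"

definition weak_deriv :: "'d::finite list \<Rightarrow> (real^'d \<Rightarrow> real) \<Rightarrow> (real^'d \<Rightarrow> real) \<Rightarrow> bool" where
  "weak_deriv is f g \<longleftrightarrow>
     set_integrable lebesgue (ball 0 1) f \<and> set_integrable lebesgue (ball 0 1) g \<and>
     (\<forall>\<phi>. test_fun \<phi> \<longrightarrow>
        (LINT x : ball 0 1 | lebesgue. f x * iter_pd is \<phi> x)
          = (-1) ^ length is * (LINT x : ball 0 1 | lebesgue. g x * \<phi> x))"

text \<open>L_infinity(Omega) norm and W^m(L_infinity(Omega)) norm (infinite if f is not in the space).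
  Multi-indices |alpha| <= m are represented by words of directions of length <= m.\<close>
definition Linf_norm :: "(real^'d::finite \<Rightarrow> real) \<Rightarrow> ereal" where
  "Linf_norm g = esssup (lebesgue_on (cball 0 1)) (\<lambda>x. ereal \<bar>g x\<bar>)"

definition W_norm :: "nat \<Rightarrow> (real^'d::finite \<Rightarrow> real) \<Rightarrow> ereal" where
  "W_norm m f = (SUP is \<in> {is :: 'd list. length is \<le> m}.
                   INF g \<in> {g. weak_deriv is f g}. Linf_norm g)"

definition dict_P :: "nat \<Rightarrow> (real^'d::finite \<Rightarrow> real) set" where
  "dict_P k = {(\<lambda>x. sigma_k k (\<omega> \<bullet> x + b)) | \<omega> b. norm \<omega> = 1 \<and> b \<in> {-1..1}}"

definition Sigma_n :: "nat \<Rightarrow> (real^'d::finite \<Rightarrow> real) set \<Rightarrow> (real^'d \<Rightarrow> real) set" where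
  "Sigma_n n D = {(\<lambda>x. \<Sum>i<n. a i * h i x) | a h. \<forall>i<n. h i \<in> D}"

definition Sigma_nM :: "nat \<Rightarrow> real \<Rightarrow> (real^'d::finite \<Rightarrow> real) set \<Rightarrow> (real^'d \<Rightarrow> real) set" where
  "Sigma_nM n M D = {(\<lambda>x. \<Sum>i<n. a i * h i x) | a h. (\<forall>i<n. h i \<in> D) \<and> (\<Sum>i<n. \<bar>a i\<bar>) \<le> M}"

definition B1 :: "nat \<Rightarrow> (real^'d::finite \<Rightarrow> real) set \<Rightarrow> (real^'d \<Rightarrow> real) set" where
  "B1 k D = {f. \<forall>\<epsilon>>0. \<exists>h \<in> (\<Union>n\<in>{1..}. Sigma_nM n 1 D). W_norm k (\<lambda>x. f x - h x) < ereal \<epsilon>}"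

definition K1_set :: "nat \<Rightarrow> (real^'d::finite \<Rightarrow> real) set \<Rightarrow> (real^'d \<Rightarrow> real) \<Rightarrow> real set" where
  "K1_set k D f = {s. s > 0 \<and> (\<exists>g \<in> B1 k D. f = (\<lambda>x. s * g x))}"

definition K1_norm :: "nat \<Rightarrow> (real^'d::finite \<Rightarrow> real) set \<Rightarrow> (real^'d \<Rightarrow> real) \<Rightarrow> real" where
  "K1_norm k D f = Inf (K1_set k D f)"

definition in_K1 :: "nat \<Rightarrow> (real^'d::finite \<Rightarrow> real) set \<Rightarrow> (real^'d \<Rightarrow> real) \<Rightarrow> bool" where
  "in_K1 k D f \<longleftrightarrow> K1_set k D f \<noteq> {}"

end

(* The k-th derivatives of a ridge function are multiples of half-space indicators, so a convex
   combination of N ridge functions is thinned by halving: the atoms of small weight receive signs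
   xi in {-1, 0, 1}, the weight a_i is replaced by a_i (1 + xi_i), and a fixed fraction of the atoms
   disappears.  Iterating down to n atoms costs a geometric series of errors dominated by its last
   term, provided that the signed sums and all their derivatives are uniformly as small as
   N^(1/2 - (2(k-m)+1)/(2d)).

   Such signs come from Beck's partial colouring method.  By Haussler's packing lemma, applied to
   the hyperplanes of the atoms and to a grid, the ball has nets with O(2^(jd)) points at scale
   2^-j, both for the Euclidean distance and for the fraction of separating hyperplanes.  Chaining
   through these nets, the Taylor polynomials of the signed sum at neighbouring net points differ by
   sums over the few separating hyperplanes.  An entropy argument produces signs making all these
   increments small at once: far below their standard deviation at the coarse scales, where there
   are few of them, and moderately above it at the fine scales.  No logarithm is lost. *)
theory Submission
  imports Defs
begin

section \<open>Packing for set systems of bounded VC dimension\<close>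

text \<open>The exponent is fixed by one scale \<open>j0\<close>, at which the number of increments,
  of order 2^(j d), reaches the number N of atoms. An increment there involves about N 2^-j0 atoms,
  each of size 2^-(j0 r) for derivatives of order k - r, so its standard deviation is of order
  N^(1/2) 2^-(j0 (r + 1/2)) = N^(1/2 - (2 r + 1)/(2 d)). Random signs miss this order, because
  coarse increments deviate by up to N^(1/2). Confining an increment to 2^-a times its standard
  deviation costs only O(a) units of entropy, however, and a total of N/4 is affordable if only a
  fixed fraction of the atoms has to be coloured; thinning asks for no more. Two points are
  delicate. The nets must have exactly the growth 2^(j d): a packing bound from the Sauer-Shelah
  count alone loses a logarithm, and the dual VC dimension has to be d, not d + 1. And the second
  claim forbids the l1 mass of the weights to grow; it is therefore balanced as one more increment,
  to the accuracy of the approximation itself, so that a final rescaling is harmless.\<close>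

definition shatters :: "bool list set \<Rightarrow> nat set \<Rightarrow> bool" where
  "shatters S K \<longleftrightarrow> (\<forall>T\<subseteq>K. \<exists>l\<in>S. \<forall>t\<in>K. l ! t \<longleftrightarrow> t \<in> T)"

definition vc_le :: "nat \<Rightarrow> nat \<Rightarrow> bool list set \<Rightarrow> bool" where
  "vc_le D s S \<longleftrightarrow> (\<forall>K\<subseteq>{..<s}. shatters S K \<longrightarrow> card K \<le> D)"

definition slice :: "bool \<Rightarrow> bool list set \<Rightarrow> bool list set" where
  "slice b S = {l. b # l \<in> S}"

lemma shatters_slice_Un:
  assumes "shatters (slice False S \<union> slice True S) K"
  shows "shatters S (Suc ` K)"
  unfolding shatters_def
proof (intro allI impI)
  fix T assume T: "T \<subseteq> Suc ` K"
  have "{t\<in>K. Suc t \<in> T} \<subseteq> K" by auto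
  then obtain l where l: "l \<in> slice False S \<union> slice True S"
    "\<forall>t\<in>K. l ! t \<longleftrightarrow> t \<in> {t\<in>K. Suc t \<in> T}"
    using assms unfolding shatters_def by meson
  then obtain b where "b # l \<in> S" by (auto simp: slice_def)
  moreover have "\<forall>t\<in>Suc ` K. (b # l) ! t \<longleftrightarrow> t \<in> T" using l(2) by auto
  ultimately show "\<exists>l\<in>S. \<forall>t\<in>Suc ` K. l ! t \<longleftrightarrow> t \<in> T" by blast
qed

lemma shatters_slice_Int:
  assumes "shatters (slice False S \<inter> slice True S) K"
  shows "shatters S (insert 0 (Suc ` K))"
  unfolding shatters_def
proof (intro allI impI)
  fix T assume T: "T \<subseteq> insert 0 (Suc ` K)"
  have "{t\<in>K. Suc t \<in> T} \<subseteq> K" by auto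
  then obtain l where l: "l \<in> slice False S \<inter> slice True S"
    "\<forall>t\<in>K. l ! t \<longleftrightarrow> t \<in> {t\<in>K. Suc t \<in> T}"
    using assms unfolding shatters_def by meson
  then have "(0 \<in> T) # l \<in> S" by (cases "0 \<in> T") (auto simp: slice_def)
  moreover have "\<forall>t\<in>insert 0 (Suc ` K). ((0\<in>T) # l) ! t \<longleftrightarrow> t \<in> T" using l(2) by auto
  ultimately show "\<exists>l\<in>S. \<forall>t\<in>insert 0 (Suc ` K). l ! t \<longleftrightarrow> t \<in> T" by blast
qed

lemma vc_le_slice_Un:
  assumes "vc_le D (Suc s) S" shows "vc_le D s (slice False S \<union> slice True S)"
  unfolding vc_le_def
proof (intro allI impI)
  fix K assume K: "K \<subseteq> {..<s}" "shatters (slice False S \<union> slice True S) K"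
  have "Suc ` K \<subseteq> {..<Suc s}" using K(1) by auto
  then have "card (Suc ` K) \<le> D"
    using assms shatters_slice_Un[OF K(2)] unfolding vc_le_def by blast
  then show "card K \<le> D" by (simp add: card_image)
qed

text \<open>A tail lying in both slices extends by either first bit, so coordinate 0 can be added to
  every shattered set and the dimension drops by one. Nonemptiness makes the empty set shattered,
  which forces \<open>D \<ge> 1\<close>; hence \<open>D - 1\<close> is a genuine
  subtraction.\<close>

lemma vc_le_slice_Int:
  assumes "vc_le D (Suc s) S" "slice False S \<inter> slice True S \<noteq> {}"
  shows "D \<ge> 1 \<and> vc_le (D - 1) s (slice False S \<inter> slice True S)"
proof -
  have *: "Suc (card K) \<le> D"
    if K: "K \<subseteq> {..<s}" "shatters (slice False S \<inter> slice True S) K" for K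
  proof -
    have "insert 0 (Suc ` K) \<subseteq> {..<Suc s}" using K(1) by auto
    then have "card (insert 0 (Suc ` K)) \<le> D"
      using assms shatters_slice_Int[OF K(2)] unfolding vc_le_def by blast
    moreover have "finite K" using K(1) finite_subset by blast
    ultimately show ?thesis by (simp add: card_image card_insert_if)
  qed
  have "shatters (slice False S \<inter> slice True S) {}"
    using assms(2) unfolding shatters_def by auto
  then have "D \<ge> 1" using *[of "{}"] by simp
  moreover have "card K \<le> D - 1"
    if "K \<subseteq> {..<s}" "shatters (slice False S \<inter> slice True S) K" for K
    using *[OF that] by simp
  ultimately show ?thesis unfolding vc_le_def by blast
qed

lemma finite_bool_lists: "finite {l :: bool list. length l = s}"
  using finite_lists_length_eq[of "UNIV :: bool set" s] by simp

lemma sum_bool_lists_Suc: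
  "(\<Sum>l | length l = Suc s. f l) =
    (\<Sum>l | length l = s. f (False # l)) + (\<Sum>l | length l = s. (f (True # l) :: 'a :: comm_monoid_add))"
proof -
  have "{l :: bool list. length l = Suc s} =
     (#) False ` {l. length l = s} \<union> (#) True ` {l. length l = s}"
    by (auto simp: length_Suc_conv image_iff)
  moreover have "(#) False ` {l. length l = s} \<inter> (#) True ` {l. length l = s} = {}" by blast
  ultimately show ?thesis
    by (simp add: sum.union_disjoint finite_bool_lists sum.reindex)
qed

lemma card_slices:
  assumes "S \<subseteq> {l. length l = Suc s}"
  shows "card S = card (slice False S) + card (slice True S)"
proof -
  have "S = (#) False ` slice False S \<union> (#) True ` slice True S" (is "_ = ?A \<union> ?B")
  proof (intro set_eqI iffI)
    fix l assume l: "l \<in> S"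
    then obtain b l' where "l = b # l'" using assms by (cases l) auto
    with l show "l \<in> ?A \<union> ?B" by (cases b) (simp_all add: slice_def)
  qed (auto simp: slice_def)
  moreover have "finite S" using assms finite_bool_lists finite_subset by blast
  then have "finite ?A" "finite ?B" using calculation by (metis finite_Un)+
  moreover have "?A \<inter> ?B = {}" by auto
  ultimately have "card S = card ?A + card ?B" by (metis card_Un_disjoint)
  then show ?thesis by (simp add: card_image)
qed

text \<open>Deleting the first coordinate splits \<open>card S\<close> into the projection and the
  set of doubly extendable tails, with VC bounds D and D - 1: Pascal's recursion. The power (s+1)^D
  satisfies it as an inequality, which avoids sums of binomial coefficients.\<close>

lemma sauer_shelah:
  assumes "S \<subseteq> {l. length l = s}" "vc_le D s S"
  shows "card S \<le> (s + 1) ^ D"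
  using assms
proof (induction s arbitrary: S D)
  case 0
  then have "card S \<le> card {[] :: bool list}" by (intro card_mono) auto
  then show ?case by simp
next
  case (Suc s)
  let ?U = "slice False S \<union> slice True S" and ?I = "slice False S \<inter> slice True S"
  have len: "slice b S \<subseteq> {l. length l = s}" for b using Suc.prems(1) by (auto simp: slice_def)
  have fin: "finite (slice b S)" for b using len finite_bool_lists finite_subset by blast
  have "card S = card ?U + card ?I"
    using card_slices[OF Suc.prems(1)] card_Un_Int[OF fin fin] by simp
  moreover have U: "card ?U \<le> (s + 1) ^ D"
    using Suc.IH[OF _ vc_le_slice_Un[OF Suc.prems(2)]] len by blast
  moreover have "card ?I \<le> (if D = 0 then 0 else (s + 1) ^ (D - 1))"
  proof (cases "?I = {}")
    case False
    with vc_le_slice_Int[OF Suc.prems(2)] have "D \<ge> 1" "vc_le (D - 1) s ?I" by auto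
    then show ?thesis using Suc.IH[of ?I "D - 1"] len by (auto simp: le_infI1)
  qed simp
  moreover have "(s + 1) ^ D + (s + 1) ^ (D - 1) \<le> (Suc s + 1) ^ D" if "D \<noteq> 0"
  proof -
    obtain E where E: "D = Suc E" using \<open>D \<noteq> 0\<close> not0_implies_Suc by blast
    have "(s + 1) ^ D + (s + 1) ^ (D - 1) = (s + 2) * (s + 1) ^ E" by (simp add: E)
    also have "\<dots> \<le> (s + 2) * (s + 2) ^ E" by (intro mult_left_mono power_mono) auto
    finally show ?thesis by (simp add: E)
  qed
  ultimately show ?case by (cases "D = 0") auto
qed

text \<open>Total weight of the unit-distance graph on the cube of bool lists, an edge weighing the minimum of
  its two end points.\<close>
primrec edge_weight :: "nat \<Rightarrow> (bool list \<Rightarrow> real) \<Rightarrow> real" where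
  "edge_weight 0 w = 0"
| "edge_weight (Suc s) w =
     (\<Sum>l | length l = s. min (w (False # l)) (w (True # l)))
     + edge_weight s (\<lambda>l. w (False # l)) + edge_weight s (\<lambda>l. w (True # l))"

text \<open>Compression: passing from two weights to their pointwise maximum and minimum loses no
  edge weight. Edge by edge this is an inequality between four numbers.\<close>

lemma edge_weight_max_min:
  "edge_weight s u + edge_weight s v
    \<le> edge_weight s (\<lambda>l. max (u l) (v l)) + edge_weight s (\<lambda>l. min (u l) (v l))"
proof (induction s arbitrary: u v)
  case (Suc s)
  have "(\<Sum>l | length l = s. min (u (False # l)) (u (True # l)))
        + (\<Sum>l | length l = s. min (v (False # l)) (v (True # l)))
     \<le> (\<Sum>l | length l = s. min (max (u (False # l)) (v (False # l))) (max (u (True # l)) (v (True # l))))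
      + (\<Sum>l | length l = s. min (min (u (False # l)) (v (False # l))) (min (u (True # l)) (v (True # l))))"
    unfolding sum.distrib[symmetric] by (intro sum_mono) (auto simp: min_def max_def)
  with Suc.IH[of "\<lambda>l. u (False # l)" "\<lambda>l. v (False # l)"] Suc.IH[of "\<lambda>l. u (True # l)" "\<lambda>l. v (True # l)"]
  show ?case by simp
qed simp

text \<open>Weighted form of the fact that the unit-distance graph of a class of VC dimension D has
  at most D edges per vertex. After compression the maximum \<open>?u\<close> lives on the union of
  the two slices and the minimum \<open>?v\<close> on their intersection. The edges in direction 0
  weigh exactly the sum of \<open>?v\<close>, and the drop to dimension D - 1 on the intersection
  pays for them.\<close>

lemma edge_weight_le:
  assumes "\<And>l. w l \<ge> 0" "vc_le D s {l. length l = s \<and> w l > 0}"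
  shows "edge_weight s w \<le> D * (\<Sum>l | length l = s. w l)"
  using assms
proof (induction s arbitrary: w D)
  case (Suc s)
  let ?S = "{l. length l = Suc s \<and> w l > 0}"
  let ?u = "\<lambda>l. max (w (False # l)) (w (True # l))"
  let ?v = "\<lambda>l. min (w (False # l)) (w (True # l))"
  have U: "{l. length l = s \<and> ?u l > 0} = slice False ?S \<union> slice True ?S"
    by (auto simp: slice_def)
  have V: "{l. length l = s \<and> ?v l > 0} = slice False ?S \<inter> slice True ?S"
    by (auto simp: slice_def)
  have u: "edge_weight s ?u \<le> D * (\<Sum>l | length l = s. ?u l)"
    using Suc.prems(1) vc_le_slice_Un[OF Suc.prems(2)] unfolding U[symmetric]
    by (intro Suc.IH) (auto simp: le_max_iff_disj)
  have v: "edge_weight s ?v + (\<Sum>l | length l = s. ?v l) \<le> D * (\<Sum>l | length l = s. ?v l)"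
  proof (cases "slice False ?S \<inter> slice True ?S = {}")
    case True
    then have e: "{l. length l = s \<and> ?v l > 0} = {}" unfolding V .
    have "vc_le 0 s {l. length l = s \<and> ?v l > 0}"
      unfolding e by (auto simp: vc_le_def shatters_def)
    then have "edge_weight s ?v \<le> real 0 * (\<Sum>l | length l = s. ?v l)"
      using Suc.prems(1) by (intro Suc.IH) auto
    moreover have "?v l = 0" if "length l = s" for l
    proof -
      have "l \<notin> {l. length l = s \<and> ?v l > 0}" unfolding e by simp
      then have "\<not> ?v l > 0" using that by simp
      then show ?thesis using Suc.prems(1)[of "False # l"] Suc.prems(1)[of "True # l"] by linarith
    qed
    ultimately show ?thesis by simp
  next
    case False
    from vc_le_slice_Int[OF Suc.prems(2) False]
    have D: "D \<ge> 1" and vc: "vc_le (D - 1) s {l. length l = s \<and> ?v l > 0}"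
      unfolding V by auto
    have "edge_weight s ?v \<le> real (D - 1) * (\<Sum>l | length l = s. ?v l)"
      using Suc.prems(1) by (intro Suc.IH[OF _ vc]) auto
    with D show ?thesis by (simp add: of_nat_diff algebra_simps)
  qed
  have "edge_weight s (\<lambda>l. w (False # l)) + edge_weight s (\<lambda>l. w (True # l))
     \<le> edge_weight s ?u + edge_weight s ?v" by (rule edge_weight_max_min)
  then have "edge_weight (Suc s) w \<le> D * ((\<Sum>l | length l = s. ?u l) + (\<Sum>l | length l = s. ?v l))"
    using u v by (simp add: distrib_left)
  also have "(\<Sum>l | length l = s. ?u l) + (\<Sum>l | length l = s. ?v l) = (\<Sum>l | length l = Suc s. w l)"
    unfolding sum_bool_lists_Suc sum.distrib[symmetric] by (intro sum.cong) (auto simp: min_def max_def)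
  finally show ?case .
qed simp

section \<open>Haussler's packing lemma by double counting over samples\<close>

definition trace_count :: "('x \<Rightarrow> 'h \<Rightarrow> bool) \<Rightarrow> 'x set \<Rightarrow> 'h list \<Rightarrow> bool list \<Rightarrow> real" where
  "trace_count A P hs l = real (card {x\<in>P. map (A x) hs = l})"

lemma trace_count_Cons:
  "trace_count A P (h # hs) (b # l) = trace_count A {x\<in>P. A x h = b} hs l"
  unfolding trace_count_def by (rule arg_cong[where f="\<lambda>X. real (card X)"]) auto

lemma sum_lists_Suc:
  assumes "finite I"
  shows "(\<Sum>hs | set hs \<subseteq> I \<and> length hs = Suc s. f hs) =
     (\<Sum>h\<in>I. \<Sum>hs | set hs \<subseteq> I \<and> length hs = s. (f (h # hs) :: real))"
proof -
  have *: "{hs. set hs \<subseteq> I \<and> length hs = Suc s} =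
    (\<lambda>(h, hs). h # hs) ` (I \<times> {hs. set hs \<subseteq> I \<and> length hs = s})"
    by (auto simp: length_Suc_conv image_iff)
  show ?thesis unfolding *
    by (subst sum.reindex) (auto simp: inj_on_def sum.cartesian_product case_prod_beta)
qed

lemma sum_trace_count:
  assumes "finite P"
  shows "(\<Sum>l | length l = length hs. trace_count A P hs l) = card P"
    and "(\<Sum>l | length l = length hs. of_bool (trace_count A P hs l > 0))
          = real (card ((\<lambda>x. map (A x) hs) ` P))"
proof -
  have "(\<Sum>l | length l = length hs. trace_count A P hs l)
     = real (\<Sum>l | length l = length hs. card {x\<in>P. map (A x) hs = l})"
    by (simp add: trace_count_def)
  also have "(\<Sum>l | length l = length hs. card {x\<in>P. map (A x) hs = l})
     = card (\<Union>l\<in>{l. length l = length hs}. {x\<in>P. map (A x) hs = l})"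
    using assms by (subst card_UN_disjoint) (auto simp: finite_bool_lists)
  also have "(\<Union>l\<in>{l. length l = length hs}. {x\<in>P. map (A x) hs = l}) = P" by auto
  finally show "(\<Sum>l | length l = length hs. trace_count A P hs l) = card P" .
  have pos: "trace_count A P hs l > 0 \<longleftrightarrow> l \<in> (\<lambda>x. map (A x) hs) ` P" for l
    using assms by (auto simp: trace_count_def card_gt_0_iff)
  have "{l :: bool list. length l = length hs} \<inter> {l. l \<in> (\<lambda>x. map (A x) hs) ` P} = (\<lambda>x. map (A x) hs) ` P"
    by auto
  then show "(\<Sum>l | length l = length hs. of_bool (trace_count A P hs l > 0))
          = real (card ((\<lambda>x. map (A x) hs) ` P))"
    unfolding pos by (subst sum_of_bool_eq) (auto simp: finite_bool_lists)
qed

lemma sum_of_bool_card: "finite X \<Longrightarrow> (\<Sum>x\<in>X. of_bool (R x)) = real (card {x\<in>X. R x})"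
  using sum_of_bool_eq[of X R] by (simp add: Int_def)

text \<open>Double counting of ordered pairs of distinct points of \<open>Q\<close> and the elements
  separating them. An element splitting \<open>Q\<close> into parts of sizes f and t separates 2 f t
  pairs, at most 2 \<open>card Q\<close> times the smaller part, while each pair has at least
  \<delta> separators. The \<open>of_bool\<close> term makes the bound vanish for empty
  \<open>Q\<close>.\<close>

lemma sum_min_split_ge:
  fixes A :: "'x \<Rightarrow> 'h \<Rightarrow> bool" and \<delta> :: real
  assumes "finite I" "finite Q"
    and sep: "\<And>x y. x \<in> Q \<Longrightarrow> y \<in> Q \<Longrightarrow> x \<noteq> y \<Longrightarrow> real (card {h\<in>I. A x h \<noteq> A y h}) \<ge> \<delta>"
    and "\<delta> \<ge> 0"
  shows "\<delta> / 2 * (real (card Q) - of_bool (card Q > 0))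
     \<le> (\<Sum>h\<in>I. min (real (card {x\<in>Q. A x h = False})) (real (card {x\<in>Q. A x h = True})))"
proof (cases "card Q > 0")
  case False
  then show ?thesis by (auto intro!: sum_nonneg)
next
  case True
  define b where "b = real (card Q)"
  have b: "b > 0" using True by (simp add: b_def)
  let ?F = "\<lambda>h. {x\<in>Q. A x h = False}" and ?T = "\<lambda>h. {x\<in>Q. A x h = True}"
  have FT: "card (?F h) + card (?T h) = card Q" for h
  proof -
    have "card (?F h \<union> ?T h) = card (?F h) + card (?T h)"
      using assms(2) by (intro card_Un_disjoint) auto
    moreover have "?F h \<union> ?T h = Q" by auto
    ultimately show ?thesis by simp
  qed
  have 1: "real (card (?F h)) * real (card (?T h)) \<le> b * min (real (card (?F h))) (real (card (?T h)))" for h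
  proof -
    have "real (card (?F h)) \<le> b" "real (card (?T h)) \<le> b" using FT[of h] by (auto simp: b_def)
    then show ?thesis
    proof (cases "card (?F h) \<le> card (?T h)")
      case True
      then have "min (real (card (?F h))) (real (card (?T h))) = real (card (?F h))" by simp
      with \<open>real (card (?T h)) \<le> b\<close> show ?thesis
        by (simp only:) (subst mult.commute, rule mult_right_mono, auto)
    next
      case False
      then have "min (real (card (?F h))) (real (card (?T h))) = real (card (?T h))" by simp
      with \<open>real (card (?F h)) \<le> b\<close> show ?thesis
        by (simp only:) (rule mult_right_mono, auto)
    qed
  qed
  have 2: "2 * (real (card (?F h)) * real (card (?T h))) = (\<Sum>(x,y)\<in>Q\<times>Q. of_bool (A x h \<noteq> A y h))" for h
  proof -
    have "(\<Sum>(x,y)\<in>Q\<times>Q. of_bool (A x h \<noteq> A y h)) = real (card {z\<in>Q\<times>Q. A (fst z) h \<noteq> A (snd z) h})"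
      unfolding case_prod_beta using assms(2) by (intro sum_of_bool_card) simp
    also have "{z\<in>Q\<times>Q. A (fst z) h \<noteq> A (snd z) h} = ?F h \<times> ?T h \<union> ?T h \<times> ?F h" by auto
    also have "card \<dots> = card (?F h \<times> ?T h) + card (?T h \<times> ?F h)"
      using assms(2) by (intro card_Un_disjoint) auto
    finally show ?thesis by (simp add: card_cartesian_product)
  qed
  have "b * (b - 1) * \<delta> = (\<Sum>(x,y)\<in>Q\<times>Q. of_bool (x \<noteq> y) * \<delta>)"
  proof -
    have "(\<Sum>(x,y)\<in>Q\<times>Q. of_bool (x \<noteq> y) * \<delta>) = (\<Sum>x\<in>Q. \<Sum>y\<in>Q. of_bool (x \<noteq> y)) * \<delta>"
      by (simp add: sum.cartesian_product sum_distrib_right case_prod_beta)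
    also have "(\<Sum>x\<in>Q. \<Sum>y\<in>Q. of_bool (x \<noteq> y)) = (\<Sum>x\<in>Q. b - 1)"
    proof (intro sum.cong refl)
      fix x assume x: "x \<in> Q"
      have "(\<Sum>y\<in>Q. of_bool (x \<noteq> y)) = real (card (Q - {x}))"
        using assms(2) by (simp, intro arg_cong[where f=card]) auto
      also have "\<dots> = b - 1" using x True assms(2) unfolding b_def by (simp add: card_Diff_singleton of_nat_diff)
      finally show "(\<Sum>y\<in>Q. of_bool (x \<noteq> y)) = b - 1" .
    qed
    finally show ?thesis by (simp add: b_def)
  qed
  also have "\<dots> \<le> (\<Sum>(x,y)\<in>Q\<times>Q. real (card {h\<in>I. A x h \<noteq> A y h}))"
    using sep by (intro sum_mono) auto
  also have "\<dots> = (\<Sum>(x,y)\<in>Q\<times>Q. \<Sum>h\<in>I. of_bool (A x h \<noteq> A y h))"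
  proof -
    have "real (card {h\<in>I. A x h \<noteq> A y h}) = (\<Sum>h\<in>I. of_bool (A x h \<noteq> A y h))" for x y
      using assms(1) by (rule sum_of_bool_card[symmetric])
    then show ?thesis by (simp only:)
  qed
  also have "\<dots> = (\<Sum>h\<in>I. \<Sum>(x,y)\<in>Q\<times>Q. of_bool (A x h \<noteq> A y h))"
    unfolding case_prod_beta by (rule sum.swap)
  also have "\<dots> = (\<Sum>h\<in>I. 2 * (real (card (?F h)) * real (card (?T h))))" by (simp only: 2)
  also have "\<dots> \<le> (\<Sum>h\<in>I. 2 * (b * min (real (card (?F h))) (real (card (?T h)))))"
    using 1 by (intro sum_mono) simp
  also have "\<dots> = b * (2 * (\<Sum>h\<in>I. min (real (card (?F h))) (real (card (?T h)))))"
    by (simp add: sum_distrib_left algebra_simps)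
  finally have "(b - 1) * \<delta> \<le> 2 * (\<Sum>h\<in>I. min (real (card (?F h))) (real (card (?T h))))"
    using b by (simp add: mult.assoc)
  then show ?thesis using True by (simp add: b_def algebra_simps)
qed

text \<open>Each of the s+1 directions of a sample contributes the same lower bound: the fibres over
  the other s entries are separated sets, and summing (size - 1) over the nonempty fibres leaves
  \<open>card P\<close> minus the number of traces. Samples are lists with repetition, so that the
  first entry can be peeled off and the others treated by induction on the two halves of
  \<open>P\<close>.\<close>

lemma sum_edge_weight_ge:
  fixes A :: "'x \<Rightarrow> 'h \<Rightarrow> bool" and \<delta> :: real
  assumes "finite I" "finite P"
    and sep: "\<And>x y. x \<in> P \<Longrightarrow> y \<in> P \<Longrightarrow> x \<noteq> y \<Longrightarrow> real (card {h\<in>I. A x h \<noteq> A y h}) \<ge> \<delta>"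
    and "\<delta> \<ge> 0"
  shows "\<delta> / 2 * real (Suc s) *
     (\<Sum>hs | set hs \<subseteq> I \<and> length hs = s. real (card P) - card ((\<lambda>x. map (A x) hs) ` P))
     \<le> (\<Sum>hs | set hs \<subseteq> I \<and> length hs = Suc s. edge_weight (Suc s) (trace_count A P hs))"
  using assms(2,3)
proof (induction s arbitrary: P)
  \<comment> \<open>The contribution of the first direction, for an arbitrary separated set: the
    base case, and one of the two summands in the induction step.\<close>
  have head: "(\<delta> / 2 *
     (\<Sum>hs | set hs \<subseteq> I \<and> length hs = s. real (card P) - card ((\<lambda>x. map (A x) hs) ` P)))
     \<le> (\<Sum>hs | set hs \<subseteq> I \<and> length hs = s. \<Sum>h\<in>I. \<Sum>l | length l = s.
           min (trace_count A P (h # hs) (False # l)) (trace_count A P (h # hs) (True # l)))"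
    if P: "finite P"
      "\<And>x y. x \<in> P \<Longrightarrow> y \<in> P \<Longrightarrow> x \<noteq> y \<Longrightarrow> real (card {h\<in>I. A x h \<noteq> A y h}) \<ge> \<delta>"
    for s and P :: "'x set"
    unfolding sum_distrib_left
  proof (intro sum_mono)
    fix hs assume hs: "hs \<in> {hs. set hs \<subseteq> I \<and> length hs = s}"
    then have len: "length hs = s" by simp
    have "\<delta> / 2 * (real (card P) - card ((\<lambda>x. map (A x) hs) ` P))
      = (\<Sum>l | length l = s. \<delta> / 2 * (trace_count A P hs l - of_bool (trace_count A P hs l > 0)))"
      unfolding sum_distrib_left[symmetric] sum_subtractf
      using sum_trace_count[OF P(1), where hs = hs and A = A] len by simp
    also have "\<dots> \<le> (\<Sum>l | length l = s. \<Sum>h\<in>I.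
           min (trace_count A P (h # hs) (False # l)) (trace_count A P (h # hs) (True # l)))"
    proof (intro sum_mono)
      fix l
      let ?Q = "{x\<in>P. map (A x) hs = l}"
      have "\<delta> / 2 * (real (card ?Q) - of_bool (card ?Q > 0))
        \<le> (\<Sum>h\<in>I. min (real (card {x\<in>?Q. A x h = False})) (real (card {x\<in>?Q. A x h = True})))"
        using assms P by (intro sum_min_split_ge) auto
      moreover have "real (card {x\<in>?Q. A x h = b}) = trace_count A P (h # hs) (b # l)" for b h
        unfolding trace_count_def by (rule arg_cong[where f="\<lambda>X. real (card X)"]) auto
      ultimately show "\<delta> / 2 * (trace_count A P hs l - of_bool (trace_count A P hs l > 0))
        \<le> (\<Sum>h\<in>I. min (trace_count A P (h # hs) (False # l)) (trace_count A P (h # hs) (True # l)))"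
        by (simp only: trace_count_def[of A P hs] of_nat_0_less_iff)
    qed
    finally show "\<delta> / 2 * (real (card P) - card ((\<lambda>x. map (A x) hs) ` P)) \<le>
       (\<Sum>h\<in>I. \<Sum>l | length l = s.
           min (trace_count A P (h # hs) (False # l)) (trace_count A P (h # hs) (True # l)))"
      by (subst sum.swap)
  qed
  {
    case 0
    from head[of P 0] 0 show ?case
      by (simp add: sum_lists_Suc[OF assms(1)] cong: conj_cong)
  next
    case (Suc s)
    let ?L = "\<lambda>s. {hs. set hs \<subseteq> I \<and> length hs = s}"
    let ?P = "\<lambda>h b. {x\<in>P. A x h = b}"
    have fin: "finite (?P h b)" for h b using Suc.prems(1) by simp
    have IH: "\<delta> / 2 * real (Suc s) * (\<Sum>hs\<in>?L s. real (card (?P h b)) - card ((\<lambda>x. map (A x) hs) ` ?P h b))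
      \<le> (\<Sum>hs\<in>?L (Suc s). edge_weight (Suc s) (trace_count A (?P h b) hs))" for h b
      by (rule Suc.IH) (use Suc.prems in auto)
    have split: "real (card P) - card ((\<lambda>x. map (A x) (h # hs)) ` P)
      = (real (card (?P h False)) - card ((\<lambda>x. map (A x) hs) ` ?P h False))
      + (real (card (?P h True)) - card ((\<lambda>x. map (A x) hs) ` ?P h True))" for h hs
    proof -
      have P: "P = ?P h False \<union> ?P h True" by auto
      have 1: "card P = card (?P h False) + card (?P h True)"
        by (subst P, rule card_Un_disjoint[OF fin fin]) auto
      have "(\<lambda>x. map (A x) (h # hs)) ` P =
        (#) False ` ((\<lambda>x. map (A x) hs) ` ?P h False) \<union> (#) True ` ((\<lambda>x. map (A x) hs) ` ?P h True)"
        by (auto simp: image_iff)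
      also have "card \<dots> = card ((\<lambda>x. map (A x) hs) ` ?P h False) + card ((\<lambda>x. map (A x) hs) ` ?P h True)"
        using Suc.prems(1) by (subst card_Un_disjoint) (auto simp: card_image)
      finally show ?thesis using 1 by simp
    qed
    have tail: "\<delta> / 2 * real (Suc s) * (\<Sum>hs\<in>?L (Suc s). real (card P) - card ((\<lambda>x. map (A x) hs) ` P))
      \<le> (\<Sum>h\<in>I. \<Sum>hs\<in>?L (Suc s). edge_weight (Suc s) (trace_count A (?P h False) hs)
           + edge_weight (Suc s) (trace_count A (?P h True) hs))"
    proof -
      have "\<delta> / 2 * real (Suc s) * (\<Sum>hs\<in>?L (Suc s). real (card P) - card ((\<lambda>x. map (A x) hs) ` P))
        = (\<Sum>h\<in>I. \<delta> / 2 * real (Suc s) * (\<Sum>hs\<in>?L s. real (card (?P h False)) - card ((\<lambda>x. map (A x) hs) ` ?P h False))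
         + \<delta> / 2 * real (Suc s) * (\<Sum>hs\<in>?L s. real (card (?P h True)) - card ((\<lambda>x. map (A x) hs) ` ?P h True)))"
        by (subst sum_lists_Suc[OF assms(1)])
           (simp only: split sum.distrib[symmetric] sum_distrib_left distrib_left[symmetric])
      also have "\<dots> \<le> (\<Sum>h\<in>I. (\<Sum>hs\<in>?L (Suc s). edge_weight (Suc s) (trace_count A (?P h False) hs))
         + (\<Sum>hs\<in>?L (Suc s). edge_weight (Suc s) (trace_count A (?P h True) hs)))"
        by (intro sum_mono add_mono IH)
      finally show ?thesis by (simp only: sum.distrib)
    qed
    have "\<delta> / 2 * real (Suc (Suc s)) * (\<Sum>hs\<in>?L (Suc s). real (card P) - card ((\<lambda>x. map (A x) hs) ` P))
      = \<delta> / 2 * (\<Sum>hs\<in>?L (Suc s). real (card P) - card ((\<lambda>x. map (A x) hs) ` P))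
      + \<delta> / 2 * real (Suc s) * (\<Sum>hs\<in>?L (Suc s). real (card P) - card ((\<lambda>x. map (A x) hs) ` P))"
      by (simp only: of_nat_Suc[of "Suc s"] distrib_left distrib_right mult_1_right)
    also have "\<dots> \<le> (\<Sum>hs\<in>?L (Suc s). \<Sum>h\<in>I. \<Sum>l | length l = Suc s.
           min (trace_count A P (h # hs) (False # l)) (trace_count A P (h # hs) (True # l)))
       + (\<Sum>h\<in>I. \<Sum>hs\<in>?L (Suc s). edge_weight (Suc s) (trace_count A (?P h False) hs)
           + edge_weight (Suc s) (trace_count A (?P h True) hs))"
      by (rule add_mono[OF head[OF Suc.prems] tail])
    also have "\<dots> = (\<Sum>h\<in>I. \<Sum>hs\<in>?L (Suc s). edge_weight (Suc (Suc s)) (trace_count A P (h # hs)))"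
      unfolding edge_weight.simps(2)[of "Suc s"] trace_count_Cons
      by (subst sum.swap) (simp only: sum.distrib add.assoc)
    also have "\<dots> = (\<Sum>hs\<in>?L (Suc (Suc s)). edge_weight (Suc (Suc s)) (trace_count A P hs))"
      by (rule sum_lists_Suc[OF assms(1), symmetric])
    finally show ?case .
  }
qed

text \<open>The edge weight of the traces, summed over samples of length s+1, is at most D per point
  by the VC bound and at least of order \<delta> (s+1) for each point in excess of the number of
  traces. As there are at most (s+1)^D traces, a much larger \<open>P\<close> is impossible.\<close>

theorem haussler_packing:
  fixes A :: "'x \<Rightarrow> 'h \<Rightarrow> bool" and \<delta> :: real
  assumes I: "finite I" "I \<noteq> {}" and P: "finite P"
    and sep: "\<And>x y. x \<in> P \<Longrightarrow> y \<in> P \<Longrightarrow> x \<noteq> y \<Longrightarrow>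
       real (card {h\<in>I. A x h \<noteq> A y h}) \<ge> \<delta> * card I"
    and \<delta>: "\<delta> > 0" "\<delta> \<le> 1" and D: "D \<ge> 1"
    and vc: "\<And>hs. set hs \<subseteq> I \<Longrightarrow> vc_le D (length hs) ((\<lambda>x. map (A x) hs) ` P)"
  shows "real (card P) \<le> 2 * (5 * real D / \<delta>) ^ D"
proof -
  \<comment> \<open>The length balances the two counts: s+1 is at least 4 D / \<delta>, so each
    excess point weighs \<delta> / 2 * (s+1) \<ge> 2 D, twice what \<open>edge_weight_le\<close>
    allows per point.\<close>
  define s where "s = nat \<lceil>4 * D / \<delta>\<rceil> - 1"
  have pos: "4 * D / \<delta> > 0" using D \<delta> by simp
  have s: "real (Suc s) \<ge> 4 * D / \<delta>" "real (Suc s) \<le> 4 * D / \<delta> + 1"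
    using pos unfolding s_def by linarith+
  let ?L = "\<lambda>s. {hs. set hs \<subseteq> I \<and> length hs = s}"
  let ?n = "real (card I)"
  have n: "?n > 0" using I by (simp add: card_gt_0_iff)
  have card_L: "real (card (?L s)) = ?n ^ s" for s using card_lists_length_eq[OF I(1), of s] by simp
  have "edge_weight (Suc s) (trace_count A P hs) \<le> real D * card P" if hs: "hs \<in> ?L (Suc s)" for hs
  proof -
    have "vc_le D (Suc s) {l. length l = Suc s \<and> trace_count A P hs l > 0}"
    proof -
      have "{l. length l = Suc s \<and> trace_count A P hs l > 0} = (\<lambda>x. map (A x) hs) ` P"
        using hs P by (auto simp: trace_count_def card_gt_0_iff)
      then show ?thesis using vc[of hs] hs by simp
    qed
    then have "edge_weight (Suc s) (trace_count A P hs) \<le> D * (\<Sum>l | length l = Suc s. trace_count A P hs l)"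
      by (intro edge_weight_le) (auto simp: trace_count_def)
    then show ?thesis using sum_trace_count(1)[OF P, where hs = hs and A = A] hs by simp
  qed
  then have "(\<Sum>hs\<in>?L (Suc s). edge_weight (Suc s) (trace_count A P hs)) \<le> (\<Sum>hs\<in>?L (Suc s). real D * card P)"
    by (intro sum_mono)
  also have "\<dots> = real D * card P * ?n ^ Suc s" using card_L[of "Suc s"] by simp
  finally have up: "(\<Sum>hs\<in>?L (Suc s). edge_weight (Suc s) (trace_count A P hs)) \<le> real D * card P * ?n ^ Suc s" .
  have "(real (card P) - real (s + 1) ^ D) * ?n ^ s = (\<Sum>hs\<in>?L s. real (card P) - real (s + 1) ^ D)"
    using card_L[of s] by simp
  also have "\<dots> \<le> (\<Sum>hs\<in>?L s. real (card P) - card ((\<lambda>x. map (A x) hs) ` P))"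
  proof (intro sum_mono diff_left_mono)
    fix hs assume hs: "hs \<in> ?L s"
    have "card ((\<lambda>x. map (A x) hs) ` P) \<le> (s + 1) ^ D"
      using vc[of hs] hs by (intro sauer_shelah) auto
    then show "real (card ((\<lambda>x. map (A x) hs) ` P)) \<le> real (s + 1) ^ D"
      by (metis of_nat_le_iff of_nat_power)
  qed
  finally have "\<delta> * ?n / 2 * real (Suc s) * ((real (card P) - real (s + 1) ^ D) * ?n ^ s)
     \<le> \<delta> * ?n / 2 * real (Suc s) * (\<Sum>hs\<in>?L s. real (card P) - card ((\<lambda>x. map (A x) hs) ` P))"
    using \<delta> n by (intro mult_left_mono) auto
  also have "\<dots> \<le> real D * card P * ?n ^ Suc s"
  proof -
    have "\<delta> * ?n / 2 * real (Suc s) * (\<Sum>hs\<in>?L s. real (card P) - card ((\<lambda>x. map (A x) hs) ` P))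
      \<le> (\<Sum>hs\<in>?L (Suc s). edge_weight (Suc s) (trace_count A P hs))"
      by (rule sum_edge_weight_ge[OF I(1) P sep]) (use \<delta> in auto)
    with up show ?thesis by (rule order_trans[rotated])
  qed
  finally have "(\<delta> / 2 * real (Suc s) * (real (card P) - real (s + 1) ^ D)) * ?n ^ Suc s \<le> (real D * card P) * ?n ^ Suc s"
    by (simp only: power_Suc mult_ac times_divide_eq_left times_divide_eq_right)
  then have main: "\<delta> / 2 * real (Suc s) * (real (card P) - real (s + 1) ^ D) \<le> real D * card P"
    using n by (simp del: power_Suc)
  have "real (card P) \<le> 2 * real (s + 1) ^ D"
  proof (rule ccontr)
    assume neg: "\<not> ?thesis"
    have "2 * D \<le> \<delta> / 2 * real (Suc s)"
      using s(1) \<delta> by (simp add: field_simps)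
    moreover have "0 \<le> real (card P) - real (s + 1) ^ D" using neg
      by (smt (verit) of_nat_power zero_le_power of_nat_0_le_iff)
    ultimately have "2 * D * (real (card P) - real (s + 1) ^ D) \<le> real D * card P"
      using main by (smt (verit, best) mult_right_mono)
    then have "D * (2 * (real (card P) - real (s + 1) ^ D)) \<le> D * real (card P)" by (simp add: algebra_simps)
    then have "2 * (real (card P) - real (s + 1) ^ D) \<le> card P" using D by simp
    then show False using neg by simp
  qed
  also have "\<dots> \<le> 2 * (5 * real D / \<delta>) ^ D"
  proof -
    have "1 \<le> D / \<delta>" using \<delta> D by (simp add: field_simps)
    then have "real (s + 1) \<le> 5 * real D / \<delta>" using s(2) by simp
    then show ?thesis by (intro mult_left_mono power_mono) auto
  qed
  finally show ?thesis .
qed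

section \<open>Partial colouring\<close>

text \<open>Independence of uniformly random signs in counting form: expectations are sums over
  \<open>Pow I\<close>, so no probability space is built.\<close>

lemma sum_Pow_prod:
  fixes F :: "'i \<Rightarrow> bool \<Rightarrow> real"
  assumes "finite I"
  shows "(\<Sum>X\<in>Pow I. \<Prod>i\<in>I. F i (i \<in> X)) = (\<Prod>i\<in>I. F i True + F i False)"
  using assms
proof (induction I rule: finite_induct)
  case (insert a I)
  have "(\<Sum>X\<in>Pow (insert a I). \<Prod>i\<in>insert a I. F i (i \<in> X))
    = (\<Sum>X\<in>Pow I. \<Prod>i\<in>insert a I. F i (i \<in> X))
    + (\<Sum>X\<in>insert a ` Pow I. \<Prod>i\<in>insert a I. F i (i \<in> X))"
    unfolding Pow_insert using insert.hyps by (intro sum.union_disjoint) auto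
  also have "(\<Sum>X\<in>Pow I. \<Prod>i\<in>insert a I. F i (i \<in> X)) = F a False * (\<Sum>X\<in>Pow I. \<Prod>i\<in>I. F i (i \<in> X))"
    unfolding sum_distrib_left using insert.hyps by (intro sum.cong refl) (auto simp: subset_eq)
  also have "inj_on (insert a) (Pow I)"
  proof (rule inj_onI)
    fix X Y assume "X \<in> Pow I" "Y \<in> Pow I" "insert a X = insert a Y"
    then show "X = Y" using insert.hyps(2) by (metis PowD insert_ident subsetD)
  qed
  then have "(\<Sum>X\<in>insert a ` Pow I. \<Prod>i\<in>insert a I. F i (i \<in> X))
      = (\<Sum>X\<in>Pow I. \<Prod>i\<in>insert a I. F i (i \<in> insert a X))"
    by (simp add: sum.reindex)
  also have "\<dots> = (\<Sum>X\<in>Pow I. F a True * (\<Prod>i\<in>I. F i (i \<in> X)))"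
  proof (intro sum.cong refl)
    fix X
    have "(\<Prod>i\<in>I. F i (i \<in> insert a X)) = (\<Prod>i\<in>I. F i (i \<in> X))"
      using insert.hyps(2) by (intro prod.cong refl arg_cong[where f = "F _"]) blast
    then show "(\<Prod>i\<in>insert a I. F i (i \<in> insert a X)) = F a True * (\<Prod>i\<in>I. F i (i \<in> X))"
      using insert.hyps by simp
  qed
  finally show ?case
    using insert by (simp add: sum_distrib_left[symmetric] algebra_simps)
qed simp

text \<open>Termwise comparison of the even power series, from 2^n n! \<le> (2n)!.\<close>

lemma exp_add_exp_minus_le: "exp x + exp (- x) \<le> 2 * exp (x\<^sup>2 / 2)" for x :: real
proof -
  have *: "(2::real) ^ n * fact n \<le> fact (2 * n)" for n
  proof (induction n)
    case (Suc n)
    have "(2::real) ^ Suc n * fact (Suc n) = (2 * real (Suc n)) * (2 ^ n * fact n)" by simp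
    also have "\<dots> \<le> (2 * real (Suc n) * real (2 * n + 1)) * fact (2 * n)"
      using Suc.IH by (intro mult_mono) auto
    also have "\<dots> = fact (2 * Suc n)" by (simp add: algebra_simps)
    finally show ?case .
  qed simp
  have "(\<lambda>n. x ^ n /\<^sub>R fact n + (- x) ^ n /\<^sub>R fact n) sums (exp x + exp (- x))"
    by (intro sums_add exp_converges)
  moreover have "x ^ n /\<^sub>R fact n + (- x) ^ n /\<^sub>R fact n
      = (if even n then 2 * x ^ n / fact n else 0)" for n
    by (cases "even n") (auto simp: field_simps)
  ultimately have "(\<lambda>n. if even n then 2 * x ^ n / fact n else 0) sums (exp x + exp (- x))" by simp
  moreover have "strict_mono (\<lambda>n::nat. 2 * n)" by (simp add: strict_mono_def)
  moreover have "(if even n then 2 * x ^ n / fact n else 0) = 0"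
    if "n \<notin> range (\<lambda>n::nat. 2 * n)" for n
    using that by (auto elim!: evenE)
  ultimately have "(\<lambda>n. if even (2 * n) then 2 * x ^ (2 * n) / fact (2 * n) else 0) sums (exp x + exp (- x))"
    by (subst sums_mono_reindex) auto
  then have 1: "(\<lambda>n. 2 * x ^ (2 * n) / fact (2 * n)) sums (exp x + exp (- x))" by simp
  have 2: "(\<lambda>n. 2 * ((x\<^sup>2 / 2) ^ n /\<^sub>R fact n)) sums (2 * exp (x\<^sup>2 / 2))"
    by (intro sums_mult exp_converges)
  show ?thesis
  proof (rule sums_le[OF _ 1 2])
    fix n
    have "x ^ (2 * n) \<ge> 0" by (simp add: power_mult)
    moreover have "(0::real) < 2 ^ n * fact n" by simp
    ultimately have "x ^ (2 * n) / fact (2 * n) \<le> x ^ (2 * n) / (2 ^ n * fact n)"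
      using *[of n] by (metis frac_le order_refl)
    moreover have "(x\<^sup>2 / 2) ^ n /\<^sub>R fact n = x ^ (2 * n) / (2 ^ n * fact n)"
      by (simp add: power_divide power_mult[symmetric] field_simps)
    ultimately show "2 * x ^ (2 * n) / fact (2 * n) \<le> 2 * ((x\<^sup>2 / 2) ^ n /\<^sub>R fact n)"
      by linarith
  qed
qed

abbreviation sgn_of :: "'i set \<Rightarrow> 'i \<Rightarrow> real" where
  "sgn_of X i \<equiv> (if i \<in> X then 1 else - 1)"

lemma sum_exp_signs_le:
  assumes "finite I"
  shows "(\<Sum>X\<in>Pow I. exp (\<theta> * (\<Sum>i\<in>I. sgn_of X i * c i)))
     \<le> 2 ^ card I * exp (\<theta>\<^sup>2 * (\<Sum>i\<in>I. (c i)\<^sup>2) / 2)"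
proof -
  have "(\<Sum>X\<in>Pow I. exp (\<theta> * (\<Sum>i\<in>I. sgn_of X i * c i)))
    = (\<Sum>X\<in>Pow I. \<Prod>i\<in>I. exp (\<theta> * ((if i \<in> X then 1 else - 1) * c i)))"
    using assms by (simp add: sum_distrib_left exp_sum)
  also have "\<dots> = (\<Prod>i\<in>I. exp (\<theta> * c i) + exp (- (\<theta> * c i)))"
    using sum_Pow_prod[OF assms, of "\<lambda>i b. exp (\<theta> * ((if b then 1 else - 1) * c i))"] by simp
  also have "\<dots> \<le> (\<Prod>i\<in>I. 2 * exp ((\<theta> * c i)\<^sup>2 / 2))"
    by (intro prod_mono conjI exp_add_exp_minus_le add_nonneg_nonneg) auto
  also have "\<dots> = 2 ^ card I * exp (\<theta>\<^sup>2 * (\<Sum>i\<in>I. (c i)\<^sup>2) / 2)"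
    using assms by (simp add: prod.distrib exp_sum[symmetric] power_mult_distrib sum_distrib_left sum_divide_distrib)
  finally show ?thesis .
qed

lemma sum_exp_abs_signs_le:
  assumes "finite I" "(\<Sum>i\<in>I. (c i)\<^sup>2) \<le> s\<^sup>2"
  shows "(\<Sum>X\<in>Pow I. exp (\<theta> * \<bar>\<Sum>i\<in>I. sgn_of X i * c i\<bar>)) \<le> 2 ^ card I * (2 * exp (\<theta>\<^sup>2 * s\<^sup>2 / 2))"
proof -
  have "exp (\<theta> * \<bar>y\<bar>) \<le> exp (\<theta> * y) + exp (- \<theta> * y)" for y :: real
    by (cases "y \<ge> 0") auto
  then have "(\<Sum>X\<in>Pow I. exp (\<theta> * \<bar>\<Sum>i\<in>I. sgn_of X i * c i\<bar>))
    \<le> (\<Sum>X\<in>Pow I. exp (\<theta> * (\<Sum>i\<in>I. sgn_of X i * c i)) + exp (- \<theta> * (\<Sum>i\<in>I. sgn_of X i * c i)))"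
    by (intro sum_mono)
  also have "\<dots> \<le> 2 ^ card I * exp (\<theta>\<^sup>2 * (\<Sum>i\<in>I. (c i)\<^sup>2) / 2) + 2 ^ card I * exp ((- \<theta>)\<^sup>2 * (\<Sum>i\<in>I. (c i)\<^sup>2) / 2)"
    unfolding sum.distrib by (intro add_mono sum_exp_signs_le assms)
  also have "\<dots> = 2 ^ card I * (2 * exp (\<theta>\<^sup>2 * (\<Sum>i\<in>I. (c i)\<^sup>2) / 2))" by simp
  also have "\<dots> \<le> 2 ^ card I * (2 * exp (\<theta>\<^sup>2 * s\<^sup>2 / 2))"
    using assms(2) by (auto intro!: mult_left_mono divide_right_mono)
  finally show ?thesis .
qed

text \<open>Bounds the entropy of a random sign sum of variance at most \<open>s\<^sup>2\<close>, rounded to multiples of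
  \<open>2 \<mu> s\<close>.\<close>
definition window_cost :: "real \<Rightarrow> real" where
  "window_cost \<mu> = (if \<mu> \<ge> 2 then (4 + \<mu>\<^sup>2) * exp (- \<mu>\<^sup>2 / 2) else ln (1 + 2 / \<mu>) + 3)"

text \<open>The right-hand side is the normalising constant of the two-sided geometric distribution
  on the integers; partial sums over finite sets avoid infinite sums.\<close>

lemma sum_exp_neg_abs_int_le:
  assumes "\<gamma> > 0" "finite F"
  shows "(\<Sum>z\<in>F. exp (- \<gamma> * \<bar>real_of_int z\<bar>)) \<le> 1 + 2 / (exp \<gamma> - 1)"
proof -
  define r where "r = exp (- \<gamma>)"
  have r: "0 < r" "r < 1" using assms by (auto simp: r_def)
  have e: "exp (- \<gamma> * \<bar>real_of_int z\<bar>) = r ^ nat \<bar>z\<bar>" for z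
  proof -
    have "- \<gamma> * \<bar>real_of_int z\<bar> = of_nat (nat \<bar>z\<bar>) * - \<gamma>" by simp
    then show ?thesis unfolding r_def by (simp only: exp_of_nat_mult)
  qed
  obtain m :: nat where m: "F \<subseteq> {- int m..int m}"
  proof -
    define M where "M = (\<Sum>z\<in>F. nat \<bar>z\<bar>)"
    have "nat \<bar>z\<bar> \<le> M" if "z \<in> F" for z
      unfolding M_def using that assms(2) by (intro member_le_sum) auto
    then have "F \<subseteq> {- int M..int M}" by force
    then show ?thesis using that by blast
  qed
  have "(\<Sum>z\<in>F. exp (- \<gamma> * \<bar>real_of_int z\<bar>)) \<le> (\<Sum>z\<in>{- int m..int m}. r ^ nat \<bar>z\<bar>)"
    unfolding e using m r by (intro sum_mono2) auto
  also have "\<dots> = 1 + 2 * (r - r ^ Suc m) / (1 - r)"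
  proof (induction m)
    case (Suc m)
    have "{- int (Suc m)..int (Suc m)} = insert (- int (Suc m)) (insert (int (Suc m)) {- int m..int m})"
      by auto
    then have "(\<Sum>z\<in>{- int (Suc m)..int (Suc m)}. r ^ nat \<bar>z\<bar>)
      = 2 * r ^ Suc m + (\<Sum>z\<in>{- int m..int m}. r ^ nat \<bar>z\<bar>)"
      by (simp add: nat_add_distrib)
    then show ?case using Suc r by (simp add: field_simps)
  qed simp
  also have "\<dots> \<le> 1 + 2 * r / (1 - r)" using r by (simp add: divide_right_mono)
  also have "r / (1 - r) = 1 / (exp \<gamma> - 1)" 
    using r assms by (simp add: r_def exp_minus field_simps)
  then have "1 + 2 * r / (1 - r) = 1 + 2 / (exp \<gamma> - 1)" by (metis times_divide_eq_right mult.right_neutral)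
  finally show ?thesis .
qed

text \<open>\<open>q\<close> is a two-sided geometric distribution serving as a code for the rounded
  sum; the average of \<open>- ln q\<close> over all signs bounds its entropy. The decay rate is
  \<mu>^2 / 2 for wide windows, where the sum rounds to 0 except with probability about exp (-
  \<mu>^2 / 2), and \<mu> for narrow ones, where the rounded value has size about 1 / \<mu>.\<close>

lemma window_cost_bound:
  assumes "finite I" "(\<Sum>i\<in>I. (c i)\<^sup>2) \<le> s\<^sup>2" "s > 0" "\<mu> > 0"
  obtains q :: "int \<Rightarrow> real" where "\<And>z. q z > 0" "\<And>F. finite F \<Longrightarrow> sum q F \<le> 1"
    "(\<Sum>X\<in>Pow I. - ln (q \<lfloor>(\<Sum>i\<in>I. sgn_of X i * c i) / (2 * (\<mu> * s)) + 1/2\<rfloor>)) \<le> 2 ^ card I * window_cost \<mu>"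
proof -
  note result = that
  define \<Delta> where "\<Delta> = \<mu> * s"
  have \<Delta>: "\<Delta> > 0" using assms by (simp add: \<Delta>_def)
  define y where "y = (\<lambda>X. \<Sum>i\<in>I. sgn_of X i * c i)"
  define Z where "Z = (\<lambda>X. \<lfloor>y X / (2 * \<Delta>) + 1/2\<rfloor>)"
  \<comment> \<open>Cells have width 2 \<Delta>, so the cell of 0 contains all |y| < \<Delta>;
    outside it, |u|/2 + 1/2 \<le> |u|.\<close>
  have Z: "\<bar>real_of_int (Z X)\<bar> \<le> (if \<bar>y X\<bar> / \<Delta> < 1 then 0 else \<bar>y X\<bar> / \<Delta>)" for X
  proof -
    define u where "u = y X / \<Delta>"
    have u: "y X / (2 * \<Delta>) = u / 2" "\<bar>y X\<bar> / \<Delta> = \<bar>u\<bar>" using \<Delta> by (auto simp: u_def)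
    have "Z X = \<lfloor>u / 2 + 1/2\<rfloor>" unfolding Z_def u ..
    then have "real_of_int (Z X) \<le> u / 2 + 1/2" "u / 2 + 1/2 < real_of_int (Z X) + 1" by linarith+
    moreover have "Z X = 0" if "\<bar>u\<bar> < 1" using that \<open>Z X = _\<close> by (simp add: floor_eq_iff) linarith
    ultimately show ?thesis unfolding u by (auto simp: abs_if)
  qed
  have main: thesis if \<gamma>: "\<gamma> > 0" and cost:
    "(\<Sum>X\<in>Pow I. ln (1 + 2 / (exp \<gamma> - 1)) + \<gamma> * \<bar>real_of_int (Z X)\<bar>) \<le> 2 ^ card I * window_cost \<mu>" for \<gamma>
  proof -
    define K where "K = 1 + 2 / (exp \<gamma> - 1)"
    have K: "K > 0" unfolding K_def using \<gamma> by (simp add: add_pos_pos)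
    define q where "q = (\<lambda>z::int. exp (- \<gamma> * \<bar>real_of_int z\<bar>) / K)"
    show thesis
    proof (rule result)
      show "q z > 0" for z using K by (simp add: q_def)
      show "sum q F \<le> 1" if "finite F" for F
        using sum_exp_neg_abs_int_le[OF \<gamma> that] K
        unfolding q_def sum_divide_distrib[symmetric] K_def[symmetric] by simp
      have "- ln (q (Z X)) = ln K + \<gamma> * \<bar>real_of_int (Z X)\<bar>" for X
        using K by (simp add: q_def ln_div)
      then have "(\<Sum>X\<in>Pow I. - ln (q (Z X))) \<le> 2 ^ card I * window_cost \<mu>"
        using cost by (simp only: K_def)
      then show "(\<Sum>X\<in>Pow I. - ln (q \<lfloor>(\<Sum>i\<in>I. sgn_of X i * c i) / (2 * (\<mu> * s)) + 1/2\<rfloor>))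
         \<le> 2 ^ card I * window_cost \<mu>"
        by (simp only: Z_def y_def \<Delta>_def)
    qed
  qed
  show thesis
  proof (cases "\<mu> \<ge> 2")
    case True
    then have l2: "\<mu>\<^sup>2 \<ge> 4" using power_mono[of 2 \<mu> 2] by simp
    define \<gamma> where "\<gamma> = \<mu>\<^sup>2 / 2"
    have \<gamma>: "\<gamma> \<ge> 2" using l2 by (simp add: \<gamma>_def)
    have eg: "exp \<gamma> \<ge> 2" using exp_ge_add_one_self[of \<gamma>] \<gamma> by linarith
    have "ln (1 + 2 / (exp \<gamma> - 1)) \<le> 2 / (exp \<gamma> - 1)"
      using eg \<gamma> by (intro ln_add_one_self_le_self) auto
    also have "\<dots> \<le> 4 * exp (- \<gamma>)" 
    proof -
      have "exp (- \<gamma>) \<le> 1 / 2" using eg by (simp add: exp_minus field_simps)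
      moreover have "4 * exp (- \<gamma>) * (exp \<gamma> - 1) = 4 * (exp (- \<gamma>) * exp \<gamma>) - 4 * exp (- \<gamma>)"
        by (simp only: right_diff_distrib mult.assoc mult_1_right)
      moreover have "exp (- \<gamma>) * exp \<gamma> = 1" by (simp add: exp_minus)
      ultimately have "2 \<le> 4 * exp (- \<gamma>) * (exp \<gamma> - 1)" by linarith
      then show ?thesis using eg \<gamma> by (subst pos_divide_le_eq) auto
    qed
    finally have 1: "ln (1 + 2 / (exp \<gamma> - 1)) \<le> 4 * exp (- \<gamma>)" .
    \<comment> \<open>Exponential Chebyshev bound with parameter \<mu> / s: equality holds at |y| =
      \<Delta>, where (\<mu> / s) |y| = \<mu>^2, and beyond that point the exponential grows faster
      than |y| / \<Delta>.\<close>
    have 2: "\<bar>real_of_int (Z X)\<bar> \<le> exp (- \<mu>\<^sup>2) * exp ((\<mu> / s) * \<bar>y X\<bar>)" for X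
    proof (cases "\<bar>y X\<bar> / \<Delta> < 1")
      case True
      with Z[of X] show ?thesis by simp
    next
      case False
      define u where "u = \<bar>y X\<bar> / \<Delta>"
      have u: "u \<ge> 1" using False by (simp add: u_def)
      have "\<bar>real_of_int (Z X)\<bar> \<le> 1 + (u - 1)" using Z[of X] False by (simp add: u_def)
      also have "\<dots> \<le> 1 + \<mu>\<^sup>2 * (u - 1)" using mult_right_mono[of 1 "\<mu>\<^sup>2" "u - 1"] l2 u by simp
      also have "\<dots> \<le> exp (\<mu>\<^sup>2 * (u - 1))" by (rule exp_ge_add_one_self)
      also have "\<mu>\<^sup>2 * (u - 1) = - \<mu>\<^sup>2 + (\<mu> / s) * \<bar>y X\<bar>"
        using assms by (simp add: u_def \<Delta>_def field_simps power2_eq_square)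
      finally show ?thesis by (simp only: exp_add)
    qed
    have "(\<Sum>X\<in>Pow I. \<bar>real_of_int (Z X)\<bar>) \<le> exp (- \<mu>\<^sup>2) * (\<Sum>X\<in>Pow I. exp ((\<mu> / s) * \<bar>y X\<bar>))"
      unfolding sum_distrib_left by (intro sum_mono 2)
    also have "\<dots> \<le> exp (- \<mu>\<^sup>2) * (2 ^ card I * (2 * exp ((\<mu> / s)\<^sup>2 * s\<^sup>2 / 2)))"
      unfolding y_def by (intro mult_left_mono sum_exp_abs_signs_le assms) auto
    also have "(\<mu> / s)\<^sup>2 * s\<^sup>2 / 2 = \<gamma>" using assms by (simp add: \<gamma>_def power_divide)
    also have "exp (- \<mu>\<^sup>2) = exp (- \<gamma>) * exp (- \<gamma>)" by (simp add: exp_add[symmetric] \<gamma>_def)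
    also have "exp (- \<gamma>) * exp (- \<gamma>) * (2 ^ card I * (2 * exp \<gamma>)) = 2 ^ card I * (2 * exp (- \<gamma>))"
      by (simp add: exp_minus)
    finally have 3: "(\<Sum>X\<in>Pow I. \<bar>real_of_int (Z X)\<bar>) \<le> 2 ^ card I * (2 * exp (- \<gamma>))" .
    show thesis
    proof (rule main)
      show "\<gamma> > 0" using \<gamma> by simp
      have "(\<Sum>X\<in>Pow I. ln (1 + 2 / (exp \<gamma> - 1)) + \<gamma> * \<bar>real_of_int (Z X)\<bar>)
        = 2 ^ card I * ln (1 + 2 / (exp \<gamma> - 1)) + \<gamma> * (\<Sum>X\<in>Pow I. \<bar>real_of_int (Z X)\<bar>)"
        using assms(1) by (simp add: sum.distrib card_Pow sum_distrib_left)
      also have "\<dots> \<le> 2 ^ card I * (4 * exp (- \<gamma>)) + \<gamma> * (2 ^ card I * (2 * exp (- \<gamma>)))"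
        using 1 3 \<gamma> by (intro add_mono mult_left_mono) auto
      also have "\<dots> = 2 ^ card I * window_cost \<mu>"
        using True by (simp add: window_cost_def \<gamma>_def algebra_simps)
      finally show "(\<Sum>X\<in>Pow I. ln (1 + 2 / (exp \<gamma> - 1)) + \<gamma> * \<bar>real_of_int (Z X)\<bar>) \<le> 2 ^ card I * window_cost \<mu>" .
    qed
  next
    case False
    \<comment> \<open>For narrow windows x \<le> exp x - 1 with parameter 1 / s is enough; with exp
      (1/2) \<le> 2 the average becomes 2 * 2 - 1 = 3, the additive constant of
      \<open>window_cost\<close>.\<close>
    have 2: "\<mu> * \<bar>real_of_int (Z X)\<bar> \<le> exp ((1 / s) * \<bar>y X\<bar>) - 1" for X
    proof -
      have "\<bar>real_of_int (Z X)\<bar> \<le> \<bar>y X\<bar> / \<Delta>" using Z[of X] \<Delta> by (auto split: if_splits)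
      then have "\<mu> * \<bar>real_of_int (Z X)\<bar> \<le> (1 / s) * \<bar>y X\<bar>"
        using assms by (simp add: \<Delta>_def field_simps)
      then show ?thesis using exp_ge_add_one_self[of "(1 / s) * \<bar>y X\<bar>"] by linarith
    qed
    have "(\<Sum>X\<in>Pow I. \<mu> * \<bar>real_of_int (Z X)\<bar>) \<le> (\<Sum>X\<in>Pow I. exp ((1 / s) * \<bar>y X\<bar>) - 1)"
      by (intro sum_mono 2)
    also have "\<dots> \<le> 2 ^ card I * (2 * exp ((1 / s)\<^sup>2 * s\<^sup>2 / 2)) - 2 ^ card I"
      using sum_exp_abs_signs_le[OF assms(1,2), of "1 / s"] assms(1)
      unfolding y_def sum_subtractf by (simp add: card_Pow)
    also have "(1 / s)\<^sup>2 * s\<^sup>2 / 2 = 1 / 2" using assms by (simp add: power_divide)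
    also have "2 ^ card I * (2 * exp (1 / 2)) - 2 ^ card I \<le> 2 ^ card I * (3::real)"
      using exp_half_le2 by simp
    finally have 3: "(\<Sum>X\<in>Pow I. \<mu> * \<bar>real_of_int (Z X)\<bar>) \<le> 2 ^ card I * 3" .
    show thesis
    proof (rule main)
      show "\<mu> > 0" by fact
      have "2 / (exp \<mu> - 1) \<le> 2 / \<mu>"
        using exp_ge_add_one_self[of \<mu>] assms(4) by (intro divide_left_mono mult_pos_pos) (auto simp: algebra_simps)
      moreover have "2 / (exp \<mu> - 1) > 0" using assms(4) by simp
      ultimately have "ln (1 + 2 / (exp \<mu> - 1)) \<le> ln (1 + 2 / \<mu>)" using assms(4)
        by (subst ln_le_cancel_iff) (auto intro: add_pos_pos)
      then have "2 ^ card I * ln (1 + 2 / (exp \<mu> - 1)) + (\<Sum>X\<in>Pow I. \<mu> * \<bar>real_of_int (Z X)\<bar>)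
        \<le> 2 ^ card I * ln (1 + 2 / \<mu>) + 2 ^ card I * 3"
        by (intro add_mono 3 mult_left_mono) auto
      then show "(\<Sum>X\<in>Pow I. ln (1 + 2 / (exp \<mu> - 1)) + \<mu> * \<bar>real_of_int (Z X)\<bar>) \<le> 2 ^ card I * window_cost \<mu>"
        using assms(1) False by (simp add: sum.distrib card_Pow window_cost_def algebra_simps)
    qed
  qed
qed

section \<open>Large fibres of the rounding map and partial colouring\<close>

text \<open>Kraft's inequality for the product code. Extensionality embeds \<open>V\<close> in a
  product of finite value sets, over which the sum factorises.\<close>

lemma sum_prod_image_le_1:
  fixes q :: "'t \<Rightarrow> int \<Rightarrow> real"
  assumes "finite T" "finite V" "V \<subseteq> extensional T"
    and q: "\<And>t z. t \<in> T \<Longrightarrow> q t z > 0" "\<And>t F. t \<in> T \<Longrightarrow> finite F \<Longrightarrow> sum (q t) F \<le> 1"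
  shows "(\<Sum>v\<in>V. \<Prod>t\<in>T. q t (v t)) \<le> 1"
proof -
  have "V \<subseteq> (\<Pi>\<^sub>E t\<in>T. (\<lambda>v. v t) ` V)" using assms(3) by (auto simp: PiE_def)
  then have "(\<Sum>v\<in>V. \<Prod>t\<in>T. q t (v t)) \<le> (\<Sum>v\<in>(\<Pi>\<^sub>E t\<in>T. (\<lambda>v. v t) ` V). \<Prod>t\<in>T. q t (v t))"
    using assms by (intro sum_mono2 finite_PiE prod_nonneg ballI)
      (auto simp: PiE_iff intro: less_imp_le)
  also have "\<dots> = (\<Prod>t\<in>T. \<Sum>z\<in>(\<lambda>v. v t) ` V. q t z)"
    using assms by (intro prod_sum_PiE[symmetric]) auto
  also have "\<dots> \<le> 1"
    using assms by (intro prod_le_1 conjI sum_nonneg q finite_imageI) (auto intro: less_imp_le)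
  finally show ?thesis .
qed

text \<open>Jensen's inequality for \<open>exp\<close> turns the average code length into a lower bound for the largest
  fibre; no Shannon entropy is needed.\<close>
lemma entropy_pigeonhole:
  fixes Z :: "'w \<Rightarrow> 't \<Rightarrow> int" and q :: "'t \<Rightarrow> int \<Rightarrow> real" and L :: real
  assumes "finite W" "W \<noteq> {}" "finite T"
    and q: "\<And>t z. t \<in> T \<Longrightarrow> q t z > 0" "\<And>t F. t \<in> T \<Longrightarrow> finite F \<Longrightarrow> sum (q t) F \<le> 1"
    and cost: "(\<Sum>t\<in>T. \<Sum>w\<in>W. - ln (q t (Z w t))) \<le> card W * L"
  obtains w0 where "w0 \<in> W" "real (card {w\<in>W. \<forall>t\<in>T. Z w t = Z w0 t}) \<ge> card W * exp (- L)"
proof (rule ccontr)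
  note result = that
  assume neg: "\<not> thesis"
  define v where "v = (\<lambda>w. restrict (Z w) T)"
  define Q where "Q = (\<lambda>f. \<Prod>t\<in>T. q t (f t))"
  have Qpos: "Q f > 0" for f unfolding Q_def using q(1) by (intro prod_pos) auto
  have fib: "{w\<in>W. v w = v w0} = {w\<in>W. \<forall>t\<in>T. Z w t = Z w0 t}" for w0
    unfolding v_def by (auto simp: restrict_def fun_eq_iff)
  have small: "real (card {w\<in>W. v w = v w0}) < card W * exp (- L)" if "w0 \<in> W" for w0
    using neg result[OF that] unfolding fib by (meson not_le)
  have "card W * exp (- L) \<le> (\<Sum>w\<in>W. exp (- L) * (1 + (ln (Q (v w)) + L)))"
  proof -
    have "ln (Q (v w)) = - (\<Sum>t\<in>T. - ln (q t (Z w t)))" for w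
      unfolding Q_def v_def using q(1) assms(3)
      by (subst ln_prod) (auto simp: sum_negf dest!: q(1)[THEN less_imp_neq])
    then have "(\<Sum>w\<in>W. ln (Q (v w))) = - (\<Sum>t\<in>T. \<Sum>w\<in>W. - ln (q t (Z w t)))"
      by (subst sum.swap) (simp add: sum_negf)
    with cost have "0 \<le> (\<Sum>w\<in>W. ln (Q (v w)) + L)" by (simp add: sum.distrib)
    then have "0 \<le> exp (- L) * (\<Sum>w\<in>W. ln (Q (v w)) + L)" by simp
    then show ?thesis by (simp add: sum.distrib sum_distrib_left distrib_left mult_ac)
  qed
  also have "\<dots> \<le> (\<Sum>w\<in>W. Q (v w))"
  proof (intro sum_mono)
    fix w
    have "exp (- L) * (1 + (ln (Q (v w)) + L)) \<le> exp (- L) * exp (ln (Q (v w)) + L)"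
      by (intro mult_left_mono exp_ge_add_one_self) auto
    also have "\<dots> = Q (v w)" using Qpos[of "v w"] by (simp add: exp_add[symmetric])
    finally show "exp (- L) * (1 + (ln (Q (v w)) + L)) \<le> Q (v w)" .
  qed
  also have "\<dots> = (\<Sum>f\<in>v ` W. \<Sum>w | w \<in> W \<and> v w = f. Q (v w))"
    using assms(1) by (subst sum.image_gen[of _ _ v]) auto
  also have "\<dots> = (\<Sum>f\<in>v ` W. card {w\<in>W. v w = f} * Q f)" by (intro sum.cong refl) simp
  also have "\<dots> < (\<Sum>f\<in>v ` W. (card W * exp (- L)) * Q f)"
    using assms(1,2) small Qpos by (intro sum_strict_mono mult_strict_right_mono) auto
  also have "\<dots> = card W * exp (- L) * (\<Sum>f\<in>v ` W. Q f)" by (simp add: sum_distrib_left)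
  also have "\<dots> \<le> card W * exp (- L) * 1"
    unfolding Q_def using assms
    by (intro mult_left_mono sum_prod_image_le_1) (auto simp: v_def)
  finally show False by simp
qed

text \<open>Beck's method: some fibre of the rounding map has at least 2^N exp (- N/4) sign
  patterns, too many to lie within Hamming distance N/10 of one of them. Half the difference of two
  distant patterns has entries -1, 0 and 1, and since both share all cells of width 2 \<mu> s, each
  of its sums is at most \<mu> s.\<close>

theorem partial_coloring:
  fixes c :: "'t \<Rightarrow> 'i \<Rightarrow> real"
  assumes I: "finite I" "I \<noteq> {}" and T: "finite T"
    and var: "\<And>t. t \<in> T \<Longrightarrow> (\<Sum>i\<in>I. (c t i)\<^sup>2) \<le> (s t)\<^sup>2"
    and pos: "\<And>t. t \<in> T \<Longrightarrow> s t > 0" "\<And>t. t \<in> T \<Longrightarrow> \<mu> t > 0"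
    and cost: "(\<Sum>t\<in>T. window_cost (\<mu> t)) \<le> card I / 4"
  obtains \<xi> :: "'i \<Rightarrow> real" where "\<And>i. \<xi> i \<in> {-1, 0, 1}"
    "real (card {i\<in>I. \<xi> i \<noteq> 0}) \<ge> card I / 10"
    "\<And>t. t \<in> T \<Longrightarrow> \<bar>\<Sum>i\<in>I. \<xi> i * c t i\<bar> \<le> \<mu> t * s t"
proof -
  define N where "N = card I"
  have N: "N > 0" using I by (simp add: N_def card_gt_0_iff)
  define y where "y = (\<lambda>X t. \<Sum>i\<in>I. sgn_of X i * c t i)"
  define Z where "Z = (\<lambda>X t. \<lfloor>y X t / (2 * (\<mu> t * s t)) + 1/2\<rfloor>)"
  define R where "R = (\<lambda>t q. (\<forall>z. q z > 0) \<and> (\<forall>F. finite F \<longrightarrow> sum q F \<le> (1::real)) \<and>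
     (\<Sum>X\<in>Pow I. - ln (q (Z X t))) \<le> 2 ^ N * window_cost (\<mu> t))"
  have "\<exists>q. R t q" if t: "t \<in> T" for t
    by (rule window_cost_bound[OF I(1) var[OF t] pos[OF t]])
       (unfold R_def Z_def y_def N_def, blast)
  then obtain q where "R t (q t)" if "t \<in> T" for t by metis
  then have q: "\<And>t z. t \<in> T \<Longrightarrow> q t z > 0" "\<And>t F. t \<in> T \<Longrightarrow> finite F \<Longrightarrow> sum (q t) F \<le> 1"
     "\<And>t. t \<in> T \<Longrightarrow> (\<Sum>X\<in>Pow I. - ln (q t (Z X t))) \<le> 2 ^ N * window_cost (\<mu> t)"
    unfolding R_def by blast+
  have "(\<Sum>t\<in>T. \<Sum>X\<in>Pow I. - ln (q t (Z X t))) \<le> (\<Sum>t\<in>T. 2 ^ N * window_cost (\<mu> t))"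
    by (intro sum_mono q)
  also have "\<dots> \<le> 2 ^ N * (N / 4)"
    using cost unfolding sum_distrib_left[symmetric] N_def by (intro mult_left_mono) auto
  finally have "(\<Sum>t\<in>T. \<Sum>X\<in>Pow I. - ln (q t (Z X t))) \<le> card (Pow I) * (N / 4)"
    using I by (simp add: card_Pow N_def)
  then obtain X0 where X0: "X0 \<in> Pow I"
      "real (card {X\<in>Pow I. \<forall>t\<in>T. Z X t = Z X0 t}) \<ge> card (Pow I) * exp (- (N / 4))"
    using entropy_pigeonhole[of "Pow I" T q Z "N / 4"] I T q(1,2) by (auto simp del: Pow_iff)
  define \<F> where "\<F> = {X\<in>Pow I. \<forall>t\<in>T. Z X t = Z X0 t}"
  have finF: "finite \<F>" unfolding \<F>_def using I by simp
  define h where "h = (\<lambda>X. card {i\<in>I. (i \<in> X) \<noteq> (i \<in> X0)})"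
  \<comment> \<open>The Hamming ball is bounded by an exponential moment: weights (1/4)^h sum to
    (5/4)^N over all patterns, while distance below N/10 means weight at least (100/115)^N, as
    (100/115)^10 \<le> 1/4. The contradiction is 2 exp (-1/4) * 100/115 > 5/4, with 100/129 as a
    rational lower bound for exp (-1/4).\<close>
  have "\<exists>X\<in>\<F>. real (h X) \<ge> N / 10"
  proof (rule ccontr)
    assume "\<not> ?thesis"
    then have less: "real (h X) < N / 10" if "X \<in> \<F>" for X using that by force
    have prod_h: "(\<Prod>i\<in>I. if (i \<in> X) \<noteq> (i \<in> X0) then 1/4 else 1) = (1/4::real) ^ h X" for X
    proof -
      have "(\<Prod>i\<in>I. if (i \<in> X) \<noteq> (i \<in> X0) then 1/4 else 1::real)
         = (\<Prod>i\<in>{i\<in>I. (i \<in> X) \<noteq> (i \<in> X0)}. 1/4)"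
        using I(1) by (simp add: prod.If_cases Int_def)
      then show ?thesis by (simp add: h_def)
    qed
    have "(\<Sum>X\<in>\<F>. (1/4::real) ^ h X) \<le> (\<Sum>X\<in>Pow I. (1/4) ^ h X)"
      using I by (intro sum_mono2) (auto simp: \<F>_def)
    also have "\<dots> = (\<Prod>i\<in>I. 5/4)"
      using sum_Pow_prod[OF I(1), of "\<lambda>i b. if b \<noteq> (i \<in> X0) then 1/4 else 1"]
      unfolding prod_h[symmetric] by (simp add: if_distrib cong: if_cong)
    also have "\<dots> = (5/4) ^ N" by (simp add: N_def)
    finally have a: "(\<Sum>X\<in>\<F>. (1/4::real) ^ h X) \<le> (5/4) ^ N" .
    have b: "(100/115) ^ N \<le> (1/4::real) ^ h X" if "X \<in> \<F>" for X
    proof -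
      have "(100/115::real) ^ N \<le> (100/115) ^ (10 * h X)"
        using less[OF that] by (intro power_decreasing) auto
      also have "\<dots> = ((100/115) ^ 10) ^ h X" by (rule power_mult)
      also have "\<dots> \<le> (1/4) ^ h X" by (intro power_mono) (auto simp: power_divide)
      finally show ?thesis .
    qed
    have e: "exp (- (1/4)) \<ge> (100/129::real)"
    proof -
      have "exp (1/4) ^ 4 = exp (1::real)" by (simp add: exp_of_nat_mult[symmetric])
      also have "\<dots> \<le> (129/100) ^ 4" using e_less_272 by (simp add: power_divide)
      finally have "exp (1/4::real) \<le> 129/100" by (rule power_le_imp_le_base[of _ 3, simplified]) auto
      then show ?thesis by (simp add: exp_minus field_simps)
    qed
    have "(2 * (100/129)) ^ N * (100/115) ^ N \<le> (2 ^ N * exp (- (N / 4))) * (100/115::real) ^ N"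
    proof -
      have "(2 * (100/129)) ^ N \<le> (2 * exp (- (1/4::real))) ^ N" using e by (intro power_mono) auto
      also have "\<dots> = 2 ^ N * exp (- (N / 4))"
        by (simp add: power_mult_distrib exp_of_nat_mult[symmetric])
      finally show ?thesis by (intro mult_right_mono) auto
    qed
    also have "\<dots> \<le> real (card \<F>) * (100/115) ^ N"
      using X0(2) I unfolding \<F>_def[symmetric] by (intro mult_right_mono) (auto simp: card_Pow N_def)
    also have "\<dots> = (\<Sum>X\<in>\<F>. (100/115) ^ N)" by simp
    also have "\<dots> \<le> (\<Sum>X\<in>\<F>. (1/4::real) ^ h X)" by (intro sum_mono b)
    also have "\<dots> \<le> (5/4) ^ N" by (rule a)
    finally have "(2 * (100/129) * (100/115)) ^ N \<le> (5/4::real) ^ N" by (simp only: power_mult_distrib)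
    moreover have "(5/4::real) ^ N < (2 * (100/129) * (100/115)) ^ N"
      using N by (intro power_strict_mono) auto
    ultimately show False by linarith
  qed
  then obtain X where X: "X \<in> \<F>" "real (h X) \<ge> N / 10" by blast
  define \<xi> where "\<xi> = (\<lambda>i. (sgn_of X i - sgn_of X0 i) / 2)"
  show thesis
  proof (rule that)
    show "\<xi> i \<in> {-1, 0, 1}" for i by (simp add: \<xi>_def)
    have "{i\<in>I. \<xi> i \<noteq> 0} = {i\<in>I. (i \<in> X) \<noteq> (i \<in> X0)}" by (auto simp: \<xi>_def)
    then show "real (card {i\<in>I. \<xi> i \<noteq> 0}) \<ge> card I / 10" using X(2) by (simp add: h_def N_def)
    fix t assume t: "t \<in> T"
    define \<Delta> where "\<Delta> = \<mu> t * s t"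
    have \<Delta>: "\<Delta> > 0" using pos[OF t] by (simp add: \<Delta>_def)
    have "Z X t = Z X0 t" using X(1) t by (simp add: \<F>_def)
    then have "\<bar>y X t / (2 * \<Delta>) - y X0 t / (2 * \<Delta>)\<bar> \<le> 1"
      unfolding Z_def \<Delta>_def by linarith
    then have "\<bar>y X t - y X0 t\<bar> / (2 * \<Delta>) \<le> 1"
      using \<Delta> by (simp add: diff_divide_distrib[symmetric])
    then have "\<bar>y X t - y X0 t\<bar> / 2 \<le> \<Delta>" using \<Delta> by (simp add: field_simps)
    moreover have "(\<Sum>i\<in>I. \<xi> i * c t i) = (y X t - y X0 t) / 2"
      unfolding \<xi>_def y_def by (simp only: sum_subtractf[symmetric] sum_divide_distrib left_diff_distrib times_divide_eq_left)
    ultimately show "\<bar>\<Sum>i\<in>I. \<xi> i * c t i\<bar> \<le> \<mu> t * s t" by (simp add: \<Delta>_def)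
  qed
qed

section \<open>Nets adapted to hyperplanes\<close>

lemma exists_nontrivial_relation:
  fixes u :: "'k \<Rightarrow> 'v :: euclidean_space"
  assumes "finite K" "card K > DIM('v)"
  obtains a where "(\<Sum>t\<in>K. a t *\<^sub>R u t) = 0" "\<exists>t\<in>K. a t \<noteq> 0"
proof (cases "inj_on u K")
  case True
  then have "card (u ` K) > DIM('v)" using assms by (simp add: card_image)
  then have "dependent (u ` K)" using assms by (intro dependent_biggerset) auto
  then obtain f where f: "(\<Sum>v\<in>u ` K. f v *\<^sub>R v) = 0" "\<exists>v\<in>u ` K. f v \<noteq> 0"
    using assms by (auto simp: dependent_finite)
  show thesis
  proof (rule that[of "f \<circ> u"])
    show "(\<Sum>t\<in>K. (f \<circ> u) t *\<^sub>R u t) = 0" using f(1) True by (simp add: sum.reindex)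
    show "\<exists>t\<in>K. (f \<circ> u) t \<noteq> 0" using f(2) by auto
  qed
next
  case False
  then obtain s t where st: "s \<in> K" "t \<in> K" "s \<noteq> t" "u s = u t" by (auto simp: inj_on_def)
  define a where "a = (\<lambda>r. if r = s then 1 else if r = t then - 1 else (0::real))"
  have "(\<Sum>r\<in>K. a r *\<^sub>R u r) = (\<Sum>r\<in>{s, t}. a r *\<^sub>R u r)"
    using assms st by (intro sum.mono_neutral_right) (auto simp: a_def)
  also have "\<dots> = 0" using st by (simp add: a_def)
  finally show thesis using st by (intro that[of a]) (auto simp: a_def)
qed

text \<open>Points vary and half-spaces index the coordinates. A linear relation among d+1 normals
  makes the corresponding combination of the affine forms independent of x, whereas a shattered
  pattern could prescribe its sign. The relation involves the normals only and not the offsets, so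
  the dimension is d rather than d+1, and with it the exponent of the net sizes.\<close>

lemma vc_le_halfspaces:
  fixes u :: "'h \<Rightarrow> real^'d::finite" and c :: "'h \<Rightarrow> real"
  shows "vc_le CARD('d) (length hs) ((\<lambda>x. map (\<lambda>h. u h \<bullet> x + c h \<ge> 0) hs) ` P)"
  unfolding vc_le_def
proof (intro allI impI)
  fix K assume K: "K \<subseteq> {..<length hs}"
    "shatters ((\<lambda>x. map (\<lambda>h. u h \<bullet> x + c h \<ge> 0) hs) ` P) K"
  have fin: "finite K" using K(1) finite_subset by blast
  show "card K \<le> CARD('d)"
  proof (rule ccontr)
    assume "\<not> ?thesis"
    then obtain a where a: "(\<Sum>t\<in>K. a t *\<^sub>R u (hs ! t)) = 0" "\<exists>t\<in>K. a t \<noteq> 0"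
      using exists_nontrivial_relation[OF fin, of "\<lambda>t. u (hs ! t)"] by auto
    define v where "v = (\<lambda>x t. u (hs ! t) \<bullet> x + c (hs ! t))"
    have pat: "\<exists>x. \<forall>t\<in>K. v x t \<ge> 0 \<longleftrightarrow> t \<in> T" if T: "T \<subseteq> K" for T
    proof -
      obtain l where l: "l \<in> (\<lambda>x. map (\<lambda>h. u h \<bullet> x + c h \<ge> 0) hs) ` P" "\<forall>t\<in>K. l ! t \<longleftrightarrow> t \<in> T"
        using K(2) T unfolding shatters_def by blast
      then obtain x where "l = map (\<lambda>h. u h \<bullet> x + c h \<ge> 0) hs" by blast
      moreover have "t < length hs" if "t \<in> K" for t using K(1) that by blast
      ultimately have "\<forall>t\<in>K. v x t \<ge> 0 \<longleftrightarrow> t \<in> T" using l(2) by (simp add: v_def)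
      then show ?thesis by blast
    qed
    have sum_v: "(\<Sum>t\<in>K. b t * v x t) = (\<Sum>t\<in>K. b t * c (hs ! t))"
      if "(\<Sum>t\<in>K. b t *\<^sub>R u (hs ! t)) = 0" for b x
    proof -
      have "(\<Sum>t\<in>K. b t * v x t) = (\<Sum>t\<in>K. b t *\<^sub>R u (hs ! t)) \<bullet> x + (\<Sum>t\<in>K. b t * c (hs ! t))"
        by (simp add: v_def inner_sum_left sum.distrib distrib_left)
      with that show ?thesis by simp
    qed
    \<comment> \<open>x is chosen such that every term b_t v(x,t) is nonnegative; a negative b_t
      makes its term strictly positive, because \<open>v x t \<ge> 0\<close> then fails strictly.
      Used for both \<open>a\<close> and \<open>- a\<close>, this gives contradictory signs.\<close>
    have key: "(\<Sum>t\<in>K. b t * c (hs ! t)) \<ge> 0 \<and> ((\<exists>t\<in>K. b t < 0) \<longrightarrow> (\<Sum>t\<in>K. b t * c (hs ! t)) > 0)"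
      if b: "(\<Sum>t\<in>K. b t *\<^sub>R u (hs ! t)) = 0" for b
    proof -
      have "{t\<in>K. b t \<ge> 0} \<subseteq> K" by blast
      from pat[OF this] obtain x where x: "\<forall>t\<in>K. v x t \<ge> 0 \<longleftrightarrow> t \<in> {t\<in>K. b t \<ge> 0}" ..
      have pos: "b t * v x t \<ge> 0" if "t \<in> K" for t
      proof (cases "b t \<ge> 0")
        case True
        with x that have "v x t \<ge> 0" by blast
        with True show ?thesis by (rule mult_nonneg_nonneg)
      next
        case False
        with x that have "\<not> v x t \<ge> 0" by blast
        with False show ?thesis by (intro mult_nonpos_nonpos) linarith+
      qed
      have "(\<Sum>t\<in>K. b t * v x t) > 0" if t: "t \<in> K" "b t < 0" for t
      proof -
        have "\<not> b t \<ge> 0" using t by linarith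
        then have "\<not> v x t \<ge> 0" using x t(1) by blast
        then have "b t * v x t > 0" using t(2) by (intro mult_neg_neg) linarith+
        then show ?thesis using t(1) fin pos by (intro sum_pos2[of K t]) blast+
      qed
      moreover have "(\<Sum>t\<in>K. b t * v x t) \<ge> 0" using pos by (intro sum_nonneg)
      ultimately show ?thesis unfolding sum_v[OF b] by blast
    qed
    have "(\<Sum>t\<in>K. - a t *\<^sub>R u (hs ! t)) = 0" using a(1) by (simp add: sum_negf)
    from key[OF this] have n: "(\<Sum>t\<in>K. a t * c (hs ! t)) \<le> 0"
      "(\<exists>t\<in>K. a t > 0) \<longrightarrow> (\<Sum>t\<in>K. a t * c (hs ! t)) < 0" by (simp_all add: sum_negf)
    from a(2) obtain t where "t \<in> K" "a t < 0 \<or> a t > 0" by force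
    with n key[OF a(1)] show False by (meson not_le order_less_le_trans)
  qed
qed

section \<open>Nets controlling distance and separating hyperplanes at once\<close>

text \<open>Turns a coordinate distance into a number of separating grid hyperplanes, so that
  closeness in space becomes part of the same packing problem. The added 2 pays for the two ends of
  the interval between x and y.\<close>

lemma grid_separation:
  fixes x y :: real
  assumes "\<bar>x\<bar> \<le> 1" "\<bar>y\<bar> \<le> 1" "N > 0"
  shows "\<bar>x - y\<bar> \<le> 2 * (real (card {t\<in>{..<N}. (x + (1 - 2 * real t / N) \<ge> 0) \<noteq> (y + (1 - 2 * real t / N) \<ge> 0)}) + 2) / N"
proof -
  have main: "y - x \<le> 2 * (real (card {t\<in>{..<N}. (x + (1 - 2 * real t / N) \<ge> 0) \<noteq> (y + (1 - 2 * real t / N) \<ge> 0)}) + 2) / N"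
    if "\<bar>x\<bar> \<le> 1" "\<bar>y\<bar> \<le> 1" "x \<le> y" for x y :: real
  proof -
    define \<alpha> where "\<alpha> = (x + 1) * N / 2"
    define \<beta> where "\<beta> = (y + 1) * N / 2"
    have ab: "0 \<le> \<alpha>" "\<beta> \<le> N" "\<alpha> \<le> \<beta>"
      using that assms(3) by (auto simp: \<alpha>_def \<beta>_def divide_right_mono mult_right_mono)
    have sx: "x + (1 - 2 * real t / N) \<ge> 0 \<longleftrightarrow> real t \<le> \<alpha>" for t
      using assms(3) by (simp add: \<alpha>_def field_simps)
    have sy: "y + (1 - 2 * real t / N) \<ge> 0 \<longleftrightarrow> real t \<le> \<beta>" for t
      using assms(3) by (simp add: \<beta>_def field_simps)
    have "{nat \<lfloor>\<alpha>\<rfloor><..<nat \<lfloor>\<beta>\<rfloor>} \<subseteq> {t\<in>{..<N}. (real t \<le> \<alpha>) \<noteq> (real t \<le> \<beta>)}"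
    proof
      fix t assume "t \<in> {nat \<lfloor>\<alpha>\<rfloor><..<nat \<lfloor>\<beta>\<rfloor>}"
      then have t: "\<lfloor>\<alpha>\<rfloor> < int t" "int t < \<lfloor>\<beta>\<rfloor>" by auto
      then have "\<alpha> < real t" "real t < \<beta>" by linarith+
      then show "t \<in> {t\<in>{..<N}. (real t \<le> \<alpha>) \<noteq> (real t \<le> \<beta>)}" using ab by auto
    qed
    then have "card {nat \<lfloor>\<alpha>\<rfloor><..<nat \<lfloor>\<beta>\<rfloor>} \<le> card {t\<in>{..<N}. (real t \<le> \<alpha>) \<noteq> (real t \<le> \<beta>)}"
      by (intro card_mono) auto
    moreover have "\<beta> - \<alpha> \<le> real (card {nat \<lfloor>\<alpha>\<rfloor><..<nat \<lfloor>\<beta>\<rfloor>}) + 2"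
      using ab by simp linarith
    ultimately have "\<beta> - \<alpha> \<le> real (card {t\<in>{..<N}. (real t \<le> \<alpha>) \<noteq> (real t \<le> \<beta>)}) + 2" by linarith
    then have "2 * (\<beta> - \<alpha>) / N \<le> 2 * (real (card {t\<in>{..<N}. (real t \<le> \<alpha>) \<noteq> (real t \<le> \<beta>)}) + 2) / N"
      by (intro divide_right_mono) auto
    moreover have "2 * (\<beta> - \<alpha>) / N = y - x" using assms(3) by (simp add: \<alpha>_def \<beta>_def field_simps)
    ultimately show ?thesis unfolding sx sy by simp
  qed
  show ?thesis
  proof (cases "x \<le> y")
    case True
    with main[OF assms(1,2)] show ?thesis by simp
  next
    case False
    have "{t\<in>{..<N}. (y + (1 - 2 * real t / N) \<ge> 0) \<noteq> (x + (1 - 2 * real t / N) \<ge> 0)} =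
      {t\<in>{..<N}. (x + (1 - 2 * real t / N) \<ge> 0) \<noteq> (y + (1 - 2 * real t / N) \<ge> 0)}" by auto
    with False main[OF assms(2,1)] show ?thesis by simp
  qed
qed

lemma exists_maximal_separated:
  assumes bound: "\<And>P. finite P \<Longrightarrow> P \<subseteq> S \<Longrightarrow> (\<And>x y. x \<in> P \<Longrightarrow> y \<in> P \<Longrightarrow> x \<noteq> y \<Longrightarrow> R x y) \<Longrightarrow> real (card P) \<le> B"
    and sym: "\<And>x y. R x y \<Longrightarrow> R y x" and irrefl: "\<And>x. \<not> R x x"
  obtains P where "finite P" "P \<subseteq> S" "real (card P) \<le> B" "\<And>x. x \<in> S \<Longrightarrow> \<exists>y\<in>P. \<not> R x y"
proof -
  define \<P> where "\<P> = (\<lambda>P. finite P \<and> P \<subseteq> S \<and> (\<forall>x\<in>P. \<forall>y\<in>P. x \<noteq> y \<longrightarrow> R x y))"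
  have "\<forall>P. \<P> P \<longrightarrow> card P < Suc (nat \<lceil>B\<rceil>)"
  proof (intro allI impI)
    fix P assume "\<P> P"
    then have "real (card P) \<le> B" by (intro bound) (auto simp: \<P>_def)
    then show "card P < Suc (nat \<lceil>B\<rceil>)" by linarith
  qed
  moreover have "\<P> {}" by (simp add: \<P>_def)
  ultimately have "\<exists>P. \<P> P \<and> (\<forall>Q. \<P> Q \<longrightarrow> card Q \<le> card P)"
    using ex_has_greatest_nat[of \<P> "{}" card] by blast
  then obtain P where P: "\<P> P" "\<And>Q. \<P> Q \<Longrightarrow> card Q \<le> card P" by blast
  show thesis
  proof (rule that[of P])
    show "finite P" "P \<subseteq> S" using P(1) by (auto simp: \<P>_def)
    show "real (card P) \<le> B" using P(1) bound[of P] by (auto simp: \<P>_def)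
    fix x assume x: "x \<in> S"
    show "\<exists>y\<in>P. \<not> R x y"
    proof (rule ccontr)
      assume neg: "\<not> ?thesis"
      then have "x \<notin> P" using irrefl by blast
      moreover have "\<P> (insert x P)" using neg x P(1) sym by (auto simp: \<P>_def)
      ultimately show False using P(2)[of "insert x P"] P(1) by (simp add: \<P>_def)
    qed
  qed
qed

text \<open>A maximal separated set is a net. \<open>J\<close> joins the N atoms with N grid
  hyperplanes in each of the d directions, so density \<epsilon> / (d+1) in \<open>J\<close> amounts
  to \<epsilon> N separators, a bound that applies to the atoms and to each grid separately.\<close>

lemma exists_net:
  fixes \<omega> :: "'i \<Rightarrow> real^'d::finite" and b :: "'i \<Rightarrow> real" and \<epsilon> :: real
  assumes I: "finite I" "card I > 0" and epos: "\<epsilon> > 0" and \<epsilon>: "\<epsilon> \<le> 1" "2 * \<epsilon> * card I \<ge> 1"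
  obtains P :: "(real^'d) set" where "finite P" "P \<subseteq> cball 0 1"
    "real (card P) \<le> 2 * (5 * real CARD('d) * (CARD('d) + 1) / \<epsilon>) ^ CARD('d)"
    "\<And>x. x \<in> cball 0 1 \<Longrightarrow> \<exists>y\<in>P. (\<forall>a. \<bar>x $ a - y $ a\<bar> \<le> 10 * \<epsilon>) \<and>
        real (card {i\<in>I. (\<omega> i \<bullet> x + b i \<ge> 0) \<noteq> (\<omega> i \<bullet> y + b i \<ge> 0)}) < \<epsilon> * card I"
proof -
  let ?d = "CARD('d)"
  define N where "N = card I"
  have N: "N > 0" using I by (simp add: N_def)
  define J where "J = Inl ` I \<union> Inr ` ((UNIV :: 'd set) \<times> {..<N})"
  define u where "u = (\<lambda>h :: 'i + 'd \<times> nat. case h of Inl i \<Rightarrow> \<omega> i | Inr (a, t) \<Rightarrow> axis a 1)"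
  define c where "c = (\<lambda>h :: 'i + 'd \<times> nat. case h of Inl i \<Rightarrow> b i | Inr (a, t) \<Rightarrow> 1 - 2 * real t / N)"
  define A where "A = (\<lambda>x h. u h \<bullet> x + c h \<ge> 0)"
  define sep where "sep = (\<lambda>x y. real (card {h\<in>J. A x h \<noteq> A y h}))"
  have J: "finite J" unfolding J_def using I by simp
  have "card J = card (Inl ` I :: ('i + 'd \<times> nat) set) + card (Inr ` ((UNIV :: 'd set) \<times> {..<N}) :: ('i + 'd \<times> nat) set)"
    unfolding J_def using I by (intro card_Un_disjoint) auto
  also have "\<dots> = N + ?d * N" by (simp add: card_image card_cartesian_product N_def)
  finally have cardJ: "card J = (?d + 1) * N" by simp
  have Jne: "J \<noteq> {}" using cardJ N by (metis card.empty mult_is_0 add_is_0 one_neq_zero less_irrefl)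
  define \<delta> where "\<delta> = \<epsilon> / (?d + 1)"
  have \<delta>: "\<delta> > 0" "\<delta> \<le> 1" using epos \<epsilon>(1) by (auto simp: \<delta>_def field_simps)
  have \<delta>J: "\<delta> * card J = \<epsilon> * N" unfolding cardJ \<delta>_def by (simp add: field_simps)
  obtain P where P: "finite P" "P \<subseteq> cball 0 1" "real (card P) \<le> 2 * (5 * real ?d / \<delta>) ^ ?d"
      "\<And>x. x \<in> cball 0 1 \<Longrightarrow> \<exists>y\<in>P. \<not> sep x y \<ge> \<epsilon> * N"
  proof (rule exists_maximal_separated[of "cball 0 1" "\<lambda>x y. sep x y \<ge> \<epsilon> * N"])
    fix P :: "(real^'d) set"
    assume "finite P" and "\<And>x y. x \<in> P \<Longrightarrow> y \<in> P \<Longrightarrow> x \<noteq> y \<Longrightarrow> sep x y \<ge> \<epsilon> * N"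
    then show "real (card P) \<le> 2 * (5 * real ?d / \<delta>) ^ ?d"
      using J Jne \<delta> vc_le_halfspaces[where u = u and c = c]
      by (intro haussler_packing[where A = A and I = J]) (simp_all add: \<delta>J sep_def A_def Suc_leI)
  next
    show "sep x y \<ge> \<epsilon> * N \<Longrightarrow> sep y x \<ge> \<epsilon> * N" for x y
      unfolding sep_def by (simp add: eq_commute[of "A x _"])
    have "\<epsilon> * real N > 0" using epos N by (intro mult_pos_pos) auto
    then show "\<not> sep x x \<ge> \<epsilon> * N" for x by (simp add: sep_def)
  qed (rule that)
  show thesis
  proof (rule that[OF P(1,2)])
    show "real (card P) \<le> 2 * (5 * real ?d * (?d + 1) / \<epsilon>) ^ ?d"
      using P(3) unfolding \<delta>_def by (simp add: algebra_simps)
    fix x :: "real^'d" assume x: "x \<in> cball 0 1"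
    then obtain y where y: "y \<in> P" "sep x y < \<epsilon> * N" using P(4) by force
    have ybox: "y \<in> cball 0 1" using y(1) P(2) by blast
    have le_sep: "real (card X) \<le> sep x y" if "f ` X \<subseteq> {h\<in>J. A x h \<noteq> A y h}" "inj_on f X"
      for X :: "'z set" and f
      using card_mono[OF _ that(1)] J card_image[OF that(2)] unfolding sep_def by simp
    have 1: "real (card {i\<in>I. (\<omega> i \<bullet> x + b i \<ge> 0) \<noteq> (\<omega> i \<bullet> y + b i \<ge> 0)}) < \<epsilon> * card I"
      using le_sep[of Inl "{i\<in>I. (\<omega> i \<bullet> x + b i \<ge> 0) \<noteq> (\<omega> i \<bullet> y + b i \<ge> 0)}"] y(2)
      by (force simp: N_def J_def A_def u_def c_def)
    have 2: "\<bar>x $ a - y $ a\<bar> \<le> 10 * \<epsilon>" for a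
    proof -
      let ?X = "{t\<in>{..<N}. (x $ a + (1 - 2 * real t / N) \<ge> 0) \<noteq> (y $ a + (1 - 2 * real t / N) \<ge> 0)}"
      have "real (card ?X) \<le> sep x y"
        by (rule le_sep[of "\<lambda>t. Inr (a, t)"]) (auto simp: J_def A_def u_def c_def inner_axis' inj_on_def)
      then have X: "real (card ?X) \<le> \<epsilon> * N" using y(2) by linarith
      have "\<bar>x $ a\<bar> \<le> 1" "\<bar>y $ a\<bar> \<le> 1"
        using x ybox component_le_norm_cart[of x a] component_le_norm_cart[of y a] by auto
      then have "\<bar>x $ a - y $ a\<bar> \<le> 2 * (real (card ?X) + 2) / N" by (rule grid_separation[OF _ _ N])
      also have "\<dots> \<le> 2 * (\<epsilon> * N + 2) / N" using X by (intro divide_right_mono) auto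
      also have "\<dots> = 2 * \<epsilon> + 4 * (1 / N)" using N by (simp add: field_simps)
      \<comment> \<open>The grid must not be coarser than the net: its resolution adds 4 * 2
        \<epsilon> to 2 \<epsilon>, whence the constant 10.\<close>
      also have "1 / N \<le> 2 * \<epsilon>" using \<epsilon>(2) N by (simp add: N_def[symmetric] field_simps)
      finally show ?thesis by linarith
    qed
    from 1 2 y(1) show "\<exists>y\<in>P. (\<forall>a. \<bar>x $ a - y $ a\<bar> \<le> 10 * \<epsilon>) \<and>
        real (card {i\<in>I. (\<omega> i \<bullet> x + b i \<ge> 0) \<noteq> (\<omega> i \<bullet> y + b i \<ge> 0)}) < \<epsilon> * card I" by blast
  qed
qed

text \<open>The hypothesis on \<open>L\<close> is the resolution condition of
  \<open>exists_net\<close> at the finest scale \<epsilon> = 2^-L.\<close>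

lemma exists_nets:
  fixes \<omega> :: "'i \<Rightarrow> real^'d::finite" and b :: "'i \<Rightarrow> real"
  assumes I: "finite I" "card I > 0" and L: "2 ^ L \<le> 2 * card I"
  obtains Net :: "nat \<Rightarrow> (real^'d) set" and near :: "nat \<Rightarrow> real^'d \<Rightarrow> real^'d" where
    "\<And>j. j \<le> L \<Longrightarrow> finite (Net j)" "\<And>j. j \<le> L \<Longrightarrow> Net j \<subseteq> cball 0 1"
    "\<And>j. j \<le> L \<Longrightarrow> real (card (Net j)) \<le> 2 * (5 * real CARD('d) * (CARD('d) + 1)) ^ CARD('d) * (2 ^ CARD('d)) ^ j"
    "\<And>j x. j \<le> L \<Longrightarrow> x \<in> cball 0 1 \<Longrightarrow> near j x \<in> Net j"
    "\<And>j x a. j \<le> L \<Longrightarrow> x \<in> cball 0 1 \<Longrightarrow> \<bar>x $ a - near j x $ a\<bar> \<le> 10 / 2 ^ j"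
    "\<And>j x. j \<le> L \<Longrightarrow> x \<in> cball 0 1 \<Longrightarrow>
       real (card {i\<in>I. (\<omega> i \<bullet> x + b i \<ge> 0) \<noteq> (\<omega> i \<bullet> near j x + b i \<ge> 0)}) < card I / 2 ^ j"
proof -
  define good where "good = (\<lambda>j x y. (\<forall>a. \<bar>x $ a - y $ a\<bar> \<le> 10 / 2 ^ j) \<and>
     real (card {i\<in>I. (\<omega> i \<bullet> x + b i \<ge> 0) \<noteq> (\<omega> i \<bullet> y + b i \<ge> 0)}) < card I / 2 ^ j)"
  define net where "net = (\<lambda>j P. finite P \<and> P \<subseteq> cball 0 1 \<and>
      real (card P) \<le> 2 * (5 * real CARD('d) * (CARD('d) + 1)) ^ CARD('d) * (2 ^ CARD('d)) ^ j \<and>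
      (\<forall>x\<in>cball 0 1. \<exists>y\<in>P. good j x y))"
  have "\<exists>P. net j P" if j: "j \<le> L" for j
  proof -
    have "(2::nat) ^ j \<le> 2 ^ L" using j by (intro power_increasing) auto
    then have "2 ^ j \<le> 2 * card I" using L by linarith
    then have "real (2 ^ j) \<le> real (2 * card I)" by (simp only: of_nat_le_iff)
    then have le: "(2::real) ^ j \<le> 2 * card I" by simp
    obtain P :: "(real^'d) set" where P: "finite P" "P \<subseteq> cball 0 1"
      "real (card P) \<le> 2 * (5 * real CARD('d) * (CARD('d) + 1) / (1 / 2 ^ j)) ^ CARD('d)"
      "\<And>x. x \<in> cball 0 1 \<Longrightarrow> \<exists>y\<in>P. (\<forall>a. \<bar>x $ a - y $ a\<bar> \<le> 10 * (1 / 2 ^ j)) \<and>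
        real (card {i\<in>I. (\<omega> i \<bullet> x + b i \<ge> 0) \<noteq> (\<omega> i \<bullet> y + b i \<ge> 0)}) < (1 / 2 ^ j) * card I"
      by (rule exists_net[OF I, where \<epsilon> = "1 / 2 ^ j" and \<omega> = \<omega> and b = b]) (use le in \<open>simp_all add: field_simps\<close>)
    have "real (card P) \<le> 2 * (5 * real CARD('d) * (CARD('d) + 1)) ^ CARD('d) * (2 ^ CARD('d)) ^ j"
      using P(3) by (simp add: power_mult_distrib power_mult[symmetric] mult.commute[of j])
    moreover have "\<forall>x\<in>cball 0 1. \<exists>y\<in>P. good j x y" using P(4) by (simp add: good_def)
    ultimately have "net j P" using P(1,2) by (simp add: net_def)
    then show ?thesis ..
  qed
  then have "\<forall>j. \<exists>P. j \<le> L \<longrightarrow> net j P" by blast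
  from choice[OF this] obtain Net where "\<forall>j. j \<le> L \<longrightarrow> net j (Net j)" ..
  then have Net: "net j (Net j)" if "j \<le> L" for j using that by (elim allE impE)
  define near where "near = (\<lambda>j x. SOME y. y \<in> Net j \<and> good j x y)"
  have near: "near j x \<in> Net j \<and> good j x (near j x)" if "j \<le> L" "x \<in> cball 0 1" for j x
  proof -
    have "\<exists>y. y \<in> Net j \<and> good j x y" using Net[OF that(1)] that(2) unfolding net_def by blast
    then show ?thesis unfolding near_def by (rule someI_ex)
  qed
  show thesis
    by (rule that[of Net near]) (use Net near in \<open>simp_all only: net_def good_def\<close>)
qed

section \<open>Chaining of ridge sums\<close>

text \<open>Words play the role of multi-indices, in the encoding of \<open>iter_pd\<close>. Each
  multi-index occurs once for each of its orderings, which removes the multinomial coefficients from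
  \<open>inner_power_eq_sum_wmono\<close>.\<close>

definition wmono :: "'d list \<Rightarrow> real^'d::finite \<Rightarrow> real" where
  "wmono w u = prod_list (map (\<lambda>a. u $ a) w)"

lemma wmono_append: "wmono (v @ w) u = wmono v u * wmono w u"
  by (simp add: wmono_def)

lemma wmono_simps [simp]: "wmono [] u = 1" "wmono (a # w) u = u $ a * wmono w u"
  by (simp_all add: wmono_def)

lemma abs_wmono_le:
  assumes "\<And>a. \<bar>u $ a\<bar> \<le> B"
  shows "\<bar>wmono w u\<bar> \<le> B ^ length w"
proof (induction w)
  case (Cons a w)
  have "0 \<le> B" using assms[of a] by linarith
  then show ?case using Cons assms[of a] by (simp add: abs_mult mult_mono)
qed simp

lemma abs_wmono_le_1: "norm u \<le> 1 \<Longrightarrow> \<bar>wmono w u\<bar> \<le> 1"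
  using abs_wmono_le[of u 1 w] component_le_norm_cart[of u] by (metis order_trans power_one)

lemma inner_power_eq_sum_wmono:
  fixes u z :: "real^'d::finite"
  shows "(u \<bullet> z) ^ t = (\<Sum>v | length v = t. wmono v u * wmono v z)"
proof (induction t)
  case (Suc t)
  have "(\<Sum>v :: 'd list | length v = Suc t. wmono v u * wmono v z)
     = (\<Sum>a\<in>UNIV. \<Sum>v | length v = t. wmono (a # v) u * wmono (a # v) z)"
    using sum_lists_Suc[of "UNIV :: 'd set", where s = t and f = "\<lambda>v. wmono v u * wmono v z"] by simp
  also have "\<dots> = (\<Sum>a\<in>UNIV. (u $ a * z $ a) * (\<Sum>v | length v = t. wmono v u * wmono v z))"
    unfolding sum_distrib_left by (intro sum.cong refl) (simp add: mult_ac)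
  also have "\<dots> = (u \<bullet> z) * (u \<bullet> z) ^ t"
    unfolding Suc.IH[symmetric] sum_distrib_right[symmetric] by (simp add: inner_vec_def)
  finally show ?case by simp
qed simp

lemma card_words: "card {v :: 'd::finite list. length v = t} = CARD('d) ^ t"
  using card_lists_length_eq[of "UNIV :: 'd set" t] by simp

lemma sigma_k_eq: "sigma_k r t = of_bool (t \<ge> 0) * t ^ r"
  by (simp add: sigma_k_def)

section \<open>Jumps between neighbouring net points\<close>

locale hyperplane_nets =
  fixes I :: "'i set" and \<omega> :: "'i \<Rightarrow> real^'d::finite" and b :: "'i \<Rightarrow> real"
    and L :: nat and Net :: "nat \<Rightarrow> (real^'d) set" and near :: "nat \<Rightarrow> real^'d \<Rightarrow> real^'d"
  assumes finite_I: "finite I"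
    and norm_\<omega>: "i \<in> I \<Longrightarrow> norm (\<omega> i) = 1" and abs_b: "i \<in> I \<Longrightarrow> \<bar>b i\<bar> \<le> 1"
    and card_le: "card I \<le> 2 ^ L"
    and Net_subset: "j \<le> L \<Longrightarrow> Net j \<subseteq> cball 0 1"
    and near_Net: "j \<le> L \<Longrightarrow> x \<in> cball 0 1 \<Longrightarrow> near j x \<in> Net j"
    and near_dist: "j \<le> L \<Longrightarrow> x \<in> cball 0 1 \<Longrightarrow> \<bar>x $ a - near j x $ a\<bar> \<le> 10 / 2 ^ j"
    and near_sep: "j \<le> L \<Longrightarrow> x \<in> cball 0 1 \<Longrightarrow>
       real (card {i\<in>I. (\<omega> i \<bullet> x + b i \<ge> 0) \<noteq> (\<omega> i \<bullet> near j x + b i \<ge> 0)}) < card I / 2 ^ j"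
begin

definition p :: "'i \<Rightarrow> real^'d \<Rightarrow> real" where "p i x = \<omega> i \<bullet> x + b i"

definition sg :: "real^'d \<Rightarrow> 'i \<Rightarrow> real" where "sg y i = of_bool (p i y \<ge> 0)"

text \<open>The coarser point is recomputed from \<open>y\<close> as \<open>near (j - 1) y\<close>,
  so an increment depends on a single net point and the tests at scale j are counted by
  \<open>Net j\<close>, not by pairs of points. At j = 0 there is no coarser point and the whole
  indicator is the jump.\<close>

definition jump :: "nat \<Rightarrow> real^'d \<Rightarrow> 'i \<Rightarrow> real" where
  "jump j y i = sg y i - (if j = 0 then 0 else sg (near (j - 1) y) i)"

definition R :: real where "R = 20 * CARD('d)"

lemma R_ge: "R \<ge> 20"
proof -
  have "CARD('d) \<ge> 1" by (simp add: Suc_leI)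
  then show ?thesis unfolding R_def by linarith
qed

lemma p_diff: "p i x = p i y + \<omega> i \<bullet> (x - y)"
  by (simp add: p_def inner_diff_right)

lemma abs_\<omega>: "i \<in> I \<Longrightarrow> \<bar>\<omega> i $ a\<bar> \<le> 1"
  using component_le_norm_cart[of "\<omega> i" a] norm_\<omega> by simp

lemma abs_jump: "\<bar>jump j y i\<bar> \<le> 1"
  by (auto simp: jump_def sg_def)

text \<open>A hyperplane separating \<open>y\<close> from its coarser neighbour passes between them,
  so the affine form at \<open>y\<close> is at most its variation, d * 10 / 2^(j-1) = R / 2^j. This
  is where the degree r of the truncated power earns the factor 2^-(j r). At j = 0 the trivial bound
  2 serves.\<close>

lemma p_small_if_jump:
  assumes i: "i \<in> I" and j: "j \<le> L" and y: "y \<in> cball 0 1" and jump: "jump j y i \<noteq> 0"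
  shows "\<bar>p i y\<bar> \<le> R / 2 ^ j"
proof (cases "j = 0")
  case True
  have "\<bar>\<omega> i \<bullet> y\<bar> \<le> norm (\<omega> i) * norm y" by (rule Cauchy_Schwarz_ineq2)
  also have "\<dots> \<le> 1" using norm_\<omega>[OF i] y by simp
  finally show ?thesis using abs_b[OF i] R_ge True unfolding p_def by simp
next
  case False
  define z where "z = near (j - 1) y"
  have "(p i y \<ge> 0) \<noteq> (p i z \<ge> 0)" using jump False by (auto simp: jump_def sg_def z_def)
  then have "\<bar>p i y\<bar> \<le> \<bar>p i y - p i z\<bar>" by linarith
  also have "\<dots> = \<bar>\<Sum>a\<in>UNIV. \<omega> i $ a * (y $ a - z $ a)\<bar>"
    unfolding p_diff[of i y z] by (simp add: inner_vec_def)
  also have "\<dots> \<le> (\<Sum>a\<in>(UNIV :: 'd set). 10 / 2 ^ (j - 1))"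
  proof (rule order_trans[OF sum_abs], rule sum_mono)
    fix a
    have "\<bar>\<omega> i $ a * (y $ a - z $ a)\<bar> \<le> 1 * (10 / 2 ^ (j - 1))"
      unfolding abs_mult z_def using j y
      by (intro mult_mono abs_\<omega>[OF i] near_dist) auto
    then show "\<bar>\<omega> i $ a * (y $ a - z $ a)\<bar> \<le> 10 / 2 ^ (j - 1)" by simp
  qed
  also have "\<dots> = R / 2 ^ j"
    using False by (cases j) (simp_all add: R_def)
  finally show ?thesis .
qed

lemma card_jump:
  assumes j: "j \<le> L" and y: "y \<in> cball 0 1"
  shows "real (card {i\<in>I. jump j y i \<noteq> 0}) \<le> 2 * card I / 2 ^ j"
proof (cases "j = 0")
  case True
  have "card {i\<in>I. jump j y i \<noteq> 0} \<le> card I" using finite_I by (intro card_mono) auto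
  then show ?thesis using True by simp
next
  case False
  have "{i\<in>I. jump j y i \<noteq> 0} \<subseteq> {i\<in>I. (\<omega> i \<bullet> y + b i \<ge> 0) \<noteq> (\<omega> i \<bullet> near (j - 1) y + b i \<ge> 0)}"
    using False by (auto simp: jump_def sg_def p_def)
  then have "card {i\<in>I. jump j y i \<noteq> 0} \<le> card {i\<in>I. (\<omega> i \<bullet> y + b i \<ge> 0) \<noteq> (\<omega> i \<bullet> near (j - 1) y + b i \<ge> 0)}"
    using finite_I by (intro card_mono) auto
  then have "real (card {i\<in>I. jump j y i \<noteq> 0}) \<le> real (card {i\<in>I. (\<omega> i \<bullet> y + b i \<ge> 0) \<noteq> (\<omega> i \<bullet> near (j - 1) y + b i \<ge> 0)})"
    by (simp only: of_nat_le_iff)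
  also have "\<dots> < card I / 2 ^ (j - 1)" using j y by (intro near_sep) auto
  also have "\<dots> = 2 * card I / 2 ^ j" using False by (cases j) auto
  finally show ?thesis by simp
qed

text \<open>Variance of a test under random signs. Both gains enter: few atoms jump, and those that
  do have a small affine form.\<close>

lemma jump_variance:
  assumes j: "j \<le> L" and y: "y \<in> cball 0 1" and e: "\<And>i. i \<in> I \<Longrightarrow> \<bar>e i\<bar> \<le> 1"
  shows "(\<Sum>i\<in>I. (e i * jump j y i * wmono v (\<omega> i) * p i y ^ r)\<^sup>2)
     \<le> (sqrt (2 * card I / 2 ^ j) * (R / 2 ^ j) ^ r)\<^sup>2"
proof -
  have "(\<Sum>i\<in>I. (e i * jump j y i * wmono v (\<omega> i) * p i y ^ r)\<^sup>2)
     = (\<Sum>i\<in>{i\<in>I. jump j y i \<noteq> 0}. (e i * jump j y i * wmono v (\<omega> i) * p i y ^ r)\<^sup>2)"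
    using finite_I by (intro sum.mono_neutral_right) auto
  also have "\<dots> \<le> (\<Sum>i\<in>{i\<in>I. jump j y i \<noteq> 0}. ((R / 2 ^ j) ^ r)\<^sup>2)"
  proof (rule sum_mono)
    fix i assume i: "i \<in> {i\<in>I. jump j y i \<noteq> 0}"
    have "\<bar>e i * jump j y i * wmono v (\<omega> i) * p i y ^ r\<bar> \<le> 1 * 1 * 1 * (R / 2 ^ j) ^ r"
      unfolding abs_mult power_abs using i j y e p_small_if_jump[of i j y] norm_\<omega>[of i] R_ge
      by (intro mult_mono abs_jump abs_wmono_le_1 power_mono) auto
    then show "(e i * jump j y i * wmono v (\<omega> i) * p i y ^ r)\<^sup>2 \<le> ((R / 2 ^ j) ^ r)\<^sup>2"
      by (intro abs_le_square_iff[THEN iffD1]) simp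
  qed
  also have "\<dots> = card {i\<in>I. jump j y i \<noteq> 0} * ((R / 2 ^ j) ^ r)\<^sup>2" by simp
  also have "\<dots> \<le> (2 * card I / 2 ^ j) * ((R / 2 ^ j) ^ r)\<^sup>2"
    by (intro mult_right_mono card_jump j y) auto
  finally show ?thesis by (simp add: power_mult_distrib)
qed

text \<open>The recursion runs from the finest scale to the coarsest, since each point must be the
  \<open>near\<close> neighbour of the next finer one for \<open>jump\<close> to telescope. The
  drifts 10 / 2^i with i \<ge> j add up to at most 20 / 2^j.\<close>

lemma chain_exists:
  assumes x: "x \<in> cball 0 1"
  obtains Y where "Y L = near L x" "\<And>j. j < L \<Longrightarrow> Y j = near j (Y (Suc j))"
    "\<And>j. j \<le> L \<Longrightarrow> Y j \<in> Net j" "\<And>j a. j \<le> L \<Longrightarrow> \<bar>x $ a - Y j $ a\<bar> \<le> 20 / 2 ^ j"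
proof -
  define ch where "ch = rec_nat (near L x) (\<lambda>n. near (L - Suc n))"
  define Y where "Y = (\<lambda>j. ch (L - j))"
  have YL: "Y L = near L x" by (simp add: Y_def ch_def)
  have Yj: "Y j = near j (Y (Suc j))" if "j < L" for j
  proof -
    have "L - j = Suc (L - Suc j)" using that by simp
    then have "Y j = near (L - Suc (L - Suc j)) (Y (Suc j))" unfolding Y_def ch_def by simp
    moreover have "L - Suc (L - Suc j) = j" using that by simp
    ultimately show ?thesis by simp
  qed
  have *: "Y (L - n) \<in> Net (L - n) \<and> (\<forall>a. \<bar>x $ a - Y (L - n) $ a\<bar> \<le> 20 / 2 ^ (L - n))" for n
  proof (induction n)
    case 0
    have "10 / 2 ^ L \<le> (20 / 2 ^ L :: real)" by (simp add: divide_right_mono)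
    then show ?case using near_Net[of L x] near_dist[of L x] x by (simp add: YL) (meson order_trans)
  next
    case (Suc n)
    show ?case
    proof (cases "n < L")
      case False
      then show ?thesis using Suc by simp
    next
      case True
      define j where "j = L - Suc n"
      have j: "j < L" "L - n = Suc j" "j \<le> L" using True by (auto simp: j_def)
      have Y1: "Y (Suc j) \<in> Net (Suc j)" "\<And>a. \<bar>x $ a - Y (Suc j) $ a\<bar> \<le> 20 / 2 ^ Suc j"
        using Suc unfolding j(2) by auto
      have Y1b: "Y (Suc j) \<in> cball 0 1" using Net_subset[of "Suc j"] Y1(1) j(1) by auto
      have "\<bar>x $ a - Y j $ a\<bar> \<le> 20 / 2 ^ j" for a
      proof -
        have "\<bar>x $ a - Y j $ a\<bar> \<le> 20 / 2 ^ Suc j + 10 / 2 ^ j"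
          using Y1(2)[of a] near_dist[OF j(3) Y1b, of a] unfolding Yj[OF j(1)] by linarith
        then show ?thesis by simp
      qed
      moreover have "Y j \<in> Net j" unfolding Yj[OF j(1)] by (rule near_Net[OF j(3) Y1b])
      ultimately show ?thesis unfolding j_def[symmetric] by blast
    qed
  qed
  have **: "Y j \<in> Net j \<and> (\<forall>a. \<bar>x $ a - Y j $ a\<bar> \<le> 20 / 2 ^ j)" if "j \<le> L" for j
    using *[of "L - j"] that by simp
  show thesis by (rule that[of Y]) (use YL Yj ** in auto)
qed

text \<open>Along a chain of net points the Taylor polynomial of \<open>\<sigma>_r \<circ> p\<close> at a net point \<open>y\<close> is
  \<open>[p y \<ge> 0] p\<^sup>r\<close>, so consecutive Taylor polynomials differ by \<open>jump * p\<^sup>r\<close>; the differences are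
  re-expanded around the net points, where \<open>p\<close> is small whenever the jump is nonzero.\<close>
lemma chaining_bound:
  assumes x: "x \<in> cball 0 1" and w: "length w \<le> k" and t_nonneg: "\<And>j. t j \<ge> 0"
    and tests: "\<And>j y v. j \<le> L \<Longrightarrow> y \<in> Net j \<Longrightarrow> length v \<le> k \<Longrightarrow>
       \<bar>\<Sum>i\<in>I. f i * jump j y i * wmono v (\<omega> i) * p i y ^ (k - length v)\<bar> \<le> t j * (R / 2 ^ j) ^ (k - length v)"
  shows "\<bar>\<Sum>i\<in>I. f i * wmono w (\<omega> i) * sigma_k (k - length w) (p i x)\<bar>
     \<le> (1 + real CARD('d)) ^ (k - length w) * (\<Sum>j\<le>L. t j * (R / 2 ^ j) ^ (k - length w))"
proof -
  define r where "r = k - length w"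
  obtain Y where Y: "Y L = near L x" "\<And>j. j < L \<Longrightarrow> Y j = near j (Y (Suc j))"
    "\<And>j. j \<le> L \<Longrightarrow> Y j \<in> Net j" "\<And>j a. j \<le> L \<Longrightarrow> \<bar>x $ a - Y j $ a\<bar> \<le> 20 / 2 ^ j"
    using chain_exists[OF x] by blast
  have tele: "(\<Sum>j\<le>n. jump j (Y j) i) = sg (Y n) i" if "n \<le> L" for n i
    using that
  proof (induction n)
    case (Suc n)
    then show ?case using Y(2)[of n] by (simp add: jump_def)
  qed (simp add: jump_def)
  \<comment> \<open>Fewer than card I / 2^L \<le> 1 hyperplanes separate x from the last point of
    the chain, hence none: the chain leaves no remainder.\<close>
  have sgL: "sg (Y L) i = sg x i" if i: "i \<in> I" for i
  proof -
    let ?S = "{i\<in>I. (\<omega> i \<bullet> x + b i \<ge> 0) \<noteq> (\<omega> i \<bullet> near L x + b i \<ge> 0)}"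
    have "real (card ?S) < card I / 2 ^ L" by (rule near_sep[OF order_refl x])
    also have "\<dots> \<le> 1" using card_le by (simp add: divide_le_eq)
    finally have "card ?S = 0" by simp
    then have "i \<notin> ?S" using finite_I by auto
    then show ?thesis using i by (simp add: sg_def p_def Y(1))
  qed
  have one: "\<bar>\<Sum>i\<in>I. f i * wmono w (\<omega> i) * (jump j (Y j) i * p i x ^ r)\<bar>
     \<le> (1 + real CARD('d)) ^ r * (t j * (R / 2 ^ j) ^ r)" if j: "j \<le> L" for j
  proof -
    let ?y = "Y j"
    \<comment> \<open>Expanding p(x)^r around \<open>?y\<close> appends a word \<open>v\<close> of
      length s to \<open>w\<close> and lowers the power of \<open>p\<close> to r - s, so every
      coefficient is again one of the assumed tests, for the word \<open>w @ v\<close>.\<close>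
    define S where "S = (\<lambda>s v. \<Sum>i\<in>I. f i * jump j ?y i * wmono (w @ v) (\<omega> i) * p i ?y ^ (r - s))"
    have "f i * wmono w (\<omega> i) * (jump j ?y i * p i x ^ r) = (\<Sum>s\<le>r. \<Sum>v | length v = s.
        real (r choose s) * wmono v (x - ?y) * (f i * jump j ?y i * wmono (w @ v) (\<omega> i) * p i ?y ^ (r - s)))" for i
    proof -
      have "p i x ^ r = (\<omega> i \<bullet> (x - ?y) + p i ?y) ^ r" unfolding p_diff[of i x ?y] by (simp add: add.commute)
      also have "\<dots> = (\<Sum>s\<le>r. real (r choose s) * (\<omega> i \<bullet> (x - ?y)) ^ s * p i ?y ^ (r - s))"
        by (rule binomial_ring)
      finally have "f i * wmono w (\<omega> i) * (jump j ?y i * p i x ^ r) =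
         (\<Sum>s\<le>r. f i * wmono w (\<omega> i) * (jump j ?y i * (real (r choose s) * (\<omega> i \<bullet> (x - ?y)) ^ s * p i ?y ^ (r - s))))"
        by (simp add: sum_distrib_left)
      also have "\<dots> = (\<Sum>s\<le>r. \<Sum>v | length v = s.
        real (r choose s) * wmono v (x - ?y) * (f i * jump j ?y i * wmono (w @ v) (\<omega> i) * p i ?y ^ (r - s)))"
        unfolding inner_power_eq_sum_wmono sum_distrib_left sum_distrib_right wmono_append
        by (intro sum.cong refl) (simp only: mult_ac)
      finally show ?thesis .
    qed
    then have "(\<Sum>i\<in>I. f i * wmono w (\<omega> i) * (jump j ?y i * p i x ^ r))
       = (\<Sum>i\<in>I. \<Sum>s\<le>r. \<Sum>v | length v = s.
        real (r choose s) * wmono v (x - ?y) * (f i * jump j ?y i * wmono (w @ v) (\<omega> i) * p i ?y ^ (r - s)))" by simp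
    also have "\<dots> = (\<Sum>s\<le>r. \<Sum>i\<in>I. \<Sum>v | length v = s.
        real (r choose s) * wmono v (x - ?y) * (f i * jump j ?y i * wmono (w @ v) (\<omega> i) * p i ?y ^ (r - s)))"
      by (rule sum.swap)
    also have "\<dots> = (\<Sum>s\<le>r. \<Sum>v | length v = s. real (r choose s) * wmono v (x - ?y) * S s v)"
      unfolding S_def sum_distrib_left by (intro sum.cong refl sum.swap)
    also have "\<bar>\<dots>\<bar> \<le> (\<Sum>s\<le>r. \<Sum>v :: 'd list | length v = s. real (r choose s) * (R / 2 ^ j) ^ s * (t j * (R / 2 ^ j) ^ (r - s)))"
    proof (intro order_trans[OF sum_abs] sum_mono)
      fix s and v :: "'d list" assume s: "s \<in> {..r}" and v: "v \<in> {v. length v = s}"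
      have "\<bar>wmono v (x - ?y)\<bar> \<le> (20 / 2 ^ j) ^ length v" using Y(4)[OF j] by (intro abs_wmono_le) simp
      also have "\<dots> \<le> (R / 2 ^ j) ^ length v" using R_ge by (intro power_mono divide_right_mono) auto
      finally have 1: "\<bar>wmono v (x - ?y)\<bar> \<le> (R / 2 ^ j) ^ s" using v by simp
      have len: "length (w @ v) \<le> k" "k - length (w @ v) = r - s" using w s v by (auto simp: r_def)
      have 2: "\<bar>S s v\<bar> \<le> t j * (R / 2 ^ j) ^ (r - s)"
        using tests[OF j Y(3)[OF j] len(1)] unfolding S_def len(2) .
      show "\<bar>real (r choose s) * wmono v (x - ?y) * S s v\<bar>
        \<le> real (r choose s) * (R / 2 ^ j) ^ s * (t j * (R / 2 ^ j) ^ (r - s))"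
        unfolding abs_mult using 1 2 R_ge by (intro mult_mono) auto
    qed
    also have "\<dots> = (\<Sum>s\<le>r. real (r choose s) * real CARD('d) ^ s * 1 ^ (r - s)) * (t j * (R / 2 ^ j) ^ r)"
    proof -
      have "(R / 2 ^ j) ^ s * (R / 2 ^ j) ^ (r - s) = (R / 2 ^ j) ^ r" if "s \<le> r" for s
        using that by (simp add: power_add[symmetric])
      then show ?thesis
        unfolding sum_distrib_right by (intro sum.cong refl) (simp add: card_words mult_ac)
    qed
    also have "(\<Sum>s\<le>r. real (r choose s) * real CARD('d) ^ s * 1 ^ (r - s)) = (1 + real CARD('d)) ^ r"
      unfolding binomial_ring[symmetric] by (simp add: add.commute)
    finally show ?thesis .
  qed
  have "(\<Sum>i\<in>I. f i * wmono w (\<omega> i) * sigma_k r (p i x))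
     = (\<Sum>i\<in>I. \<Sum>j\<le>L. f i * wmono w (\<omega> i) * (jump j (Y j) i * p i x ^ r))"
  proof (rule sum.cong[OF refl])
    fix i assume i: "i \<in> I"
    have "sigma_k r (p i x) = (\<Sum>j\<le>L. jump j (Y j) i) * p i x ^ r"
      unfolding tele[OF order_refl] sgL[OF i] by (simp add: sigma_k_eq sg_def)
    then show "f i * wmono w (\<omega> i) * sigma_k r (p i x) = (\<Sum>j\<le>L. f i * wmono w (\<omega> i) * (jump j (Y j) i * p i x ^ r))"
      by (simp only: sum_distrib_left sum_distrib_right)
  qed
  also have "\<dots> = (\<Sum>j\<le>L. \<Sum>i\<in>I. f i * wmono w (\<omega> i) * (jump j (Y j) i * p i x ^ r))"
    by (rule sum.swap)
  also have "\<bar>\<dots>\<bar> \<le> (\<Sum>j\<le>L. (1 + real CARD('d)) ^ r * (t j * (R / 2 ^ j) ^ r))"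
    by (rule order_trans[OF sum_abs], rule sum_mono, rule one) simp
  also have "\<dots> = (1 + real CARD('d)) ^ r * (\<Sum>j\<le>L. t j * (R / 2 ^ j) ^ r)"
    by (simp only: sum_distrib_left)
  finally show ?thesis unfolding r_def .
qed

end

section \<open>Tolerances along the scales\<close>

lemma power_div_fact_le_exp: "x \<ge> 0 \<Longrightarrow> x ^ n / fact n \<le> exp x" for x :: real
proof -
  assume x: "x \<ge> 0"
  have "(\<Sum>m<Suc n. x ^ m /\<^sub>R fact m) \<le> exp x"
    unfolding exp_def using x by (intro sum_le_suminf summable_exp_generic) auto
  moreover have "x ^ n /\<^sub>R fact n \<le> (\<Sum>m<Suc n. x ^ m /\<^sub>R fact m)"
    using x by (intro member_le_sum) auto
  ultimately show ?thesis by (simp add: divide_inverse mult.commute)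
qed

lemma window_cost_nonneg: "\<mu> > 0 \<Longrightarrow> window_cost \<mu> \<ge> 0"
  unfolding window_cost_def by (auto intro!: add_nonneg_nonneg ln_ge_zero)

text \<open>The exponential beats every power of \<mu>. Its Taylor term of degree 2 m + 1 leaves one
  factor \<mu>^2 to cancel the prefactor 4 + \<mu>^2 \<le> 2 \<mu>^2.\<close>

lemma window_cost_large_le:
  assumes "\<mu> \<ge> 2"
  shows "window_cost \<mu> \<le> 2 * fact (2 * m + 1) * 2 ^ (2 * m + 1) / (\<mu> ^ 4) ^ m"
proof -
  define q where "q = 2 * m + 1"
  have "\<mu> ^ 2 \<ge> 2 ^ 2" using assms by (intro power_mono) auto
  then have m4: "4 + \<mu>\<^sup>2 \<le> 2 * \<mu>\<^sup>2" by simp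
  have mp: "\<mu> > 0" using assms by simp
  have "(\<mu>\<^sup>2 / 2) ^ q / fact q \<le> exp (\<mu>\<^sup>2 / 2)" by (rule power_div_fact_le_exp) simp
  moreover have "(\<mu>\<^sup>2 / 2) ^ q / fact q > 0" using mp by simp
  ultimately have "inverse (exp (\<mu>\<^sup>2 / 2)) \<le> inverse ((\<mu>\<^sup>2 / 2) ^ q / fact q)"
    by (rule le_imp_inverse_le)
  then have e: "exp (- \<mu>\<^sup>2 / 2) \<le> fact q * 2 ^ q / (\<mu>\<^sup>2) ^ q"
    by (simp add: exp_minus power_divide mult.commute)
  have "window_cost \<mu> = (4 + \<mu>\<^sup>2) * exp (- \<mu>\<^sup>2 / 2)" using assms by (simp add: window_cost_def)
  also have "\<dots> \<le> (2 * \<mu>\<^sup>2) * (fact q * 2 ^ q / (\<mu>\<^sup>2) ^ q)"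
    using m4 e by (intro mult_mono) auto
  also have "(\<mu>\<^sup>2) ^ q = \<mu>\<^sup>2 * (\<mu> ^ 4) ^ m"
    unfolding q_def by (simp add: power_mult[symmetric])
  also have "(2 * \<mu>\<^sup>2) * (fact q * 2 ^ q / (\<mu>\<^sup>2 * (\<mu> ^ 4) ^ m)) = 2 * fact q * 2 ^ q / (\<mu> ^ 4) ^ m"
    using mp by (simp add: field_simps)
  finally show ?thesis unfolding q_def .
qed

definition halfroot :: real where "halfroot = (1/2) powr (1/4)"

lemma halfroot_bounds: "0 < halfroot" "halfroot < 1"
  using powr_less_mono2[of "1/4" "1/2" 1] by (simp_all add: halfroot_def)

lemma halfroot_power4: "halfroot ^ (4 * n) = 1 / 2 ^ n"
proof -
  have "halfroot ^ 4 = 1/2" unfolding halfroot_def by (simp add: powr_powr flip: powr_realpow)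
  then show ?thesis by (simp only: power_mult power_divide power_one)
qed

text \<open>Window widths in units of the standard deviation at scale \<open>2\<^sup>-\<^sup>j\<close>; at \<open>j = j0\<close> there are about as
  many increments as atoms. With \<open>halfroot\<^sup>4 = 1/2\<close> all scale factors are integer powers of
  \<open>halfroot\<close>.\<close>
definition tol :: "nat \<Rightarrow> nat \<Rightarrow> nat \<Rightarrow> real" where
  "tol A j0 j = (if j < j0 then 2 * halfroot ^ (4 * A * (j0 - j)) else 2 / halfroot ^ (j - j0))"

lemma tol_pos: "tol A j0 j > 0"
  using halfroot_bounds by (simp add: tol_def)

text \<open>A narrow window costs only the logarithm of its inverse width: linear in j0 - j,
  although the width is exponentially small.\<close>

lemma cost_coarse:
  assumes "j < j0" "A \<ge> 1"
  shows "window_cost (tol A j0 j) \<le> (real A + 4) * real (j0 - j)"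
proof -
  define i where "i = j0 - j"
  have i: "i \<ge> 1" using assms by (simp add: i_def)
  have t: "tol A j0 j = 2 / 2 ^ (A * i)"
    using assms(1) halfroot_power4[of "A * i"] by (simp add: tol_def i_def mult.assoc)
  have "(2::real) ^ 1 \<le> 2 ^ (A * i)" using i assms by (intro power_increasing) auto
  then have lt: "\<not> tol A j0 j \<ge> 2" unfolding t by (simp add: divide_less_eq not_le)
  have "ln (1 + 2 / tol A j0 j) \<le> ln (2 ^ (A * i + 1))"
    unfolding t by (subst ln_le_cancel_iff) (auto intro: add_pos_pos)
  also have "\<dots> = real (A * i + 1) * ln 2" by (rule ln_realpow)
  also have "\<dots> \<le> real (A * i + 1) * 1" using ln_2_less_1 by (intro mult_left_mono) auto
  finally have "window_cost (tol A j0 j) \<le> real A * real i + 4" using lt by (simp add: window_cost_def)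
  also have "\<dots> \<le> (real A + 4) * real i" using i by (simp add: distrib_right)
  finally show ?thesis by (simp add: i_def)
qed

definition tail_const :: "nat \<Rightarrow> real" where "tail_const m = 2 * fact (2 * m + 1) * 2 ^ (2 * m + 1)"

text \<open>The fourth power of the window 2 / halfroot^i is 16 * 2^i, so the cost decays like 2^(-i
  m) for any m; the choice of m can beat the growth 2^(d i) of the number of tests.\<close>

lemma cost_fine:
  assumes "j0 \<le> j"
  shows "window_cost (tol A j0 j) \<le> tail_const m * (1 / 2 ^ (j - j0)) ^ m"
proof -
  define i where "i = j - j0"
  have t: "tol A j0 j = 2 / halfroot ^ i" using assms by (simp add: tol_def i_def)
  have "halfroot ^ i \<le> 1" using halfroot_bounds by (simp add: power_le_one)
  then have "tol A j0 j \<ge> 2" unfolding t using halfroot_bounds by (simp add: le_divide_eq)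
  then have "window_cost (tol A j0 j) \<le> tail_const m / (tol A j0 j ^ 4) ^ m"
    unfolding tail_const_def by (rule window_cost_large_le)
  also have "tol A j0 j ^ 4 = 16 * 2 ^ i"
    unfolding t using halfroot_power4[of i] by (simp add: power_divide power_mult[symmetric] mult.commute)
  also have "tail_const m / (16 * 2 ^ i) ^ m \<le> tail_const m / (2 ^ i) ^ m"
    unfolding tail_const_def by (intro divide_left_mono power_mono) auto
  also have "\<dots> = tail_const m * (1 / 2 ^ i) ^ m" by (simp add: power_divide)
  finally show ?thesis by (simp add: i_def)
qed

lemma sum_power_le: "(\<Sum>j\<le>n. Q ^ j) \<le> 2 * Q ^ n" if "Q \<ge> 2" for Q :: real
proof (induction n)
  case (Suc n)
  have "2 * Q ^ n \<le> Q * Q ^ n" using that by (intro mult_right_mono) auto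
  then show ?case using Suc by simp
qed (use that in simp)

lemma sum_power_weighted_le: "(\<Sum>j<n. Q ^ j * real (n - j)) \<le> 2 * Q ^ n" if Q: "Q \<ge> 2" for Q :: real
proof (induction n)
  case (Suc n)
  have "(\<Sum>j<Suc n. Q ^ j * real (Suc n - j)) = (\<Sum>j<Suc n. Q ^ j * real (n - j) + Q ^ j)"
    by (intro sum.cong refl) (simp add: Suc_diff_le distrib_left)
  also have "\<dots> = (\<Sum>j<n. Q ^ j * real (n - j)) + (\<Sum>j\<le>n. Q ^ j)"
    by (simp add: sum.distrib lessThan_Suc_atMost[symmetric])
  also have "\<dots> \<le> 4 * Q ^ n" using Suc sum_power_le[OF Q, of n] by simp
  also have "\<dots> \<le> 2 * Q ^ Suc n" using Q by simp
  finally show ?case .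
qed (use Q in simp)

lemma sum_geometric_le: "(\<Sum>j<n. x ^ j) \<le> 1 / (1 - x)" if "0 \<le> x" "x < 1" for x :: real
  using that by (subst sum_gp_strict) (auto intro!: divide_right_mono)

text \<open>Both sides are dominated by j = j0: below it the cost grows only linearly against the
  geometric 2^(d j), above it the power m = d + 1 leaves a spare factor 2^-i.\<close>

lemma sum_cost_le:
  assumes d: "d \<ge> 1" and A: "A \<ge> 1"
  shows "(\<Sum>j\<le>L. (2 ^ d) ^ j * window_cost (tol A j0 j)) \<le> (2 * (real A + 4) + 2 * tail_const (Suc d)) * (2 ^ d) ^ j0"
proof -
  define Q where "Q = (2::real) ^ d"
  have "(2::real) ^ 1 \<le> 2 ^ d" using d by (intro power_increasing) auto
  then have Q: "Q \<ge> 2" by (simp add: Q_def)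
  have nn: "Q ^ j * window_cost (tol A j0 j) \<ge> 0" for j
    using Q tol_pos window_cost_nonneg by (intro mult_nonneg_nonneg) auto
  have "(\<Sum>j\<le>L. Q ^ j * window_cost (tol A j0 j)) \<le> (\<Sum>j\<in>{..<j0} \<union> {j0..<j0 + Suc L}. Q ^ j * window_cost (tol A j0 j))"
    using nn by (intro sum_mono2) auto
  also have "\<dots> = (\<Sum>j<j0. Q ^ j * window_cost (tol A j0 j)) + (\<Sum>j\<in>{j0..<j0 + Suc L}. Q ^ j * window_cost (tol A j0 j))"
    by (rule sum.union_disjoint) auto
  also have "(\<Sum>j<j0. Q ^ j * window_cost (tol A j0 j)) \<le> (\<Sum>j<j0. (real A + 4) * (Q ^ j * real (j0 - j)))"
  proof (rule sum_mono)
    fix j assume "j \<in> {..<j0}"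
    then have "Q ^ j * window_cost (tol A j0 j) \<le> Q ^ j * ((real A + 4) * real (j0 - j))"
      using cost_coarse[of j j0 A] A Q by (intro mult_left_mono) auto
    then show "Q ^ j * window_cost (tol A j0 j) \<le> (real A + 4) * (Q ^ j * real (j0 - j))" by (simp only: mult_ac)
  qed
  also have "(\<Sum>j<j0. (real A + 4) * (Q ^ j * real (j0 - j))) \<le> (real A + 4) * (2 * Q ^ j0)"
    unfolding sum_distrib_left[symmetric] by (intro mult_left_mono sum_power_weighted_le Q) auto
  also have "(\<Sum>j\<in>{j0..<j0 + Suc L}. Q ^ j * window_cost (tol A j0 j)) \<le> (\<Sum>i<Suc L. Q ^ j0 * tail_const (Suc d) * (1/2) ^ i)"
  proof -
    have "(\<Sum>j\<in>{j0..<j0 + Suc L}. Q ^ j * window_cost (tol A j0 j)) = (\<Sum>i<Suc L. Q ^ (i + j0) * window_cost (tol A j0 (i + j0)))"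
      using sum.shift_bounds_nat_ivl[of "\<lambda>j. Q ^ j * window_cost (tol A j0 j)" 0 j0 "Suc L"]
      by (simp add: atLeast0LessThan add.commute)
    also have "\<dots> \<le> (\<Sum>i<Suc L. Q ^ j0 * tail_const (Suc d) * (1/2) ^ i)"
    proof (rule sum_mono)
      fix i
      have "Q ^ (i + j0) * window_cost (tol A j0 (i + j0)) \<le> Q ^ (i + j0) * (tail_const (Suc d) * (1 / 2 ^ i) ^ Suc d)"
        using cost_fine[of j0 "i + j0" A "Suc d"] Q by (intro mult_left_mono) auto
      also have "\<dots> = Q ^ j0 * tail_const (Suc d) * (1/2) ^ i"
      proof -
        have "Q ^ i * (1 / 2 ^ i) ^ d = 1"
          by (simp add: Q_def power_divide power_mult[symmetric] mult.commute)
        then have "Q ^ i * (1 / 2 ^ i) ^ Suc d = (1/2) ^ i"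
          by (simp only: power_Suc mult.left_commute[of "Q ^ i"]) (simp add: power_divide)
        moreover have "Q ^ (i + j0) * (tail_const (Suc d) * (1 / 2 ^ i) ^ Suc d) = Q ^ j0 * tail_const (Suc d) * (Q ^ i * (1 / 2 ^ i) ^ Suc d)"
          by (simp only: power_add mult_ac)
        ultimately show ?thesis by simp
      qed
      finally show "Q ^ (i + j0) * window_cost (tol A j0 (i + j0)) \<le> Q ^ j0 * tail_const (Suc d) * (1/2) ^ i" .
    qed
    finally show ?thesis .
  qed
  also have "(\<Sum>i<Suc L. Q ^ j0 * tail_const (Suc d) * (1/2) ^ i) \<le> Q ^ j0 * tail_const (Suc d) * (1 / (1 - 1/2))"
    unfolding sum_distrib_left[symmetric] using Q
    by (intro mult_left_mono sum_geometric_le) (auto simp: tail_const_def)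
  finally show ?thesis by (simp add: Q_def algebra_simps)
qed

text \<open>\<open>halfroot ^ ((2 + 4 * r) * j)\<close> is 2^(-j (r + 1/2)), the scale dependence of
  the standard deviation. Going down from \<open>j0\<close> the windows shrink by 2^-(k+2) per
  scale, which outweighs the growth by 2^(r + 1/2); going up they widen by 2^(1/4) against a decay
  of at least 2^(1/2). So the sum has the order of its term at \<open>j0\<close>.\<close>

lemma sum_tol_le:
  assumes "r \<le> k"
  shows "(\<Sum>j\<le>L. tol (k + 2) j0 j * halfroot ^ ((2 + 4 * r) * j)) \<le> 4 / (1 - halfroot) * halfroot ^ ((2 + 4 * r) * j0)"
proof -
  let ?c = "2 * halfroot ^ ((2 + 4 * r) * j0)"
  have halfroot: "0 < halfroot" "halfroot < 1" "0 \<le> halfroot" "halfroot \<le> 1" using halfroot_bounds by auto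
  have c: "?c \<ge> 0" using halfroot by simp
  have coarse: "tol (k + 2) j0 j * halfroot ^ ((2 + 4 * r) * j) \<le> ?c * halfroot ^ (j0 - Suc j)" if j: "j < j0" for j
  proof -
    define i where "i = j0 - j"
    have i: "j0 = i + j" "j0 - j = i" "i \<ge> 1" using j by (auto simp: i_def)
    have "(2 + 4 * r) * i + i \<le> 4 * (k + 2) * i"
    proof -
      have "(2 + 4 * r + 1) * i \<le> (4 * (k + 2)) * i" using assms by (intro mult_right_mono) auto
      then show ?thesis by (simp add: algebra_simps)
    qed
    then have "(2 + 4 * r) * j0 + (j0 - Suc j) \<le> 4 * (k + 2) * (j0 - j) + (2 + 4 * r) * j"
      unfolding i(2) using i(3) by (simp add: i(1) algebra_simps)
    then have "halfroot ^ (4 * (k + 2) * (j0 - j) + (2 + 4 * r) * j) \<le> halfroot ^ ((2 + 4 * r) * j0 + (j0 - Suc j))"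
      using halfroot by (intro power_decreasing) auto
    then have "2 * halfroot ^ (4 * (k + 2) * (j0 - j)) * halfroot ^ ((2 + 4 * r) * j) \<le> 2 * halfroot ^ ((2 + 4 * r) * j0) * halfroot ^ (j0 - Suc j)"
      by (simp only: power_add[symmetric] mult.assoc)
    then show ?thesis using j by (simp only: tol_def if_True)
  qed
  have fine: "tol (k + 2) j0 (i + j0) * halfroot ^ ((2 + 4 * r) * (i + j0)) \<le> ?c * halfroot ^ i" for i
  proof -
    have "halfroot ^ ((2 + 4 * r) * (i + j0)) = halfroot ^ ((2 + 4 * r) * j0) * halfroot ^ ((1 + 4 * r) * i) * halfroot ^ i"
      by (simp add: power_add[symmetric] algebra_simps)
    then have "tol (k + 2) j0 (i + j0) * halfroot ^ ((2 + 4 * r) * (i + j0)) = ?c * halfroot ^ ((1 + 4 * r) * i)"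
      using halfroot by (simp add: tol_def)
    also have "\<dots> \<le> ?c * halfroot ^ i" using halfroot c by (intro mult_left_mono power_decreasing) auto
    finally show ?thesis .
  qed
  have nn: "tol (k + 2) j0 j * halfroot ^ ((2 + 4 * r) * j) \<ge> 0" for j
    using halfroot tol_pos[of "k + 2" j0 j] by simp
  have "(\<Sum>j\<le>L. tol (k + 2) j0 j * halfroot ^ ((2 + 4 * r) * j)) \<le> (\<Sum>j\<in>{..<j0} \<union> {j0..<j0 + Suc L}. tol (k + 2) j0 j * halfroot ^ ((2 + 4 * r) * j))"
    using nn by (intro sum_mono2) auto
  also have "\<dots> = (\<Sum>j<j0. tol (k + 2) j0 j * halfroot ^ ((2 + 4 * r) * j)) + (\<Sum>j\<in>{j0..<j0 + Suc L}. tol (k + 2) j0 j * halfroot ^ ((2 + 4 * r) * j))"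
    by (rule sum.union_disjoint) auto
  also have "(\<Sum>j<j0. tol (k + 2) j0 j * halfroot ^ ((2 + 4 * r) * j)) \<le> (\<Sum>j<j0. ?c * halfroot ^ (j0 - Suc j))"
    using coarse by (intro sum_mono) auto
  also have "(\<Sum>j<j0. ?c * halfroot ^ (j0 - Suc j)) = ?c * (\<Sum>j<j0. halfroot ^ j)"
    unfolding sum_distrib_left[symmetric] by (subst sum.nat_diff_reindex) simp
  also have "(\<Sum>j\<in>{j0..<j0 + Suc L}. tol (k + 2) j0 j * halfroot ^ ((2 + 4 * r) * j)) \<le> ?c * (\<Sum>i<Suc L. halfroot ^ i)"
  proof -
    have "(\<Sum>j\<in>{j0..<j0 + Suc L}. tol (k + 2) j0 j * halfroot ^ ((2 + 4 * r) * j)) =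
       (\<Sum>i<Suc L. tol (k + 2) j0 (i + j0) * halfroot ^ ((2 + 4 * r) * (i + j0)))"
      using sum.shift_bounds_nat_ivl[of "\<lambda>j. tol (k + 2) j0 j * halfroot ^ ((2 + 4 * r) * j)" 0 j0 "Suc L"]
      by (simp add: atLeast0LessThan add.commute)
    also have "\<dots> \<le> (\<Sum>i<Suc L. ?c * halfroot ^ i)" by (intro sum_mono fine)
    finally show ?thesis by (simp only: sum_distrib_left)
  qed
  also have "?c * (\<Sum>j<j0. halfroot ^ j) \<le> ?c * (1 / (1 - halfroot))"
    using halfroot c by (intro mult_left_mono sum_geometric_le) auto
  also have "?c * (\<Sum>i<Suc L. halfroot ^ i) \<le> ?c * (1 / (1 - halfroot))"
    using halfroot c by (intro mult_left_mono sum_geometric_le) auto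
  finally show ?thesis by simp
qed

text \<open>As (2^d)^j0 has the order of N, 2^-j0 has the order of N^(-1/d). Bounding the exponent
  (2 r + 1) / (2 d) by k + 1 makes the constant independent of r.\<close>

lemma halfroot_power_scale_le:
  assumes d: "d \<ge> 1" and C: "C \<ge> 1" and N: "real N > 0" and lt: "real N < C * (2 ^ d) ^ Suc j0" and r: "r \<le> k"
  shows "halfroot ^ ((2 + 4 * r) * j0) \<le> (C * 2 ^ d) ^ Suc k * real N powr (- ((2 * real r + 1) / (2 * real d)))"
proof -
  define h where "h = (1 / 2 :: real) ^ j0"
  have hpos: "h > 0" by (simp add: h_def)
  define e where "e = (2 * real r + 1) / 2"
  have e: "e > 0" by (simp add: e_def)
  have "halfroot ^ ((2 + 4 * r) * j0) = halfroot powr (real ((2 + 4 * r) * j0))"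
    using halfroot_bounds by (intro powr_realpow[symmetric])
  also have "\<dots> = (1/2) powr (real j0 * e)"
    unfolding halfroot_def e_def powr_powr by (rule arg_cong[where f = "\<lambda>x. _ powr x"]) (simp add: field_simps)
  also have "\<dots> = h powr e"
    unfolding h_def by (simp only: powr_powr[symmetric]) (simp add: powr_realpow)
  also have "\<dots> = (h ^ d) powr (e / d)"
    using d hpos by (simp add: powr_powr flip: powr_realpow)
  also have "\<dots> \<le> (C * 2 ^ d / N) powr (e / d)"
  proof (rule powr_mono2)
    have "h ^ d * (2 ^ d) ^ j0 = 1"
      by (simp add: h_def power_divide power_mult[symmetric] mult.commute)
    then have "h ^ d = 1 / (2 ^ d) ^ j0" by (simp add: field_simps)
    also have "\<dots> \<le> C * 2 ^ d / N" using lt N by (simp add: field_simps)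
    finally show "h ^ d \<le> C * 2 ^ d / N" .
  qed (use e hpos in auto)
  also have "\<dots> = (C * 2 ^ d) powr (e / d) * N powr (- (e / d))"
    using N C by (simp add: powr_divide powr_minus_divide)
  also have "(C * 2 ^ d) powr (e / d) \<le> (C * 2 ^ d) ^ Suc k"
  proof -
    have "1 * 1 \<le> C * 2 ^ d" using C by (intro mult_mono) auto
    then have 1: "1 \<le> C * 2 ^ d" by simp
    have "e / d \<le> e" using d e by (simp add: divide_le_eq)
    also have "e \<le> real (Suc k)" using r by (simp add: e_def)
    finally have "(C * 2 ^ d) powr (e / d) \<le> (C * 2 ^ d) powr real (Suc k)"
      using 1 by (intro powr_mono) auto
    then show ?thesis using 1 by (subst (asm) powr_realpow) auto
  qed
  finally show ?thesis by (simp add: e_def mult_right_mono)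
qed

section \<open>Signs that balance ridge sums\<close>

lemma exists_scale:
  fixes N Q C :: real
  assumes "Q \<ge> 2" "C > 0" "N \<ge> C"
  obtains j0 where "C * Q ^ j0 \<le> N" "N < C * Q ^ Suc j0"
proof -
  obtain n where "N / C < Q ^ n" using real_arch_pow[of Q "N / C"] assms(1) by auto
  then have ex: "N < C * Q ^ n" using assms(2) by (simp add: divide_less_eq mult.commute)
  define m where "m = (LEAST n. N < C * Q ^ n)"
  have m: "N < C * Q ^ m" unfolding m_def by (rule LeastI[of "\<lambda>n. N < C * Q ^ n", OF ex])
  have "m \<noteq> 0"
  proof
    assume "m = 0"
    then show False using m assms(3) by simp
  qed
  then obtain j0 where j0: "m = Suc j0" using not0_implies_Suc by blast
  have "\<not> N < C * Q ^ j0" by (rule not_less_Least) (simp add: m_def[symmetric] j0)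
  then show thesis using m by (intro that[of j0]) (auto simp: j0)
qed

lemma sqrt_tol_eq:
  fixes N R :: real
  assumes "N \<ge> 0"
  shows "sqrt (2 * N / 2 ^ j) * (R / 2 ^ j) ^ r = sqrt (2 * N) * R ^ r * halfroot ^ ((2 + 4 * r) * j)"
proof -
  have "halfroot ^ (2 * j) = sqrt (1 / 2 ^ j)"
  proof (rule real_sqrt_unique[symmetric])
    show "(halfroot ^ (2 * j))\<^sup>2 = 1 / 2 ^ j" using halfroot_power4[of j] by (simp add: power_mult[symmetric] mult.commute mult.left_commute)
  qed (use halfroot_bounds in simp)
  moreover have "(1 / 2 ^ j) ^ r = halfroot ^ (4 * (j * r))"
    unfolding halfroot_power4 by (simp add: power_divide power_mult)
  moreover have "sqrt (2 * N / 2 ^ j) = sqrt (2 * N) * sqrt (1 / 2 ^ j)"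
    by (simp add: real_sqrt_mult[symmetric])
  moreover have "(R / 2 ^ j) ^ r = R ^ r * (1 / 2 ^ j) ^ r" by (simp add: power_divide)
  moreover have "halfroot ^ ((2 + 4 * r) * j) = halfroot ^ (2 * j) * halfroot ^ (4 * (j * r))"
    by (simp add: power_add[symmetric] algebra_simps)
  ultimately show ?thesis by (simp only: mult_ac)
qed

definition words_le :: "nat \<Rightarrow> 'd::finite list set" where "words_le k = {v. length v \<le> k}"

lemma finite_words_le: "finite (words_le k :: 'd::finite list set)"
  using finite_lists_length_le[of "UNIV :: 'd set" k] by (simp add: words_le_def)

definition admissible :: "'i set \<Rightarrow> ('i \<Rightarrow> real^'d::finite) \<Rightarrow> ('i \<Rightarrow> real) \<Rightarrow> bool" where
  "admissible I \<omega> b \<longleftrightarrow> finite I \<and> (\<forall>i\<in>I. norm (\<omega> i) = 1 \<and> \<bar>b i\<bar> \<le> 1)"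

text \<open>The last conjunct concerns no derivative: it controls the change of the l1 mass of the
  weights, which the restriction to \<open>Sigma_nM n 1\<close> requires.\<close>

definition balanced_signs :: "nat \<Rightarrow> real \<Rightarrow> 'i set \<Rightarrow> ('i \<Rightarrow> real^'d::finite) \<Rightarrow> ('i \<Rightarrow> real) \<Rightarrow> ('i \<Rightarrow> real) \<Rightarrow> ('i \<Rightarrow> real) \<Rightarrow> bool" where
  "balanced_signs k C I \<omega> b e \<xi> \<longleftrightarrow>
      (\<forall>i. \<xi> i \<in> {-1, 0, 1}) \<and> real (card {i\<in>I. \<xi> i \<noteq> 0}) \<ge> real (card I) / 10 \<and>
      (\<forall>w x. length w \<le> k \<and> x \<in> cball 0 1 \<longrightarrow>
        \<bar>\<Sum>i\<in>I. \<xi> i * e i * wmono w (\<omega> i) * sigma_k (k - length w) (\<omega> i \<bullet> x + b i)\<bar>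
         \<le> C * (sqrt (card I) * real (card I) powr (- ((2 * real (k - length w) + 1) / (2 * real CARD('d)))))) \<and>
      \<bar>\<Sum>i\<in>I. \<xi> i * \<bar>e i\<bar>\<bar> \<le> C * (sqrt (card I) * real (card I) powr (- ((2 * real k + 1) / (2 * real CARD('d)))))"

text \<open>There is one test for each scale, net point and word (\<open>Some\<close>) and one for
  the l1 mass (\<open>None\<close>). Their total cost is at most C3 * 2^(d j0), and
  \<open>j0\<close> is the last scale at which four times this amount fits into N.\<close>

theorem ridge_coloring:
  fixes k :: nat
  shows "\<exists>C::real. \<exists>N0::nat. C > 0 \<and> N0 > 0 \<and> (\<forall>(I :: 'i set) (\<omega> :: 'i \<Rightarrow> real^'d::finite) b e.
    admissible I \<omega> b \<and> card I \<ge> N0 \<and> (\<forall>i\<in>I. \<bar>e i\<bar> \<le> 1) \<longrightarrow> (\<exists>\<xi>. balanced_signs k C I \<omega> b e \<xi>))"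
proof -
  let ?d = "CARD('d)"
  have d: "?d \<ge> 1" by (simp add: Suc_leI)
  then have dr: "real ?d \<ge> 1" by linarith
  define W where "W = real (card (words_le k :: 'd list set))"
  define C1 where "C1 = 2 * (5 * real ?d * (?d + 1)) ^ ?d"
  define Q where "Q = (2::real) ^ ?d"
  \<comment> \<open>The 1 in \<open>W + 1\<close> pays for the mass test.\<close>
  define C3 where "C3 = (W + 1) * C1 * (2 * (real (k + 2) + 4) + 2 * tail_const (Suc ?d))"
  define RR where "RR = 20 * real ?d"
  have RR: "RR \<ge> 1" using dr unfolding RR_def by linarith
  have W: "W \<ge> 0" by (simp add: W_def)
  have "(2::real) ^ 1 \<le> 2 ^ ?d" using d by (intro power_increasing) auto
  then have Q: "Q \<ge> 2" by (simp add: Q_def)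
  have tail_const: "tail_const (Suc ?d) \<ge> 0" by (simp add: tail_const_def)
  have C1: "C1 \<ge> 1"
  proof -
    have "1 \<le> 5 * real ?d" using dr by linarith
    then have "1 * 1 \<le> 5 * real ?d * (?d + 1)" by (intro mult_mono) auto
    then have "1 \<le> (5 * real ?d * (?d + 1)) ^ ?d" by (intro one_le_power) simp
    then show ?thesis by (simp add: C1_def)
  qed
  have C3: "C3 \<ge> 1"
  proof -
    have "1 * 1 * 1 \<le> (W + 1) * C1 * (2 * (real (k + 2) + 4) + 2 * tail_const (Suc ?d))"
      using W C1 tail_const by (intro mult_mono) auto
    then show ?thesis by (simp add: C3_def)
  qed
  define Cc where "Cc = 4 * C3"
  define B where "B = sqrt 2 * RR ^ k * (4 / (1 - halfroot)) * (Cc * Q) ^ Suc k"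
  define C where "C = (1 + real ?d) ^ k * B"
  have CcQ: "Cc * Q > 0" using C3 Q by (simp add: Cc_def)
  have B: "B > 0" unfolding B_def using RR CcQ halfroot_bounds by simp
  have C: "C > 0" "B \<le> C"
  proof -
    have "1 * B \<le> (1 + real ?d) ^ k * B" using B by (intro mult_right_mono one_le_power) auto
    then show "B \<le> C" by (simp add: C_def)
    with B show "C > 0" by linarith
  qed
  define N0 where "N0 = nat \<lceil>Cc\<rceil>"
  have N0: "N0 > 0" using C3 by (simp add: N0_def Cc_def)
  show ?thesis
  proof (intro exI[of _ C] exI[of _ N0] conjI C(1) N0 allI impI)
    fix I :: "'i set" and \<omega> :: "'i \<Rightarrow> real^'d" and b e :: "'i \<Rightarrow> real"
    assume asm: "admissible I \<omega> b \<and> card I \<ge> N0 \<and> (\<forall>i\<in>I. \<bar>e i\<bar> \<le> 1)"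
    then have I: "finite I" "card I \<ge> N0" and e: "\<And>i. i \<in> I \<Longrightarrow> \<bar>e i\<bar> \<le> 1"
      by (auto simp: admissible_def)
    define N where "N = card I"
    have N: "N > 0" "real N \<ge> Cc" using I(2) N0 unfolding N_def N0_def by linarith+
    obtain j0 where j0: "Cc * Q ^ j0 \<le> real N" "real N < Cc * Q ^ Suc j0"
      using exists_scale[OF Q _ N(2)] C3 by (auto simp: Cc_def)
    define tl where "tl = tol (k + 2) j0"
    have tl: "tl j > 0" for j unfolding tl_def by (rule tol_pos)
    \<comment> \<open>N \<le> 2^L makes the chains end without remainder; 2^L \<le> 2 N lets the
      nets exist at every scale.\<close>
    obtain L where L: "N \<le> 2 ^ L" "2 ^ L \<le> 2 * N"
    proof -
      obtain j where j: "1 * 2 ^ j \<le> real N" "real N < 1 * 2 ^ Suc j"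
        using exists_scale[of 2 1 "real N"] N(1) by auto
      have "real N \<le> real (2 ^ Suc j)" "real (2 ^ Suc j) \<le> real (2 * N)" using j by auto
      then have "N \<le> 2 ^ Suc j" "2 ^ Suc j \<le> 2 * N" unfolding of_nat_le_iff by auto
      then show thesis by (rule that)
    qed
    have IN: "card I > 0" "2 ^ L \<le> 2 * card I" using N L unfolding N_def by auto
    obtain Net :: "nat \<Rightarrow> (real^'d) set" and near :: "nat \<Rightarrow> real^'d \<Rightarrow> real^'d" where nets:
      "\<And>j. j \<le> L \<Longrightarrow> finite (Net j)" "\<And>j. j \<le> L \<Longrightarrow> Net j \<subseteq> cball 0 1"
      "\<And>j. j \<le> L \<Longrightarrow> real (card (Net j)) \<le> C1 * Q ^ j"
      "\<And>j x. j \<le> L \<Longrightarrow> x \<in> cball 0 1 \<Longrightarrow> near j x \<in> Net j"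
      "\<And>j x a. j \<le> L \<Longrightarrow> x \<in> cball 0 1 \<Longrightarrow> \<bar>x $ a - near j x $ a\<bar> \<le> 10 / 2 ^ j"
      "\<And>j x. j \<le> L \<Longrightarrow> x \<in> cball 0 1 \<Longrightarrow>
       real (card {i\<in>I. (\<omega> i \<bullet> x + b i \<ge> 0) \<noteq> (\<omega> i \<bullet> near j x + b i \<ge> 0)}) < card I / 2 ^ j"
      using that by (rule exists_nets[OF I(1) IN, where \<omega> = \<omega> and b = b, folded C1_def Q_def])
    interpret hyperplane_nets I \<omega> b L Net near
      using asm L(1) nets by unfold_locales (auto simp: N_def admissible_def)
    have R: "R = RR" by (simp add: R_def RR_def)
    define S where "S = (SIGMA j:{..L}. Net j \<times> (words_le k :: 'd list set))"
    define T where "T = insert None (Some ` S)"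
    define c where "c = (\<lambda>q. case q of None \<Rightarrow> (\<lambda>i. \<bar>e i\<bar>)
      | Some (j, y, v) \<Rightarrow> (\<lambda>i. e i * jump j y i * wmono v (\<omega> i) * p i y ^ (k - length v)))"
    \<comment> \<open>The variance of the mass test is at most N, but it receives the deviation of a
      scale-0 test with r = k, so that its bound is the term j = 0 of the sum \<open>A k\<close>
      defined below.\<close>
    define s where "s = (\<lambda>q. case q of None \<Rightarrow> sqrt (2 * real N) * R ^ k
      | Some (j, y :: real^'d, v :: 'd list) \<Rightarrow> sqrt (2 * real N / 2 ^ j) * (R / 2 ^ j) ^ (k - length v))"
    define \<mu> where "\<mu> = (\<lambda>q. case q of None \<Rightarrow> tl 0 | Some (j, y :: real^'d, v :: 'd list) \<Rightarrow> tl j)"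
    have finS: "finite S" unfolding S_def using nets(1) finite_words_le by (intro finite_SigmaI) auto
    have finT: "finite T" unfolding T_def using finS by simp
    have cost: "(\<Sum>q\<in>T. window_cost (\<mu> q)) \<le> real (card I) / 4"
    proof -
      have nn: "window_cost (tl j) \<ge> 0" for j using tl window_cost_nonneg by blast
      have "(\<Sum>q\<in>T. window_cost (\<mu> q)) = window_cost (tl 0) + (\<Sum>q\<in>S. window_cost (\<mu> (Some q)))"
        unfolding T_def using finS by (simp add: sum.reindex \<mu>_def)
      also have "(\<Sum>q\<in>S. window_cost (\<mu> (Some q))) = (\<Sum>j\<le>L. \<Sum>z\<in>Net j \<times> (words_le k :: 'd list set). window_cost (tl j))"
        unfolding S_def \<mu>_def using nets(1) finite_words_le by (subst sum.Sigma) (auto simp: case_prod_beta)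
      also have "\<dots> = (\<Sum>j\<le>L. W * (real (card (Net j)) * window_cost (tl j)))"
        by (simp add: card_cartesian_product W_def mult_ac)
      also have "\<dots> \<le> (\<Sum>j\<le>L. W * (C1 * Q ^ j * window_cost (tl j)))"
        using W nn nets(3) by (intro sum_mono mult_left_mono mult_right_mono) auto
      also have "\<dots> = W * C1 * (\<Sum>j\<le>L. Q ^ j * window_cost (tl j))"
        by (simp only: sum_distrib_left mult_ac)
      also have "window_cost (tl 0) \<le> C1 * (\<Sum>j\<le>L. Q ^ j * window_cost (tl j))"
      proof -
        have "Q ^ 0 * window_cost (tl 0) \<le> (\<Sum>j\<le>L. Q ^ j * window_cost (tl j))"
          using nn Q by (intro member_le_sum) auto
        moreover have "(\<Sum>j\<le>L. Q ^ j * window_cost (tl j)) \<ge> 0" using nn Q by (intro sum_nonneg) auto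
        then have "1 * (\<Sum>j\<le>L. Q ^ j * window_cost (tl j)) \<le> C1 * (\<Sum>j\<le>L. Q ^ j * window_cost (tl j))"
          using C1 by (intro mult_right_mono) auto
        ultimately show ?thesis by simp
      qed
      finally have "(\<Sum>q\<in>T. window_cost (\<mu> q)) \<le> (W + 1) * C1 * (\<Sum>j\<le>L. Q ^ j * window_cost (tl j))"
        by (simp add: algebra_simps)
      also have "\<dots> \<le> (W + 1) * C1 * ((2 * (real (k + 2) + 4) + 2 * tail_const (Suc ?d)) * Q ^ j0)"
        unfolding Q_def tl_def using W C1 d by (intro mult_left_mono sum_cost_le) auto
      also have "\<dots> = Cc * Q ^ j0 / 4" by (simp add: C3_def Cc_def mult.assoc)
      also have "\<dots> \<le> real (card I) / 4" using j0(1) by (simp add: N_def)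
      finally show ?thesis .
    qed
    obtain \<xi> :: "'i \<Rightarrow> real" where \<xi>: "\<And>i. \<xi> i \<in> {-1, 0, 1}"
      "real (card {i\<in>I. \<xi> i \<noteq> 0}) \<ge> real (card I) / 10"
      "\<And>q. q \<in> T \<Longrightarrow> \<bar>\<Sum>i\<in>I. \<xi> i * c q i\<bar> \<le> \<mu> q * s q"
    proof (rule partial_coloring[OF I(1) _ finT _ _ _ cost, of c s])
      show "I \<noteq> {}" using N by (auto simp: N_def)
      have Rp: "R > 0" using R_ge by linarith
      show "s q > 0" for q using N Rp by (auto simp: s_def split: option.split)
      show "\<mu> q > 0" for q using tl by (auto simp: \<mu>_def split: option.split)
      fix q assume q: "q \<in> T"
      show "(\<Sum>i\<in>I. (c q i)\<^sup>2) \<le> (s q)\<^sup>2"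
      proof (cases q)
        case None
        have "(\<Sum>i\<in>I. (c q i)\<^sup>2) \<le> (\<Sum>i\<in>I. 1)"
          using e None by (intro sum_mono) (auto simp: c_def abs_square_le_1)
        also have "\<dots> = real N" by (simp add: N_def)
        also have "\<dots> \<le> 2 * real N * (R ^ k)\<^sup>2"
        proof -
          have "1 \<le> (R ^ k)\<^sup>2" using RR unfolding R by (intro one_le_power)
          then have "2 * real N * 1 \<le> 2 * real N * (R ^ k)\<^sup>2" by (intro mult_left_mono) auto
          then show ?thesis by simp
        qed
        finally show ?thesis using None by (simp add: s_def power_mult_distrib)
      next
        case (Some z)
        then obtain j y v where z: "q = Some (j, y, v)" "j \<le> L" "y \<in> Net j" "length v \<le> k"
          using q by (auto simp: T_def S_def words_le_def)
        show ?thesis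
          using jump_variance[OF z(2) _ e, where y = y and v = v and r = "k - length v"] nets(2)[OF z(2)] z(3)
          unfolding z(1) c_def s_def by (auto simp: N_def)
      qed
    qed (rule that)
    define A where "A = (\<lambda>r. \<Sum>j\<le>L. tl j * sqrt (2 * real N / 2 ^ j) * (R / 2 ^ j) ^ r)"
    have A: "A r \<le> B * (sqrt (real N) * real N powr (- ((2 * real r + 1) / (2 * real ?d))))" if r: "r \<le> k" for r
    proof -
      have "A r = sqrt (2 * real N) * RR ^ r * (\<Sum>j\<le>L. tl j * halfroot ^ ((2 + 4 * r) * j))"
        unfolding A_def sum_distrib_left R mult.assoc[of "tl _"] sqrt_tol_eq[OF of_nat_0_le_iff]
        by (intro sum.cong refl) (simp only: mult_ac)
      also have "\<dots> \<le> sqrt (2 * real N) * RR ^ r * (4 / (1 - halfroot) * halfroot ^ ((2 + 4 * r) * j0))"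
        unfolding tl_def using RR by (intro mult_left_mono sum_tol_le r) auto
      also have "\<dots> \<le> sqrt (2 * real N) * RR ^ k * (4 / (1 - halfroot) * ((Cc * Q) ^ Suc k * real N powr (- ((2 * real r + 1) / (2 * real ?d)))))"
      proof (intro mult_mono order_refl power_increasing r RR)
        show "halfroot ^ ((2 + 4 * r) * j0) \<le> (Cc * Q) ^ Suc k * real N powr (- ((2 * real r + 1) / (2 * real ?d)))"
          unfolding Q_def using d C3 N j0(2) r by (intro halfroot_power_scale_le) (auto simp: Cc_def Q_def)
      qed (use halfroot_bounds RR in auto)
      also have "\<dots> = B * (sqrt (real N) * real N powr (- ((2 * real r + 1) / (2 * real ?d))))"
        by (simp only: B_def real_sqrt_mult mult_ac)
      finally show ?thesis .
    qed
    show "\<exists>\<xi>. balanced_signs k C I \<omega> b e \<xi>"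
      unfolding balanced_signs_def
    proof (intro exI[of _ \<xi>] conjI allI impI)
      show "\<xi> i \<in> {-1, 0, 1}" for i by (rule \<xi>(1))
      show "real (card {i\<in>I. \<xi> i \<noteq> 0}) \<ge> real (card I) / 10" by (rule \<xi>(2))
    next
      fix w :: "'d list" and x :: "real^'d" assume wx: "length w \<le> k \<and> x \<in> cball 0 1"
      let ?r = "k - length w"
      have "\<bar>\<Sum>i\<in>I. \<xi> i * e i * wmono w (\<omega> i) * sigma_k ?r (p i x)\<bar>
        \<le> (1 + real ?d) ^ ?r * A ?r"
        unfolding A_def
      proof (rule chaining_bound)
        show "tl j * sqrt (2 * real N / 2 ^ j) \<ge> 0" for j using tl[of j] by simp
        fix j y and v :: "'d list" assume j: "j \<le> L" "y \<in> Net j" "length v \<le> k"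
        then have "Some (j, y, v) \<in> T" by (auto simp: T_def S_def words_le_def)
        from \<xi>(3)[OF this] show "\<bar>\<Sum>i\<in>I. \<xi> i * e i * jump j y i * wmono v (\<omega> i) * p i y ^ (k - length v)\<bar>
          \<le> tl j * sqrt (2 * real N / 2 ^ j) * (R / 2 ^ j) ^ (k - length v)"
          unfolding c_def \<mu>_def s_def by (simp add: mult.assoc)
      qed (use wx in auto)
      also have "\<dots> \<le> (1 + real ?d) ^ k * (B * (sqrt (real N) * real N powr (- ((2 * real ?r + 1) / (2 * real ?d)))))"
      proof (intro mult_mono power_increasing A)
        show "0 \<le> A ?r" unfolding A_def using tl R_ge
          by (intro sum_nonneg mult_nonneg_nonneg) (auto intro: less_imp_le)
      qed auto
      finally show "\<bar>\<Sum>i\<in>I. \<xi> i * e i * wmono w (\<omega> i) * sigma_k ?r (\<omega> i \<bullet> x + b i)\<bar>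
         \<le> C * (sqrt (card I) * real (card I) powr (- ((2 * real ?r + 1) / (2 * real ?d))))"
        by (simp only: C_def N_def p_def mult.assoc)
    next
      have "\<bar>\<Sum>i\<in>I. \<xi> i * \<bar>e i\<bar>\<bar> \<le> tl 0 * (sqrt (2 * real N) * R ^ k)"
        using \<xi>(3)[of None] by (simp add: T_def c_def s_def \<mu>_def)
      also have "\<dots> \<le> A k"
      proof -
        have "tl 0 * sqrt (2 * real N / 2 ^ 0) * (R / 2 ^ 0) ^ k \<le> A k"
          unfolding A_def using tl R_ge
          by (intro member_le_sum mult_nonneg_nonneg) (auto intro: less_imp_le)
        then show ?thesis by (simp add: mult.assoc)
      qed
      also have "\<dots> \<le> B * (sqrt (real N) * real N powr (- ((2 * real k + 1) / (2 * real ?d))))" by (rule A) simp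
      also have "\<dots> \<le> C * (sqrt (real N) * real N powr (- ((2 * real k + 1) / (2 * real ?d))))"
        by (rule mult_right_mono[OF C(2)]) (intro mult_nonneg_nonneg real_sqrt_ge_zero powr_ge_zero of_nat_0_le_iff)
      finally show "\<bar>\<Sum>i\<in>I. \<xi> i * \<bar>e i\<bar>\<bar> \<le> C * (sqrt (card I) * real (card I) powr (- ((2 * real k + 1) / (2 * real ?d))))"
        by (simp only: N_def)
    qed
  qed
qed

section \<open>Sparse ridge approximation\<close>

definition ridge_rate :: "nat \<Rightarrow> nat \<Rightarrow> nat \<Rightarrow> real" where
  "ridge_rate d k m = 1/2 + (2 * real (k - m) + 1) / (2 * real d)"

lemma ridge_rate_bounds: "d \<ge> 1 \<Longrightarrow> ridge_rate d k m \<ge> 1/2" "d \<ge> 1 \<Longrightarrow> ridge_rate d k m \<le> real k + 1"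
proof -
  assume d: "d \<ge> 1"
  then show "ridge_rate d k m \<ge> 1/2" by (simp add: ridge_rate_def)
  have "(2 * real (k - m) + 1) / (2 * real d) \<le> (2 * real k + 1) / 2"
    using d by (intro frac_le) auto
  then show "ridge_rate d k m \<le> real k + 1" by (simp add: ridge_rate_def add_divide_distrib)
qed

text \<open>The derivative of the combination along the word \<open>w\<close>, without the factor k!
  / (k - |w|)!, which \<open>wbound_ridge_sum\<close> restores.\<close>

definition ridge_sum :: "'i set \<Rightarrow> ('i \<Rightarrow> real^'d::finite) \<Rightarrow> ('i \<Rightarrow> real) \<Rightarrow> nat \<Rightarrow> ('i \<Rightarrow> real) \<Rightarrow> 'd list \<Rightarrow> real^'d \<Rightarrow> real" where
  "ridge_sum I \<omega> b k a w x = (\<Sum>i\<in>I. a i * wmono w (\<omega> i) * sigma_k (k - length w) (\<omega> i \<bullet> x + b i))"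

lemma ridge_sum_diff: "ridge_sum I \<omega> b k (\<lambda>i. a i - a' i) w x = ridge_sum I \<omega> b k a w x - ridge_sum I \<omega> b k a' w x"
  by (simp add: ridge_sum_def left_diff_distrib sum_subtractf)

lemma ridge_sum_scale: "ridge_sum I \<omega> b k (\<lambda>i. c * a i) w x = c * ridge_sum I \<omega> b k a w x"
  by (simp add: ridge_sum_def sum_distrib_left mult.assoc)

definition ridge_close :: "'i set \<Rightarrow> ('i \<Rightarrow> real^'d::finite) \<Rightarrow> ('i \<Rightarrow> real) \<Rightarrow> nat \<Rightarrow> nat \<Rightarrow> ('i \<Rightarrow> real) \<Rightarrow> ('i \<Rightarrow> real) \<Rightarrow> real \<Rightarrow> bool" where
  "ridge_close I \<omega> b k m a a' \<delta> \<longleftrightarrow> (\<forall>w x. length w \<le> m \<and> x \<in> cball 0 1 \<longrightarrow>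
     \<bar>ridge_sum I \<omega> b k a w x - ridge_sum I \<omega> b k a' w x\<bar> \<le> \<delta>)"

lemma abs_ridge_sum_le:
  assumes "admissible I \<omega> b" "x \<in> cball 0 1"
  shows "\<bar>ridge_sum I \<omega> b k a w x\<bar> \<le> 2 ^ k * (\<Sum>i\<in>I. \<bar>a i\<bar>)"
proof -
  have "\<bar>ridge_sum I \<omega> b k a w x\<bar> \<le> (\<Sum>i\<in>I. \<bar>a i\<bar> * 1 * 2 ^ k)"
    unfolding ridge_sum_def
  proof (rule order_trans[OF sum_abs], rule sum_mono)
    fix i assume i: "i \<in> I"
    let ?p = "\<omega> i \<bullet> x + b i"
    have "\<bar>\<omega> i \<bullet> x\<bar> \<le> norm (\<omega> i) * norm x" by (rule Cauchy_Schwarz_ineq2)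
    also have "\<dots> \<le> 1" using assms i by (simp add: admissible_def)
    finally have p: "\<bar>?p\<bar> \<le> 2" using assms(1) i unfolding admissible_def by force
    have "\<bar>sigma_k (k - length w) ?p\<bar> \<le> 1 * \<bar>?p\<bar> ^ (k - length w)"
      unfolding sigma_k_eq abs_mult power_abs by (intro mult_right_mono) auto
    also have "\<dots> \<le> 1 * 2 ^ (k - length w)" using p by (intro mult_left_mono power_mono) auto
    also have "\<dots> \<le> 2 ^ k" by (simp add: power_increasing)
    finally have "\<bar>sigma_k (k - length w) ?p\<bar> \<le> 2 ^ k" .
    moreover have "\<bar>wmono w (\<omega> i)\<bar> \<le> 1" using assms i by (intro abs_wmono_le_1) (simp add: admissible_def)
    ultimately show "\<bar>a i * wmono w (\<omega> i) * sigma_k (k - length w) ?p\<bar> \<le> \<bar>a i\<bar> * 1 * 2 ^ k"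
      unfolding abs_mult by (intro mult_mono) auto
  qed
  also have "\<dots> = 2 ^ k * (\<Sum>i\<in>I. \<bar>a i\<bar>)" by (simp add: sum_distrib_left mult.commute)
  finally show ?thesis .
qed

section \<open>Thinning by a fixed fraction and its iteration\<close>

definition sparsifies :: "nat \<Rightarrow> nat \<Rightarrow> real \<Rightarrow> 'i set \<Rightarrow> ('i \<Rightarrow> real^'d::finite) \<Rightarrow> ('i \<Rightarrow> real) \<Rightarrow> ('i \<Rightarrow> real) \<Rightarrow> ('i \<Rightarrow> real) \<Rightarrow> bool" where
  "sparsifies k m \<delta> I \<omega> b a a' \<longleftrightarrow> real (card {i\<in>I. a' i \<noteq> 0}) \<le> 39/40 * real (card I) \<and>
     ridge_close I \<omega> b k m a a' \<delta> \<and> (\<Sum>i\<in>I. \<bar>a' i\<bar>) \<le> (\<Sum>i\<in>I. \<bar>a i\<bar>) + \<delta>"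

text \<open>Mass at most 2 allows at most N/2 atoms heavier than 4/N; the others are coloured. After
  a global change of sign the value -1 is at least as frequent as 1, so at least N/40 atoms get
  weight a_i (1 - 1) = 0. As 1 + \<eta>_i is never negative, the l1 mass changes by exactly the sum
  of the \<eta>_i |a_i|, which is balanced.\<close>

lemma sparsify_step:
  fixes k :: nat
  shows "\<exists>C::real. \<exists>N0::nat. C > 0 \<and> N0 > 0 \<and> (\<forall>(I :: 'i set) (\<omega> :: 'i \<Rightarrow> real^'d::finite) b a m.
    admissible I \<omega> b \<and> card I \<ge> N0 \<and> m \<le> k \<and> (\<Sum>i\<in>I. \<bar>a i\<bar>) \<le> 2 \<longrightarrow>
    (\<exists>a'. sparsifies k m (C * real (card I) powr (- ridge_rate CARD('d) k m)) I \<omega> b a a'))"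
proof -
  let ?d = "CARD('d)"
  have d: "?d \<ge> 1" by (simp add: Suc_leI)
  obtain C :: real and N1 :: nat where C: "C > 0" "N1 > 0" and col: "\<And>(I :: 'i set) (\<omega> :: 'i \<Rightarrow> real^'d) b e.
    admissible I \<omega> b \<and> card I \<ge> N1 \<and> (\<forall>i\<in>I. \<bar>e i\<bar> \<le> 1) \<Longrightarrow> \<exists>\<xi>. balanced_signs k C I \<omega> b e \<xi>"
    using ridge_coloring[where 'i = 'i and 'd = 'd and k = k] by blast
  define C' where "C' = 4 * C * 2 ^ (k + 1)"
  have C': "C' > 0" using C by (simp add: C'_def)
  show ?thesis
  proof (intro exI[of _ C'] exI[of _ "2 * N1"] conjI C' allI impI)
    show "2 * N1 > 0" using C by simp
    fix I :: "'i set" and \<omega> :: "'i \<Rightarrow> real^'d" and b a :: "'i \<Rightarrow> real" and m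
    assume asm: "admissible I \<omega> b \<and> card I \<ge> 2 * N1 \<and> m \<le> k \<and> (\<Sum>i\<in>I. \<bar>a i\<bar>) \<le> 2"
    then have I: "finite I" "card I \<ge> 2 * N1" and m: "m \<le> k" and mass: "(\<Sum>i\<in>I. \<bar>a i\<bar>) \<le> 2"
      and at: "\<And>i. i \<in> I \<Longrightarrow> norm (\<omega> i) = 1 \<and> \<bar>b i\<bar> \<le> 1" by (auto simp: admissible_def)
    define N where "N = real (card I)"
    have N: "N > 0" using I C by (simp add: N_def)
    define J where "J = {i\<in>I. \<bar>a i\<bar> \<le> 4 / N}"
    define N' where "N' = real (card J)"
    have J: "J \<subseteq> I" "finite J" using I by (auto simp: J_def)
    have "real (card (I - J)) * (4 / N) \<le> 2"
    proof -
      have "real (card (I - J)) * (4 / N) = (\<Sum>i\<in>I - J. 4 / N)" by simp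
      also have "\<dots> \<le> (\<Sum>i\<in>I - J. \<bar>a i\<bar>)" by (intro sum_mono) (auto simp: J_def)
      also have "\<dots> \<le> (\<Sum>i\<in>I. \<bar>a i\<bar>)" using I by (intro sum_mono2) auto
      finally show ?thesis using mass by linarith
    qed
    then have "real (card (I - J)) \<le> N / 2" using N by (simp add: field_simps)
    moreover have "real (card (I - J)) = N - N'"
      using J I by (simp add: card_Diff_subset N_def N'_def of_nat_diff card_mono)
    ultimately have N': "N' \<ge> N / 2" "N' \<le> N" using card_mono[OF I(1) J(1)] by (auto simp: N_def N'_def)
    have cardJ: "card J \<ge> N1" using N'(1) I(2) unfolding N_def N'_def by linarith
    then have N'1: "N' \<ge> 1" using C(2) unfolding N'_def by linarith
    define e where "e = (\<lambda>i. a i * N / 4)"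
    have e: "\<bar>e i\<bar> \<le> 1" if "i \<in> J" for i
      using that N by (simp add: J_def e_def abs_mult field_simps)
    have ae: "a i = 4 / N * e i" for i using N by (simp add: e_def)
    have "admissible J \<omega> b \<and> card J \<ge> N1 \<and> (\<forall>i\<in>J. \<bar>e i\<bar> \<le> 1)"
      using J cardJ e at by (auto simp: admissible_def)
    from col[OF this] obtain \<xi> where "balanced_signs k C J \<omega> b e \<xi>" ..
    note \<xi> = this[unfolded balanced_signs_def, THEN conjunct1]
      this[unfolded balanced_signs_def, THEN conjunct2, THEN conjunct1]
      this[unfolded balanced_signs_def, THEN conjunct2, THEN conjunct2, THEN conjunct1]
      this[unfolded balanced_signs_def, THEN conjunct2, THEN conjunct2, THEN conjunct2]
    define P where "P = {i\<in>J. \<xi> i = 1}"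
    define M where "M = {i\<in>J. \<xi> i = - 1}"
    define \<eta> where "\<eta> = (\<lambda>i. if card P \<le> card M then \<xi> i else - \<xi> i)"
    have \<eta>: "\<eta> i \<in> {-1, 0, 1}" for i using \<xi>(1)[rule_format, of i] by (auto simp: \<eta>_def)
    have \<eta>_sum: "\<bar>\<Sum>i\<in>J. \<eta> i * f i\<bar> = \<bar>\<Sum>i\<in>J. \<xi> i * f i\<bar>" for f
      by (cases "card P \<le> card M") (simp_all add: \<eta>_def sum_negf)
    have PM: "real (card P) + real (card M) \<ge> N' / 10"
    proof -
      have "{i\<in>J. \<xi> i \<noteq> 0} = P \<union> M" using \<xi>(1) by (auto simp: P_def M_def)
      moreover have "card (P \<union> M) \<le> card P + card M" by (rule card_Un_le)
      ultimately have "card {i\<in>J. \<xi> i \<noteq> 0} \<le> card P + card M" by simp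
      then show ?thesis using \<xi>(2) unfolding N'_def by linarith
    qed
    define D where "D = {i\<in>J. \<eta> i = - 1}"
    have "D = (if card P \<le> card M then M else P)" by (auto simp: D_def \<eta>_def M_def P_def)
    then have D: "real (card D) \<ge> N / 40" using PM N'(1) by (auto split: if_splits)
    define a' where "a' = (\<lambda>i. if i \<in> J then a i * (1 + \<eta> i) else a i)"
    \<comment> \<open>The factor 4 / N from normalising the weights turns sqrt N' * N'^-s into at
      most 4 N'^(-1/2 - s), and N' \<ge> N/2 leads back to N; since the rate is at most k + 1, this
      loses at most 2^(k+1).\<close>
    have conv: "4 / N * (C * (sqrt N' * N' powr (- ((2 * real r + 1) / (2 * real ?d))))) \<le> C' * N powr (- ridge_rate ?d k m)"
      if r: "r \<ge> k - m" for r
    proof -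
      have "4 / N * (C * (sqrt N' * N' powr (- ((2 * real r + 1) / (2 * real ?d)))))
        \<le> 4 / N' * (C * (sqrt N' * N' powr (- ((2 * real r + 1) / (2 * real ?d)))))"
        using N' N'1 C by (intro mult_right_mono divide_left_mono) auto
      also have "\<dots> = 4 * C * N' powr (-1/2 - ((2 * real r + 1) / (2 * real ?d)))"
      proof -
        define s where "s = (2 * real r + 1) / (2 * real ?d)"
        have "N' powr (-1/2 - s) = N' powr (- 1 + 1/2 + - s)" by simp
        also have "\<dots> = N' powr (- 1) * N' powr (1/2) * N' powr (- s)" by (simp only: powr_add)
        also have "N' powr (- 1) = 1 / N'" using N'1 by (simp add: powr_minus_divide)
        also have "N' powr (1/2) = sqrt N'" using N'1 by (simp add: powr_half_sqrt)
        finally show ?thesis unfolding s_def[symmetric] by simp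
      qed
      also have "\<dots> \<le> 4 * C * N' powr (- ridge_rate ?d k m)"
      proof (intro mult_left_mono powr_mono)
        have "(2 * real (k - m) + 1) / (2 * real ?d) \<le> (2 * real r + 1) / (2 * real ?d)"
          using r by (intro divide_right_mono) auto
        then show "-1/2 - (2 * real r + 1) / (2 * real ?d) \<le> - ridge_rate ?d k m" by (simp add: ridge_rate_def)
      qed (use N'1 C in auto)
      also have "\<dots> \<le> 4 * C * (N / 2) powr (- ridge_rate ?d k m)"
        using N' N C ridge_rate_bounds(1)[OF d, of k m] by (intro mult_left_mono powr_mono2') auto
      also have "(N / 2) powr (- ridge_rate ?d k m) = 2 powr (ridge_rate ?d k m) * N powr (- ridge_rate ?d k m)"
        using N by (simp add: powr_divide powr_minus_divide)
      also have "4 * C * (2 powr (ridge_rate ?d k m) * N powr (- ridge_rate ?d k m)) \<le> 4 * C * (2 ^ (k + 1) * N powr (- ridge_rate ?d k m))"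
      proof (intro mult_left_mono mult_right_mono)
        have "2 powr ridge_rate ?d k m \<le> (2::real) powr real (k + 1)" using ridge_rate_bounds(2)[OF d, of k m] by (intro powr_mono) auto
        then show "2 powr ridge_rate ?d k m \<le> (2::real) ^ (k + 1)" by (subst (asm) powr_realpow) auto
      qed (use C in auto)
      finally show ?thesis by (simp only: C'_def mult.assoc)
    qed
    show "\<exists>a'. sparsifies k m (C' * real (card I) powr (- ridge_rate ?d k m)) I \<omega> b a a'"
      unfolding sparsifies_def
    proof (intro exI[of _ a'] conjI)
      have "{i\<in>I. a' i \<noteq> 0} \<subseteq> I - D" by (auto simp: a'_def D_def)
      then have "card {i\<in>I. a' i \<noteq> 0} \<le> card (I - D)" using I by (intro card_mono) auto
      moreover have "D \<subseteq> I" using J by (auto simp: D_def)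
      then have "real (card (I - D)) = N - card D"
        using I by (simp add: card_Diff_subset finite_subset N_def of_nat_diff card_mono)
      ultimately show "real (card {i\<in>I. a' i \<noteq> 0}) \<le> 39/40 * real (card I)"
        using D unfolding N_def by linarith
    next
      show "ridge_close I \<omega> b k m a a' (C' * real (card I) powr (- ridge_rate ?d k m))"
        unfolding ridge_close_def
      proof (intro allI impI)
        fix w :: "'d list" and x :: "real^'d" assume wx: "length w \<le> m \<and> x \<in> cball 0 1"
        let ?h = "\<lambda>i. wmono w (\<omega> i) * sigma_k (k - length w) (\<omega> i \<bullet> x + b i)"
        have "ridge_sum I \<omega> b k a w x - ridge_sum I \<omega> b k a' w x = (\<Sum>i\<in>I. (a i - a' i) * ?h i)"
          unfolding ridge_sum_diff[symmetric] by (simp add: ridge_sum_def mult.assoc)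
        also have "\<dots> = (\<Sum>i\<in>J. (a i - a' i) * ?h i)"
          using I J by (intro sum.mono_neutral_right) (auto simp: a'_def)
        also have "\<dots> = (\<Sum>i\<in>J. - (4 / N) * (\<eta> i * (e i * ?h i)))"
        proof (intro sum.cong refl)
          fix i assume "i \<in> J"
          then have "a i - a' i = - (a i * \<eta> i)" by (simp add: a'_def distrib_left)
          also have "\<dots> = - (4 / N) * (\<eta> i * e i)" by (simp add: ae[of i])
          finally show "(a i - a' i) * ?h i = - (4 / N) * (\<eta> i * (e i * ?h i))" by (simp only: mult.assoc)
        qed
        also have "\<dots> = - (4 / N) * (\<Sum>i\<in>J. \<eta> i * (e i * ?h i))" by (simp only: sum_distrib_left)
        finally have "\<bar>ridge_sum I \<omega> b k a w x - ridge_sum I \<omega> b k a' w x\<bar> = 4 / N * \<bar>\<Sum>i\<in>J. \<xi> i * (e i * ?h i)\<bar>"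
          using N by (simp add: abs_mult \<eta>_sum)
        also have "\<dots> \<le> 4 / N * (C * (sqrt N' * N' powr (- ((2 * real (k - length w) + 1) / (2 * real ?d)))))"
          using \<xi>(3)[rule_format, of w x] wx m N unfolding N'_def
          by (intro mult_left_mono) (auto simp: mult.assoc)
        also have "\<dots> \<le> C' * N powr (- ridge_rate ?d k m)" using wx by (intro conv) auto
        finally show "\<bar>ridge_sum I \<omega> b k a w x - ridge_sum I \<omega> b k a' w x\<bar> \<le> C' * real (card I) powr (- ridge_rate ?d k m)"
          by (simp only: N_def)
      qed
    next
      have "(\<Sum>i\<in>I. \<bar>a' i\<bar> - \<bar>a i\<bar>) = (\<Sum>i\<in>J. \<bar>a' i\<bar> - \<bar>a i\<bar>)"
        using I J by (intro sum.mono_neutral_right) (auto simp: a'_def)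
      also have "\<dots> = (\<Sum>i\<in>J. 4 / N * (\<eta> i * \<bar>e i\<bar>))"
      proof (intro sum.cong refl)
        fix i assume "i \<in> J"
        then have "\<bar>a' i\<bar> = \<bar>a i\<bar> * (1 + \<eta> i)" using \<eta>[of i] by (auto simp: a'_def abs_mult)
        moreover have "\<bar>a i\<bar> = 4 / N * \<bar>e i\<bar>" using N unfolding ae[of i] by (simp add: abs_mult)
        ultimately show "\<bar>a' i\<bar> - \<bar>a i\<bar> = 4 / N * (\<eta> i * \<bar>e i\<bar>)" by (simp add: distrib_left)
      qed
      also have "\<dots> = 4 / N * (\<Sum>i\<in>J. \<eta> i * \<bar>e i\<bar>)" by (simp only: sum_distrib_left)
      also have "\<dots> \<le> 4 / N * \<bar>\<Sum>i\<in>J. \<xi> i * \<bar>e i\<bar>\<bar>"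
        unfolding \<eta>_sum[symmetric] using N by (intro mult_left_mono) auto
      also have "\<dots> \<le> 4 / N * (C * (sqrt N' * N' powr (- ((2 * real k + 1) / (2 * real ?d)))))"
        using \<xi>(4) N unfolding N'_def by (intro mult_left_mono) auto
      also have "\<dots> \<le> C' * N powr (- ridge_rate ?d k m)" by (intro conv) auto
      finally show "(\<Sum>i\<in>I. \<bar>a' i\<bar>) \<le> (\<Sum>i\<in>I. \<bar>a i\<bar>) + C' * real (card I) powr (- ridge_rate ?d k m)"
        by (simp add: sum_subtractf N_def)
    qed
  qed
qed

text \<open>Makes the errors telescope: a step reduces N to at most 39/40 N, so N^-r is bounded by a
  multiple of its own increment. 81/80 is a rational lower bound for sqrt (40/39), the worst case r
  = 1/2.\<close>

lemma powr_gap: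
  fixes r N N' :: real
  assumes "r \<ge> 1/2" "0 < N'" "N' \<le> 39/40 * N"
  shows "N powr (- r) \<le> 80 * (N' powr (- r) - N powr (- r))"
proof -
  have N: "N > 0" using assms(2,3) by simp
  have "81/80 \<le> sqrt (40/39::real)" by (rule real_le_rsqrt) (simp add: power2_eq_square)
  also have "\<dots> = (40/39::real) powr (1/2)" by (simp add: powr_half_sqrt)
  also have "\<dots> \<le> (40/39::real) powr r" using assms(1) by (intro powr_mono) auto
  finally have "81/80 * N powr (- r) \<le> (40/39::real) powr r * N powr (- r)" by (intro mult_right_mono) auto
  also have "\<dots> = (39/40 * N) powr (- r)"
    using N by (simp add: powr_mult powr_minus_divide powr_divide)
  also have "\<dots> \<le> N' powr (- r)" using assms by (intro powr_mono2') auto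
  finally show ?thesis by simp
qed

text \<open>\<open>E\<close> is a potential bounding all remaining errors. While more than n atoms
  survive, \<open>powr_gap\<close> pays for a step by the growth of N^-r. The last step may fall far
  below n, where \<open>E\<close> is 0; for it the doubled term 2 n^-r reserves 80 C n^-r. Including
  \<open>E\<close> in the mass budget keeps every intermediate mass at most 2, as a step
  demands.\<close>

lemma sparsify_iterate:
  fixes I :: "'i set" and \<omega> :: "'i \<Rightarrow> real^'d::finite" and a b :: "'i \<Rightarrow> real"
  assumes step: "\<And>(I :: 'i set) a. admissible I \<omega> b \<Longrightarrow> card I \<ge> N0 \<Longrightarrow> (\<Sum>i\<in>I. \<bar>a i\<bar>) \<le> 2 \<Longrightarrow>
    \<exists>a'. sparsifies k m (C * real (card I) powr (- r)) I \<omega> b a a'"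
    and C: "C > 0" and r: "r \<ge> 1/2" and n: "n \<ge> N0" "n > 0"
    and E_def: "\<And>N. E N = (if N \<le> n then 0 else 80 * C * (2 * real n powr (- r) - real N powr (- r)))"
    and adm: "admissible I \<omega> b" and mass: "(\<Sum>i\<in>I. \<bar>a i\<bar>) + E (card I) \<le> 2"
  shows "\<exists>a'. card {i\<in>I. a' i \<noteq> 0} \<le> n \<and> ridge_close I \<omega> b k m a a' (E (card I)) \<and>
       (\<Sum>i\<in>I. \<bar>a' i\<bar>) \<le> (\<Sum>i\<in>I. \<bar>a i\<bar>) + E (card I)"
  using adm mass
proof (induction "card I" arbitrary: I a rule: less_induct)
  case less
  have finI: "finite I" using less.prems(1) by (simp add: admissible_def)
  show ?case
  proof (cases "card I \<le> n")
    case True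
    have "card {i\<in>I. a i \<noteq> 0} \<le> card I" using finI by (intro card_mono) auto
    then show ?thesis using True by (intro exI[of _ a]) (auto simp: E_def ridge_close_def)
  next
    case False
    define N where "N = card I"
    have N: "N > n" "real N > 0" using False n by (auto simp: N_def)
    have Nn: "real N powr (- r) \<le> real n powr (- r)" using N n r by (intro powr_mono2') auto
    have Epos: "E M \<ge> 0" for M
    proof (cases "M \<le> n")
      case False
      then have "real M powr (- r) \<le> real n powr (- r)" using n r by (intro powr_mono2') auto
      then have "0 \<le> 2 * real n powr (- r) - real M powr (- r)" using powr_ge_zero[of "real n" "- r"] by linarith
      then show ?thesis using C False by (simp add: E_def)
    qed (simp add: E_def)
    have "(\<Sum>i\<in>I. \<bar>a i\<bar>) \<le> 2" using less.prems(2) Epos[of "card I"] by linarith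
    then obtain a1 where "sparsifies k m (C * real N powr (- r)) I \<omega> b a a1"
      using step[OF less.prems(1), of a] n N unfolding N_def by auto
    then have a1: "real (card {i\<in>I. a1 i \<noteq> 0}) \<le> 39/40 * real N"
      "ridge_close I \<omega> b k m a a1 (C * real N powr (- r))"
      "(\<Sum>i\<in>I. \<bar>a1 i\<bar>) \<le> (\<Sum>i\<in>I. \<bar>a i\<bar>) + C * real N powr (- r)"
      unfolding sparsifies_def N_def by auto
    define I1 where "I1 = {i\<in>I. a1 i \<noteq> 0}"
    have I1: "I1 \<subseteq> I" "finite I1" using finI by (auto simp: I1_def)
    have card1: "real (card I1) \<le> 39/40 * real N" using a1(1) by (simp add: I1_def)
    have lt: "card I1 < card I" using card1 N(2) unfolding N_def by linarith
    have adm1: "admissible I1 \<omega> b" using less.prems(1) I1 by (auto simp: admissible_def)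
    have restr: "(\<Sum>i\<in>I. \<bar>a1 i\<bar>) = (\<Sum>i\<in>I1. \<bar>a1 i\<bar>)"
      using finI by (intro sum.mono_neutral_right) (auto simp: I1_def)
    have EE: "E (card I1) + C * real N powr (- r) \<le> E N"
    proof (cases "card I1 \<le> n")
      case True
      have "1 * (C * real N powr (- r)) \<le> 80 * (C * real n powr (- r))"
        using C Nn by (intro mult_mono) auto
      also have "\<dots> \<le> 80 * (C * (2 * real n powr (- r) - real N powr (- r)))"
        using C Nn by (intro mult_left_mono) auto
      finally show ?thesis using True N(1) by (simp add: E_def)
    next
      case False
      then have "0 < real (card I1)" using n by linarith
      from powr_gap[OF r this card1] have "C * real N powr (- r) \<le> C * (80 * (real (card I1) powr (- r) - real N powr (- r)))"
        using C by (intro mult_left_mono) auto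
      then show ?thesis using False N(1) by (simp add: E_def algebra_simps)
    qed
    have "(\<Sum>i\<in>I1. \<bar>a1 i\<bar>) + E (card I1) \<le> 2"
      using a1(3) EE less.prems(2) unfolding restr N_def by linarith
    from less.hyps[OF lt adm1 this] obtain a2 where a2: "card {i\<in>I1. a2 i \<noteq> 0} \<le> n"
      "ridge_close I1 \<omega> b k m a1 a2 (E (card I1))"
      "(\<Sum>i\<in>I1. \<bar>a2 i\<bar>) \<le> (\<Sum>i\<in>I1. \<bar>a1 i\<bar>) + E (card I1)" by blast
    define a' where "a' = (\<lambda>i. if i \<in> I1 then a2 i else 0)"
    have "{i\<in>I. a' i \<noteq> 0} = {i\<in>I1. a2 i \<noteq> 0}" using I1 by (auto simp: a'_def)
    then have 1: "card {i\<in>I. a' i \<noteq> 0} \<le> n" using a2(1) by simp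
    have sums: "(\<Sum>i\<in>I. f (a' i) i) = (\<Sum>i\<in>I1. f (a2 i) i)" if "\<And>i. f 0 i = 0" for f :: "real \<Rightarrow> 'i \<Rightarrow> real"
    proof -
      have "(\<Sum>i\<in>I. f (a' i) i) = (\<Sum>i\<in>I1. f (a' i) i)"
        using finI I1 that by (intro sum.mono_neutral_right) (auto simp: a'_def)
      then show ?thesis by (simp add: a'_def)
    qed
    have 2: "ridge_close I \<omega> b k m a a' (E (card I))"
      unfolding ridge_close_def
    proof (intro allI impI)
      fix w :: "'d list" and x :: "real^'d" assume wx: "length w \<le> m \<and> x \<in> cball 0 1"
      have "ridge_sum I \<omega> b k a' w x = ridge_sum I1 \<omega> b k a2 w x"
        unfolding ridge_sum_def by (rule sums) simp
      moreover have "ridge_sum I \<omega> b k a1 w x = ridge_sum I1 \<omega> b k a1 w x"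
        unfolding ridge_sum_def using finI by (intro sum.mono_neutral_right) (auto simp: I1_def)
      moreover have "\<bar>ridge_sum I \<omega> b k a w x - ridge_sum I \<omega> b k a1 w x\<bar> \<le> C * real N powr (- r)"
        using a1(2) wx by (simp add: ridge_close_def)
      moreover have "\<bar>ridge_sum I1 \<omega> b k a1 w x - ridge_sum I1 \<omega> b k a2 w x\<bar> \<le> E (card I1)"
        using a2(2) wx by (simp add: ridge_close_def)
      ultimately show "\<bar>ridge_sum I \<omega> b k a w x - ridge_sum I \<omega> b k a' w x\<bar> \<le> E (card I)"
        using EE unfolding N_def by linarith
    qed
    have "(\<Sum>i\<in>I. \<bar>a' i\<bar>) = (\<Sum>i\<in>I1. \<bar>a2 i\<bar>)" by (rule sums) simp
    then have 3: "(\<Sum>i\<in>I. \<bar>a' i\<bar>) \<le> (\<Sum>i\<in>I. \<bar>a i\<bar>) + E (card I)"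
      using a2(3) a1(3) EE unfolding restr N_def by linarith
    from 1 2 3 show ?thesis by blast
  qed
qed

text \<open>The number of initial atoms does not enter the bound. For large n the iteration ends
  with mass at most 1 + e, where e is of the order of the error, and division by 1 + e restores mass
  1 at a comparable cost. For small n the zero combination suffices, since ridge sums of mass 1 are
  bounded by 2^k.\<close>

theorem sparse_ridge_approximation:
  fixes k :: nat
  shows "\<exists>K::real. K > 0 \<and> (\<forall>(I :: 'i set) (\<omega> :: 'i \<Rightarrow> real^'d::finite) b a m n.
    admissible I \<omega> b \<and> n \<ge> 1 \<and> m \<le> k \<and> (\<Sum>i\<in>I. \<bar>a i\<bar>) \<le> 1 \<longrightarrow>
    (\<exists>a'. card {i\<in>I. a' i \<noteq> 0} \<le> n \<and> (\<Sum>i\<in>I. \<bar>a' i\<bar>) \<le> 1 \<and>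
       ridge_close I \<omega> b k m a a' (K * real n powr (- ridge_rate CARD('d) k m))))"
proof -
  let ?d = "CARD('d)"
  have d: "?d \<ge> 1" by (simp add: Suc_leI)
  obtain C :: real and N0 :: nat where C: "C > 0" "N0 > 0" and step: "\<And>(I :: 'i set) (\<omega> :: 'i \<Rightarrow> real^'d) b a m.
    admissible I \<omega> b \<and> card I \<ge> N0 \<and> m \<le> k \<and> (\<Sum>i\<in>I. \<bar>a i\<bar>) \<le> 2 \<Longrightarrow>
    \<exists>a'. sparsifies k m (C * real (card I) powr (- ridge_rate ?d k m)) I \<omega> b a a'"
    using sparsify_step[where 'i = 'i and 'd = 'd and k = k] by blast
  \<comment> \<open>For n \<ge> (160 C)^2 the error 160 C n^-r is at most 1, because r \<ge> 1/2;
    initial mass 1 then fits the budget 2.\<close>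
  define n0 where "n0 = max N0 (nat \<lceil>(160 * C)\<^sup>2\<rceil>)"
  have n0: "n0 \<ge> N0" "real n0 \<ge> (160 * C)\<^sup>2" "n0 > 0" using C unfolding n0_def by linarith+
  \<comment> \<open>The first summand covers the iteration and the rescaling for n \<ge> n0; the
    second makes K n^-r at least 2^k for n < n0.\<close>
  define K where "K = 160 * C * (1 + 2 ^ k) + 2 ^ k * real n0 ^ (k + 1)"
  have Kpos: "K > 0" unfolding K_def using C by (intro add_pos_nonneg mult_pos_pos) auto
  show ?thesis
  proof (intro exI[of _ K] conjI Kpos allI impI)
    fix I :: "'i set" and \<omega> :: "'i \<Rightarrow> real^'d" and b a :: "'i \<Rightarrow> real" and m n :: nat
    assume "admissible I \<omega> b \<and> 1 \<le> n \<and> m \<le> k \<and> (\<Sum>i\<in>I. \<bar>a i\<bar>) \<le> 1"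
    then have adm: "admissible I \<omega> b" and n: "n \<ge> 1" and m: "m \<le> k" and mass: "(\<Sum>i\<in>I. \<bar>a i\<bar>) \<le> 1" by auto
    define r where "r = ridge_rate ?d k m"
    have r: "r \<ge> 1/2" "r \<le> real k + 1" using ridge_rate_bounds[OF d, of k m] by (auto simp: r_def)
    define q where "q = real n powr (- r)"
    have q: "q \<ge> 0" by (simp add: q_def)
    show "\<exists>a'. card {i\<in>I. a' i \<noteq> 0} \<le> n \<and> (\<Sum>i\<in>I. \<bar>a' i\<bar>) \<le> 1 \<and>
       ridge_close I \<omega> b k m a a' (K * real n powr (- ridge_rate ?d k m))"
    proof (cases "n \<ge> n0")
      case False
      have "2 ^ k \<le> K * q"
      proof -
        have "1 = real n0 powr r * real n0 powr (- r)" using n0 by (simp add: powr_minus)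
        also have "\<dots> \<le> real n0 ^ (k + 1) * q"
          unfolding q_def
        proof (intro mult_mono)
          have "real n0 powr r \<le> real n0 powr real (k + 1)" using r n0 by (intro powr_mono) auto
          then show "real n0 powr r \<le> real n0 ^ (k + 1)" using n0 by (subst (asm) powr_realpow) auto
          show "real n0 powr (- r) \<le> real n powr (- r)" using False n r by (intro powr_mono2') auto
        qed auto
        finally have "2 ^ k * 1 \<le> 2 ^ k * (real n0 ^ (k + 1) * q)" by (intro mult_left_mono) auto
        also have "\<dots> \<le> K * q" unfolding K_def using q C by (simp add: distrib_right)
        finally show ?thesis by simp
      qed
      moreover have "\<bar>ridge_sum I \<omega> b k a w x\<bar> \<le> 2 ^ k" if "x \<in> cball 0 1" for w x
      proof -
        have "\<bar>ridge_sum I \<omega> b k a w x\<bar> \<le> 2 ^ k * (\<Sum>i\<in>I. \<bar>a i\<bar>)" by (rule abs_ridge_sum_le[OF adm that])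
        also have "\<dots> \<le> 2 ^ k * 1" using mass by (intro mult_left_mono) auto
        finally show ?thesis by simp
      qed
      moreover have "ridge_sum I \<omega> b k (\<lambda>i. 0) w x = 0" for w x by (simp add: ridge_sum_def)
      ultimately have "ridge_close I \<omega> b k m a (\<lambda>i. 0) (K * q)"
        unfolding ridge_close_def by (auto intro: order_trans)
      then show ?thesis by (intro exI[of _ "\<lambda>i. 0"]) (auto simp: q_def r_def)
    next
      case True
      define E where "E = (\<lambda>N. if N \<le> n then 0 else 80 * C * (2 * real n powr (- r) - real N powr (- r)))"
      define e where "e = 160 * C * q"
      have E: "E N \<le> e" for N
      proof (cases "N \<le> n")
        case False
        have "80 * C * (2 * real n powr (- r) - real N powr (- r)) \<le> 80 * C * (2 * real n powr (- r))"
          using C by (intro mult_left_mono) auto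
        then show ?thesis using False by (simp add: E_def e_def q_def)
      qed (use C q in \<open>simp add: E_def e_def\<close>)
      have e: "0 \<le> e" "e \<le> 1"
      proof -
        show "0 \<le> e" using C q by (simp add: e_def)
        have "q \<le> real n powr (- (1/2))" unfolding q_def using n r by (intro powr_mono) auto
        also have "\<dots> = 1 / sqrt (real n)" using n by (simp add: powr_minus_divide powr_half_sqrt)
        finally have q1: "q \<le> 1 / sqrt (real n)" .
        have "(160 * C)\<^sup>2 \<le> real n" using n0(2) True by linarith
        then have "160 * C \<le> sqrt (real n)" by (rule real_le_rsqrt)
        then have "160 * C * q \<le> sqrt (real n) * (1 / sqrt (real n))"
          using q1 q C by (intro mult_mono) auto
        then show "e \<le> 1" using n by (simp add: e_def)
      qed
      have "\<exists>a'. card {i\<in>I. a' i \<noteq> 0} \<le> n \<and> ridge_close I \<omega> b k m a a' (E (card I)) \<and>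
         (\<Sum>i\<in>I. \<bar>a' i\<bar>) \<le> (\<Sum>i\<in>I. \<bar>a i\<bar>) + E (card I)"
      proof (rule sparsify_iterate[where C = C and r = r and n = n and ?N0.0 = N0])
        show "\<exists>a'. sparsifies k m (C * real (card I) powr (- r)) I \<omega> b a a'"
          if "admissible I \<omega> b" "card I \<ge> N0" "(\<Sum>i\<in>I. \<bar>a i\<bar>) \<le> 2" for I :: "'i set" and a
          using step[of I \<omega> b m a] that m unfolding r_def by blast
        show "(\<Sum>i\<in>I. \<bar>a i\<bar>) + E (card I) \<le> 2" using mass E[of "card I"] e by linarith
      qed (use C r n True n0 adm in \<open>auto simp: E_def\<close>)
      then obtain a1 where a1: "card {i\<in>I. a1 i \<noteq> 0} \<le> n" "ridge_close I \<omega> b k m a a1 (E (card I))"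
         "(\<Sum>i\<in>I. \<bar>a1 i\<bar>) \<le> (\<Sum>i\<in>I. \<bar>a i\<bar>) + E (card I)" by blast
      define c where "c = 1 / (1 + e)"
      have c: "c > 0" "c * (1 + e) = 1" using e by (auto simp: c_def)
      have mass1: "(\<Sum>i\<in>I. \<bar>a1 i\<bar>) \<le> 1 + e" using a1(3) mass E[of "card I"] by linarith
      show ?thesis
      proof (intro exI[of _ "\<lambda>i. c * a1 i"] conjI)
        show "card {i\<in>I. c * a1 i \<noteq> 0} \<le> n" using a1(1) c by simp
        have "(\<Sum>i\<in>I. \<bar>c * a1 i\<bar>) = c * (\<Sum>i\<in>I. \<bar>a1 i\<bar>)" using c by (simp add: abs_mult sum_distrib_left)
        also have "\<dots> \<le> c * (1 + e)" using mass1 c by (intro mult_left_mono) auto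
        finally show "(\<Sum>i\<in>I. \<bar>c * a1 i\<bar>) \<le> 1" using c by simp
        show "ridge_close I \<omega> b k m a (\<lambda>i. c * a1 i) (K * real n powr (- ridge_rate ?d k m))"
          unfolding ridge_close_def ridge_sum_scale
        proof (intro allI impI)
          fix w :: "'d list" and x :: "real^'d" assume wx: "length w \<le> m \<and> x \<in> cball 0 1"
          let ?F = "ridge_sum I \<omega> b k a w x" and ?G = "ridge_sum I \<omega> b k a1 w x"
          have FG: "\<bar>?F - ?G\<bar> \<le> e" using a1(2) wx E[of "card I"] unfolding ridge_close_def by force
          have "\<bar>?G\<bar> \<le> 2 ^ k * (\<Sum>i\<in>I. \<bar>a1 i\<bar>)" using wx by (intro abs_ridge_sum_le[OF adm]) auto
          also have "\<dots> \<le> 2 ^ k * (1 + e)" using mass1 by (intro mult_left_mono) auto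
          finally have G: "\<bar>?G\<bar> \<le> 2 ^ k * (1 + e)" .
          have ce: "1 - c = c * e" using c(2) by (simp add: distrib_left)
          have "\<bar>?G - c * ?G\<bar> = (c * e) * \<bar>?G\<bar>"
            using c e by (simp add: ce[symmetric] left_diff_distrib[symmetric, of 1, simplified] abs_mult)
              (metis abs_mult abs_of_nonneg ce left_diff_distrib mult_1 mult_nonneg_nonneg less_imp_le)
          also have "\<dots> \<le> (c * e) * (2 ^ k * (1 + e))" using c e G by (intro mult_left_mono) auto
          also have "\<dots> = 2 ^ k * e * (c * (1 + e))" by (simp only: mult_ac)
          also have "\<dots> = 2 ^ k * e" by (simp only: c(2) mult_1_right)
          finally have "\<bar>?F - c * ?G\<bar> \<le> (1 + 2 ^ k) * e" using FG by (simp add: distrib_right)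
          also have "\<dots> = 160 * C * (1 + 2 ^ k) * q" by (simp add: e_def)
          also have "\<dots> \<le> K * q" using q by (intro mult_right_mono) (auto simp: K_def)
          finally show "\<bar>?F - c * ?G\<bar> \<le> K * real n powr (- ridge_rate ?d k m)" by (simp add: q_def r_def)
        qed
      qed
    qed
  qed
qed

section \<open>Weak derivatives of ridge functions\<close>

lemma iter_pd_append: "iter_pd (v @ w) f = iter_pd v (iter_pd w f)"
  by (induction v) auto

lemma pd_eq_0_outside:
  assumes "closed K" "\<And>x. x \<notin> K \<Longrightarrow> f x = 0" "x \<notin> K"
  shows "pd i f x = 0"
proof -
  have "(f has_derivative (\<lambda>_. 0)) (at x)"
    by (rule has_derivative_transform_within_open[of "\<lambda>_. 0" _ _ _ "- K"]) (use assms in auto)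
  then have "frechet_derivative f (at x) = (\<lambda>_. 0)" by (rule frechet_derivative_at[symmetric])
  then show ?thesis by (simp add: pd_def)
qed

lemma test_fun_pd:
  assumes "test_fun \<phi>"
  shows "test_fun (pd i \<phi>)"
proof -
  obtain K where K: "compact K" "K \<subseteq> ball 0 1" "\<And>x. x \<notin> K \<Longrightarrow> \<phi> x = 0"
    using assms by (auto simp: test_fun_def)
  have "iter_pd is (pd i \<phi>) differentiable at x" for "is" x
    using assms iter_pd_append[of "is" "[i]" \<phi>] unfolding test_fun_def by (metis iter_pd.simps)
  moreover have "pd i \<phi> x = 0" if "x \<notin> K" for x
    using pd_eq_0_outside[OF compact_imp_closed[OF K(1)] K(3) that] .
  ultimately show ?thesis using K unfolding test_fun_def by blast
qed

lemma test_fun_iter_pd: "test_fun \<phi> \<Longrightarrow> test_fun (iter_pd is \<phi>)"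
  by (induction "is") (auto intro: test_fun_pd)

lemma test_fun_differentiable: "test_fun \<phi> \<Longrightarrow> \<phi> differentiable at x"
  unfolding test_fun_def by (metis iter_pd.simps(1))

lemma test_fun_continuous: "test_fun \<phi> \<Longrightarrow> continuous_on UNIV \<phi>"
  using test_fun_differentiable differentiable_imp_continuous_within continuous_at_imp_continuous_on by blast

lemma test_fun_outside: "test_fun \<phi> \<Longrightarrow> x \<notin> ball 0 1 \<Longrightarrow> \<phi> x = 0"
  unfolding test_fun_def by blast

lemma test_fun_bounded:
  assumes "test_fun \<phi>"
  obtains B where "B \<ge> 0" "\<And>x. \<bar>\<phi> x\<bar> \<le> B"
proof -
  have "compact (\<phi> ` cball 0 1)"
    using test_fun_continuous[OF assms] by (intro compact_continuous_image) (auto intro: continuous_on_subset)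
  then have "bounded (\<phi> ` cball 0 1)" by (rule compact_imp_bounded)
  then obtain B where "\<forall>y\<in>\<phi> ` cball 0 1. norm y \<le> B" unfolding bounded_iff by blast
  then have B: "\<bar>\<phi> x\<bar> \<le> B" if "x \<in> cball 0 1" for x using that by auto
  have B0: "B \<ge> 0" using B[of 0] by simp
  have "\<bar>\<phi> x\<bar> \<le> B" for x
  proof (cases "x \<in> ball 0 1")
    case True
    then show ?thesis by (intro B) auto
  next
    case False
    then show ?thesis using test_fun_outside[OF assms False] B0 by simp
  qed
  with B0 show thesis by (rule that)
qed

lemma test_fun_borel: "test_fun \<phi> \<Longrightarrow> \<phi> \<in> borel_measurable borel"
  using test_fun_continuous borel_measurable_continuous_onI by blast

section \<open>Regularity of truncated powers\<close>

lemma sigma_k_borel: "sigma_k r \<in> borel_measurable borel"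
  unfolding sigma_k_def by measurable

lemma ridge_borel: "(\<lambda>x::real^'d::finite. sigma_k r (\<omega> \<bullet> x + b)) \<in> borel_measurable borel"
proof -
  have "(\<lambda>x::real^'d. \<omega> \<bullet> x + b) \<in> borel_measurable borel"
    by (intro borel_measurable_continuous_onI continuous_intros)
  then show ?thesis by (rule measurable_compose[OF _ sigma_k_borel])
qed

lemma abs_sigma_k_le: "\<bar>u\<bar> \<le> B \<Longrightarrow> \<bar>sigma_k r u\<bar> \<le> B ^ r"
  by (auto simp: sigma_k_def power_abs intro: order_trans[OF _ power_mono] power_mono)

text \<open>A truncated power of positive degree is the ordinary power of \<open>max u 0\<close>, so
  the Lipschitz bound for powers passes through the kink.\<close>

lemma sigma_k_lipschitz:
  fixes u v B :: real
  assumes "\<bar>u\<bar> \<le> B" "\<bar>v\<bar> \<le> B" "B \<ge> 1"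
  shows "\<bar>sigma_k (Suc r) u - sigma_k (Suc r) v\<bar> \<le> real (Suc r) * B ^ Suc r * \<bar>u - v\<bar>"
proof -
  have pw: "\<bar>x ^ n - y ^ n\<bar> \<le> n * B ^ n * \<bar>x - y\<bar>" if "\<bar>x\<bar> \<le> B" "\<bar>y\<bar> \<le> B" for x y :: real and n
  proof (induction n)
    case (Suc n)
    have "x ^ Suc n - y ^ Suc n = x * (x ^ n - y ^ n) + (x - y) * y ^ n" by (simp add: algebra_simps)
    then have "\<bar>x ^ Suc n - y ^ Suc n\<bar> \<le> \<bar>x * (x ^ n - y ^ n)\<bar> + \<bar>(x - y) * y ^ n\<bar>"
      by (metis abs_triangle_ineq)
    also have "\<bar>x * (x ^ n - y ^ n)\<bar> \<le> B * (n * B ^ n * \<bar>x - y\<bar>)"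
      unfolding abs_mult using Suc that assms(3) by (intro mult_mono) auto
    also have "\<bar>(x - y) * y ^ n\<bar> \<le> \<bar>x - y\<bar> * B ^ Suc n"
    proof -
      have "\<bar>y ^ n\<bar> \<le> B ^ n" using that(2) by (simp add: power_abs power_mono)
      also have "\<dots> \<le> B ^ Suc n" using assms(3) by (intro power_increasing) auto
      finally show ?thesis unfolding abs_mult by (intro mult_left_mono) auto
    qed
    finally show ?case by (simp add: algebra_simps)
  qed simp
  have eq: "sigma_k (Suc r) u = max u 0 ^ Suc r" for u by (auto simp: sigma_k_def max_def)
  have "\<bar>max u 0 ^ Suc r - max v 0 ^ Suc r\<bar> \<le> real (Suc r) * B ^ Suc r * \<bar>max u 0 - max v 0\<bar>"
    using assms by (intro pw) auto
  also have "\<dots> \<le> real (Suc r) * B ^ Suc r * \<bar>u - v\<bar>"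
    using assms(3) by (intro mult_left_mono) auto
  finally show ?thesis unfolding eq .
qed

lemma sigma_k_deriv:
  assumes "u \<noteq> 0"
  shows "(sigma_k (Suc r) has_real_derivative Suc r * sigma_k r u) (at u)"
proof (cases "u > 0")
  case True
  have "((\<lambda>u. u ^ Suc r) has_real_derivative Suc r * sigma_k r u) (at u)"
    using True DERIV_pow[of "Suc r" u UNIV] by (simp add: sigma_k_def)
  then show ?thesis
    by (rule has_field_derivative_transform_within_open[of _ _ _ "{0<..}"]) (use True in \<open>auto simp: sigma_k_def\<close>)
next
  case False
  have "((\<lambda>u. 0) has_real_derivative Suc r * sigma_k r u) (at u)"
    using False assms by (auto simp: sigma_k_def)
  then show ?thesis
    by (rule has_field_derivative_transform_within_open[of _ _ _ "{..<0}"]) (use False assms in \<open>auto simp: sigma_k_def\<close>)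
qed

lemma pd_line:
  assumes "\<phi> differentiable at (x + s *\<^sub>R axis i 1)"
  shows "((\<lambda>s. \<phi> (x + s *\<^sub>R axis i 1)) has_real_derivative pd i \<phi> (x + s *\<^sub>R axis i 1)) (at s)"
proof -
  let ?D = "frechet_derivative \<phi> (at (x + s *\<^sub>R axis i 1))"
  have D: "(\<phi> has_derivative ?D) (at (x + s *\<^sub>R axis i 1))" using assms frechet_derivative_works by blast
  have "((\<lambda>s. x + s *\<^sub>R axis i 1) has_derivative (\<lambda>h. h *\<^sub>R axis i 1)) (at s)"
    by (auto intro!: derivative_eq_intros)
  from diff_chain_at[OF this D]
  have "((\<lambda>s. \<phi> (x + s *\<^sub>R axis i 1)) has_derivative (\<lambda>h. ?D (h *\<^sub>R axis i 1))) (at s)"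
    by (simp add: o_def)
  also have "(\<lambda>h. ?D (h *\<^sub>R axis i 1)) = (\<lambda>h. h * pd i \<phi> (x + s *\<^sub>R axis i 1))"
    using linear_scale[OF has_derivative_linear[OF D]] by (auto simp: pd_def)
  also have "\<dots> = (*) (pd i \<phi> (x + s *\<^sub>R axis i 1))" by (auto simp: mult.commute)
  finally show ?thesis by (simp only: has_field_derivative_def)
qed

section \<open>Integration by parts across the kink hyperplane\<close>

lemma integrable_bounded_support:
  fixes f :: "real^'d::finite \<Rightarrow> real"
  assumes "f \<in> borel_measurable borel" "\<And>x. x \<notin> ball 0 1 \<Longrightarrow> f x = 0" "\<And>x. x \<in> ball 0 1 \<Longrightarrow> \<bar>f x\<bar> \<le> B"
  shows "integrable lborel f"
  by (rule integrableI_bounded_set[of "ball 0 1" _ _ B])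
     (use assms emeasure_bounded_finite[of "ball (0 :: real^'d) 1"] in auto)

lemma integral_translate:
  fixes F :: "real^'d::finite \<Rightarrow> real"
  assumes [measurable]: "F \<in> borel_measurable borel"
  shows "(LINT x|lborel. F (x + c)) = (LINT x|lborel. F x)"
proof -
  have "(LINT x|lborel. F x) = (LINT x|distr lborel borel ((+) c). F x)"
    by (simp add: lborel_distr_plus)
  also have "\<dots> = (LINT x|lborel. F (c + x))" by (rule integral_distr) auto
  finally show ?thesis by (simp add: add.commute)
qed

lemma abs_affine_le:
  fixes \<omega> :: "real^'d::finite"
  assumes "norm \<omega> = 1" "\<bar>b\<bar> \<le> 1" "norm x \<le> B"
  shows "\<bar>\<omega> \<bullet> x + b\<bar> \<le> B + 1"
proof -
  have "\<bar>\<omega> \<bullet> x\<bar> \<le> norm \<omega> * norm x" by (rule Cauchy_Schwarz_ineq2)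
  then show ?thesis using assms by simp
qed

lemma AE_off_hyperplane:
  fixes \<omega> :: "real^'d::finite"
  assumes "norm \<omega> = 1"
  shows "AE x in lborel. \<omega> \<bullet> x + b \<noteq> 0"
proof -
  have "\<omega> \<noteq> 0" using assms by auto
  then have "negligible {x. \<omega> \<bullet> x = - b}" by (intro negligible_hyperplane) auto
  then have "{x. \<omega> \<bullet> x = - b} \<in> null_sets lebesgue" by (simp add: negligible_iff_null_sets)
  moreover have "{x. \<omega> \<bullet> x = - b} \<in> sets lborel"
    using borel_closed[OF closed_hyperplane[of \<omega> "- b"]] by simp
  ultimately have "{x. \<omega> \<bullet> x = - b} \<in> null_sets lborel" using null_sets_completion_iff by blast
  then show ?thesis by (rule AE_I') (auto simp: eq_neg_iff_add_eq_0)
qed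

text \<open>Translation invariance makes the integral of every difference quotient of a compactly supported
  function vanish; dominated convergence passes to the derivative, the kink hyperplane being a null set.\<close>
lemma ridge_integration_by_parts:
  fixes \<omega> :: "real^'d::finite"
  assumes \<omega>: "norm \<omega> = 1" "\<bar>b\<bar> \<le> 1" and \<psi>: "test_fun \<psi>"
  shows "(LINT x|lborel. sigma_k (Suc r) (\<omega> \<bullet> x + b) * pd i \<psi> x)
     = - (LINT x|lborel. (Suc r * \<omega> $ i * sigma_k r (\<omega> \<bullet> x + b)) * \<psi> x)"
proof -
  define h where "h = (\<lambda>x. sigma_k (Suc r) (\<omega> \<bullet> x + b))"
  define h' where "h' = (\<lambda>x. Suc r * \<omega> $ i * sigma_k r (\<omega> \<bullet> x + b))"
  define F where "F = (\<lambda>x. h x * \<psi> x)"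
  define e where "e = (axis i 1 :: real^'d)"
  define t where "t = (\<lambda>n. 1 / real (Suc n))"
  have t: "0 < t n" "t n \<le> 1" for n by (auto simp: t_def)
  obtain M0 where M0: "M0 \<ge> 0" "\<And>x. \<bar>\<psi> x\<bar> \<le> M0" using test_fun_bounded[OF \<psi>] by blast
  obtain M1 where M1: "M1 \<ge> 0" "\<And>x. \<bar>pd i \<psi> x\<bar> \<le> M1" using test_fun_bounded[OF test_fun_pd[OF \<psi>]] by blast
  have \<psi>_out: "\<psi> x = 0" if "x \<notin> ball 0 1" for x by (rule test_fun_outside[OF \<psi> that])
  have pd_out: "pd i \<psi> x = 0" if "x \<notin> ball 0 1" for x by (rule test_fun_outside[OF test_fun_pd[OF \<psi>] that])
  have [measurable]: "\<psi> \<in> borel_measurable borel" "pd i \<psi> \<in> borel_measurable borel"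
    using \<psi> test_fun_pd test_fun_borel by blast+
  have [measurable]: "h \<in> borel_measurable borel" unfolding h_def by (rule ridge_borel)
  have [measurable]: "h' \<in> borel_measurable borel" unfolding h'_def
    by (intro borel_measurable_times borel_measurable_const ridge_borel)
  have [measurable]: "F \<in> borel_measurable borel" unfolding F_def by measurable
  \<comment> \<open>Radius 3 covers the ball of radius 2, where the difference quotients live, and
    its translates by at most 1.\<close>
  have hb: "\<bar>h x\<bar> \<le> 4 ^ Suc r" if "norm x \<le> 3" for x
    unfolding h_def using abs_affine_le[OF \<omega> that] by (intro abs_sigma_k_le) simp
  have intF: "integrable lborel F"
  proof (rule integrable_bounded_support[of _ "4 ^ Suc r * M0"])
    show "\<bar>F x\<bar> \<le> 4 ^ Suc r * M0" if "x \<in> ball 0 1" for x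
      unfolding F_def abs_mult using that M0 by (intro mult_mono hb) auto
  qed (auto simp: F_def \<psi>_out)
  have int1: "integrable lborel (\<lambda>x. h x * pd i \<psi> x)"
  proof (rule integrable_bounded_support[of _ "4 ^ Suc r * M1"])
    show "\<bar>h x * pd i \<psi> x\<bar> \<le> 4 ^ Suc r * M1" if "x \<in> ball 0 1" for x
      unfolding abs_mult using that M1 by (intro mult_mono hb) auto
  qed (auto simp: pd_out)
  have int2: "integrable lborel (\<lambda>x. h' x * \<psi> x)"
  proof (rule integrable_bounded_support[of _ "(Suc r * \<bar>\<omega> $ i\<bar> * 2 ^ r) * M0"])
    show "\<bar>h' x * \<psi> x\<bar> \<le> (Suc r * \<bar>\<omega> $ i\<bar> * 2 ^ r) * M0" if x: "x \<in> ball 0 1" for x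
    proof -
      have "\<bar>sigma_k r (\<omega> \<bullet> x + b)\<bar> \<le> 2 ^ r"
        using abs_affine_le[OF \<omega>, of x 1] x by (intro abs_sigma_k_le) simp
      then have "\<bar>h' x\<bar> \<le> Suc r * \<bar>\<omega> $ i\<bar> * 2 ^ r"
        unfolding h'_def abs_mult by (simp add: mult_left_mono)
      then show ?thesis unfolding abs_mult using M0 by (intro mult_mono) auto
    qed
  qed (auto simp: \<psi>_out)
  define Dq where "Dq = (\<lambda>n x. (F (x + t n *\<^sub>R e) - F x) / t n)"
  have "(LINT x|lborel. Dq n x) = 0" for n
  proof -
    have "integrable lborel (\<lambda>x. F (x + t n *\<^sub>R e))"
    proof -
      have "integrable (distr lborel borel ((+) (t n *\<^sub>R e))) F" using intF by (simp add: lborel_distr_plus)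
      then have "integrable lborel (\<lambda>x. F (t n *\<^sub>R e + x))" by (subst (asm) integrable_distr_eq) auto
      then show ?thesis by (simp add: add.commute)
    qed
    then show ?thesis unfolding Dq_def using intF integral_translate[of F "t n *\<^sub>R e"] by simp
  qed
  moreover have "(\<lambda>n. LINT x|lborel. Dq n x) \<longlonglongrightarrow> (LINT x|lborel. h' x * \<psi> x + h x * pd i \<psi> x)"
  proof (rule integral_dominated_convergence)
    \<comment> \<open>Product rule for difference quotients, uniformly in n: supremum of
      \<open>h\<close> times the Lipschitz bound of \<psi>, plus supremum of \<psi> times the
      Lipschitz bound of \<open>h\<close>.\<close>
    define Lc where "Lc = 4 ^ Suc r * M1 + M0 * (real (Suc r) * 4 ^ Suc r)"
    have Lc: "Lc \<ge> 0" using M0 M1 by (simp add: Lc_def)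
    show "integrable lborel (\<lambda>x. Lc * indicator (ball (0 :: real^'d) 2) x)"
      using emeasure_bounded_finite[of "ball (0 :: real^'d) 2"] by (intro integrable_mult_right) auto
    show "AE x in lborel. norm (Dq n x) \<le> Lc * indicator (ball 0 2) x" for n
    proof (rule AE_I2)
      fix x :: "real^'d"
      define y where "y = x + t n *\<^sub>R e"
      have "norm (y - x) = t n" using t[of n] by (simp add: y_def e_def)
      then have yx: "norm (y - x) \<le> 1" "norm y \<le> norm x + 1" "norm x \<le> norm y + 1"
        using t[of n] norm_triangle_ineq[of x "y - x"] norm_triangle_ineq[of y "x - y"] norm_minus_commute[of x y] by auto
      show "norm (Dq n x) \<le> Lc * indicator (ball 0 2) x"
      proof (cases "x \<in> ball 0 2")
        case False
        then have "x \<notin> ball 0 1" "y \<notin> ball 0 1" using yx by auto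
        then show ?thesis using False by (simp add: Dq_def F_def \<psi>_out y_def[symmetric])
      next
        case True
        then have nx: "norm x \<le> 3" "norm y \<le> 3" using yx by auto
        obtain z where z: "\<psi> (x + t n *\<^sub>R axis i 1) - \<psi> (x + 0 *\<^sub>R axis i 1) = (t n - 0) * pd i \<psi> (x + z *\<^sub>R axis i 1)"
          using MVT2[of 0 "t n" "\<lambda>s. \<psi> (x + s *\<^sub>R axis i 1)" "\<lambda>s. pd i \<psi> (x + s *\<^sub>R axis i 1)"]
            t[of n] pd_line[OF test_fun_differentiable[OF \<psi>]] by blast
        then have 1: "\<bar>\<psi> y - \<psi> x\<bar> \<le> t n * M1"
          using t[of n] M1(2)[of "x + z *\<^sub>R axis i 1"] by (simp add: y_def e_def abs_mult)
        have "\<bar>h y - h x\<bar> \<le> real (Suc r) * 4 ^ Suc r * \<bar>(\<omega> \<bullet> y + b) - (\<omega> \<bullet> x + b)\<bar>"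
          unfolding h_def using abs_affine_le[OF \<omega> nx(1)] abs_affine_le[OF \<omega> nx(2)]
          by (intro sigma_k_lipschitz) auto
        also have "(\<omega> \<bullet> y + b) - (\<omega> \<bullet> x + b) = t n * \<omega> $ i"
          by (simp add: y_def e_def inner_add_right inner_axis)
        also have "real (Suc r) * 4 ^ Suc r * \<bar>t n * \<omega> $ i\<bar> \<le> real (Suc r) * 4 ^ Suc r * t n"
        proof -
          have "\<bar>\<omega> $ i\<bar> \<le> 1" using component_le_norm_cart[of \<omega> i] \<omega> by simp
          then have "t n * \<bar>\<omega> $ i\<bar> \<le> t n * 1" using t[of n] by (intro mult_left_mono) auto
          then show ?thesis using t[of n] by (intro mult_left_mono) (auto simp: abs_mult)
        qed
        finally have 2: "\<bar>h y - h x\<bar> \<le> real (Suc r) * 4 ^ Suc r * t n" .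
        have "F y - F x = h y * (\<psi> y - \<psi> x) + \<psi> x * (h y - h x)" by (simp add: F_def algebra_simps)
        then have "\<bar>F y - F x\<bar> \<le> \<bar>h y\<bar> * \<bar>\<psi> y - \<psi> x\<bar> + \<bar>\<psi> x\<bar> * \<bar>h y - h x\<bar>"
          by (metis abs_mult abs_triangle_ineq)
        also have "\<dots> \<le> 4 ^ Suc r * (t n * M1) + M0 * (real (Suc r) * 4 ^ Suc r * t n)"
          using 1 2 hb[OF nx(2)] M0 by (intro add_mono mult_mono) auto
        also have "\<dots> = Lc * t n" by (simp only: Lc_def distrib_left distrib_right mult_ac)
        finally have "\<bar>F y - F x\<bar> / t n \<le> Lc" using t[of n] by (simp add: divide_le_eq)
        then show ?thesis using True t[of n] by (simp add: Dq_def y_def)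
      qed
    qed
    show "AE x in lborel. (\<lambda>n. Dq n x) \<longlonglongrightarrow> h' x * \<psi> x + h x * pd i \<psi> x"
      using AE_off_hyperplane[OF \<omega>(1), of b]
    proof eventually_elim
      fix x assume x: "\<omega> \<bullet> x + b \<noteq> 0"
      let ?l = "\<lambda>s. \<omega> \<bullet> (x + s *\<^sub>R axis i 1) + b"
      have l: "?l = (\<lambda>s. (\<omega> \<bullet> x + b) + s * \<omega> $ i)" by (auto simp: inner_add_right inner_axis)
      have "(?l has_real_derivative \<omega> $ i) (at 0)" unfolding l by (auto intro!: derivative_eq_intros)
      then have l': "(?l has_real_derivative \<omega> $ i) (at 0 within UNIV)" by simp
      have "(sigma_k (Suc r) has_real_derivative Suc r * sigma_k r (\<omega> \<bullet> x + b)) (at (?l 0))"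
        using sigma_k_deriv[OF x] by simp
      from DERIV_chain2[OF this l'] have "((\<lambda>s. h (x + s *\<^sub>R axis i 1)) has_real_derivative Suc r * sigma_k r (\<omega> \<bullet> x + b) * \<omega> $ i) (at 0)"
        unfolding h_def .
      then have "((\<lambda>s. F (x + s *\<^sub>R axis i 1)) has_real_derivative
          Suc r * sigma_k r (\<omega> \<bullet> x + b) * \<omega> $ i * \<psi> (x + 0 *\<^sub>R axis i 1) + pd i \<psi> (x + 0 *\<^sub>R axis i 1) * h (x + 0 *\<^sub>R axis i 1)) (at 0)"
        unfolding F_def by (intro DERIV_mult pd_line test_fun_differentiable \<psi>)
      then have "((\<lambda>s. F (x + s *\<^sub>R e)) has_real_derivative h' x * \<psi> x + h x * pd i \<psi> x) (at 0)"
        by (simp add: h'_def e_def mult_ac)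
      then have "(\<lambda>s. (F (x + s *\<^sub>R e) - F x) / s) \<midarrow>0\<rightarrow> h' x * \<psi> x + h x * pd i \<psi> x"
        unfolding DERIV_def by simp
      moreover have "t \<longlonglongrightarrow> 0" unfolding t_def using LIMSEQ_inverse_real_of_nat by (simp add: inverse_eq_divide)
      then have "filterlim t (at 0) sequentially"
        using t by (auto simp: filterlim_at intro!: always_eventually) (metis less_irrefl)
      ultimately show "(\<lambda>n. Dq n x) \<longlonglongrightarrow> h' x * \<psi> x + h x * pd i \<psi> x"
        unfolding Dq_def by (rule filterlim_compose)
    qed
    show "(\<lambda>x. h' x * \<psi> x + h x * pd i \<psi> x) \<in> borel_measurable lborel" by measurable
    show "Dq n \<in> borel_measurable lborel" for n unfolding Dq_def by measurable
  qed
  ultimately have "(LINT x|lborel. h' x * \<psi> x + h x * pd i \<psi> x) = 0"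
    by (simp add: LIMSEQ_const_iff)
  then have "(LINT x|lborel. h' x * \<psi> x) + (LINT x|lborel. h x * pd i \<psi> x) = 0"
    using int1 int2 by simp
  then show ?thesis by (simp add: h_def h'_def)
qed

text \<open>The outermost derivative is moved first, and the rest stays in the test function.
  \<open>length w \<le> k\<close> guarantees positive degree before each move, so the process may
  end at the discontinuous degree 0 but never differentiates it.\<close>

lemma ridge_iterated_parts:
  fixes \<omega> :: "real^'d::finite"
  assumes \<omega>: "norm \<omega> = 1" "\<bar>b\<bar> \<le> 1" and \<phi>: "test_fun \<phi>" and w: "length w \<le> k"
  shows "(LINT x|lborel. sigma_k k (\<omega> \<bullet> x + b) * iter_pd w \<phi> x)
     = (-1) ^ length w * (LINT x|lborel. (fact k / fact (k - length w) * wmono w \<omega> * sigma_k (k - length w) (\<omega> \<bullet> x + b)) * \<phi> x)"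
  using w
proof (induction w arbitrary: k)
  case (Cons i w)
  then obtain r where r: "k = Suc r" by (cases k) auto
  have "(LINT x|lborel. sigma_k k (\<omega> \<bullet> x + b) * iter_pd (i # w) \<phi> x)
    = - (LINT x|lborel. (Suc r * \<omega> $ i * sigma_k r (\<omega> \<bullet> x + b)) * iter_pd w \<phi> x)"
    unfolding r iter_pd.simps by (rule ridge_integration_by_parts[OF \<omega> test_fun_iter_pd[OF \<phi>]])
  also have "\<dots> = - (Suc r * \<omega> $ i) * (LINT x|lborel. sigma_k r (\<omega> \<bullet> x + b) * iter_pd w \<phi> x)"
    by (simp add: mult.assoc del: of_nat_Suc)
  also have "(LINT x|lborel. sigma_k r (\<omega> \<bullet> x + b) * iter_pd w \<phi> x) =
      (-1) ^ length w * (LINT x|lborel. (fact r / fact (r - length w) * wmono w \<omega> * sigma_k (r - length w) (\<omega> \<bullet> x + b)) * \<phi> x)"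
    using Cons.prems r by (intro Cons.IH) simp
  also have "- (Suc r * \<omega> $ i) * ((-1) ^ length w * (LINT x|lborel. (fact r / fact (r - length w) * wmono w \<omega> * sigma_k (r - length w) (\<omega> \<bullet> x + b)) * \<phi> x))
    = (-1) ^ length (i # w) * ((Suc r * \<omega> $ i) * (LINT x|lborel. (fact r / fact (r - length w) * wmono w \<omega> * sigma_k (r - length w) (\<omega> \<bullet> x + b)) * \<phi> x))"
    by simp
  also have "(Suc r * \<omega> $ i) * (LINT x|lborel. (fact r / fact (r - length w) * wmono w \<omega> * sigma_k (r - length w) (\<omega> \<bullet> x + b)) * \<phi> x)
    = (LINT x|lborel. (Suc r * \<omega> $ i) * ((fact r / fact (r - length w) * wmono w \<omega> * sigma_k (r - length w) (\<omega> \<bullet> x + b)) * \<phi> x))"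
    by (rule integral_mult_right_zero[symmetric])
  also have "\<dots> = (LINT x|lborel. (fact k / fact (k - length (i # w)) * wmono (i # w) \<omega> * sigma_k (k - length (i # w)) (\<omega> \<bullet> x + b)) * \<phi> x)"
    by (rule Bochner_Integration.integral_cong) (auto simp: r field_simps)
  finally show ?case .
qed simp

section \<open>Approximation in Sobolev norm\<close>

text \<open>A quantitative form of \<open>W_norm m q \<le> \<delta>\<close> that is stable under sums and multiples.\<close>
definition wbound :: "nat \<Rightarrow> (real^'d::finite \<Rightarrow> real) \<Rightarrow> real \<Rightarrow> bool" where
  "wbound m q \<delta> \<longleftrightarrow> (\<forall>w. length w \<le> m \<longrightarrow> (\<exists>G. weak_deriv w q G \<and>
     G \<in> borel_measurable (lebesgue_on (cball 0 1)) \<and> (AE x in lebesgue_on (cball 0 1). \<bar>G x\<bar> \<le> \<delta>)))"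

lemma W_norm_le_wbound:
  fixes q :: "real^'d::finite \<Rightarrow> real"
  assumes "wbound m q \<delta>"
  shows "W_norm m q \<le> ereal \<delta>"
  unfolding W_norm_def
proof (rule SUP_least)
  fix w :: "'d list" assume "w \<in> {w. length w \<le> m}"
  then obtain G where G: "weak_deriv w q G" "G \<in> borel_measurable (lebesgue_on (cball 0 1))"
    "AE x in lebesgue_on (cball 0 1). \<bar>G x\<bar> \<le> \<delta>" using assms unfolding wbound_def by blast
  have "Linf_norm G \<le> ereal \<delta>"
    unfolding Linf_norm_def
  proof (rule esssup_I)
    show "(\<lambda>x. ereal \<bar>G x\<bar>) \<in> borel_measurable (lebesgue_on (cball 0 1))"
      using G(2) by (intro borel_measurable_ereal borel_measurable_abs)
    show "AE x in lebesgue_on (cball 0 1). ereal \<bar>G x\<bar> \<le> ereal \<delta>" using G(3) by simp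
  qed
  then show "(INF g\<in>{g. weak_deriv w q g}. Linf_norm g) \<le> ereal \<delta>"
    using G(1) by (intro INF_lower2[of G]) auto
qed

text \<open>An infimum below \<delta> is undercut by some weak derivative with essential supremum
  below \<delta>. Weak derivatives are integrable over the open ball while the norm is taken on the
  closed one; the sphere between them is a null set, which transfers measurability.\<close>

lemma wbound_of_W_norm:
  fixes q :: "real^'d::finite \<Rightarrow> real"
  assumes "W_norm k q < ereal \<delta>" "m \<le> k"
  shows "wbound m q \<delta>"
  unfolding wbound_def
proof (intro allI impI)
  fix w :: "'d list" assume "length w \<le> m"
  then have "(INF g\<in>{g. weak_deriv w q g}. Linf_norm g) \<le> W_norm k q"
    unfolding W_norm_def using assms(2) by (intro SUP_upper) auto
  then have "(INF g\<in>{g. weak_deriv w q g}. Linf_norm g) < ereal \<delta>" using assms(1) by (rule le_less_trans)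
  then obtain G where G: "weak_deriv w q G" "Linf_norm G < ereal \<delta>" unfolding INF_less_iff by blast
  have meas: "(\<lambda>x. ereal \<bar>G x\<bar>) \<in> borel_measurable (lebesgue_on (cball 0 1))"
  proof (rule ccontr)
    assume "\<not> ?thesis"
    then have "Linf_norm G = top" unfolding Linf_norm_def by (rule esssup_non_measurable)
    then show False using G(2) by simp
  qed
  have ae: "AE x in lebesgue_on (cball 0 1). ereal \<bar>G x\<bar> \<le> Linf_norm G"
    unfolding Linf_norm_def by (rule esssup_AE)
  have "AE x in lebesgue_on (cball 0 1). \<bar>G x\<bar> \<le> \<delta>"
    using ae
  proof eventually_elim
    fix x assume "ereal \<bar>G x\<bar> \<le> Linf_norm G"
    then have "ereal \<bar>G x\<bar> < ereal \<delta>" using G(2) by (rule le_less_trans)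
    then show "\<bar>G x\<bar> \<le> \<delta>" by simp
  qed
  moreover have "G \<in> borel_measurable (lebesgue_on (cball 0 1))"
  proof -
    have "set_integrable lebesgue (ball 0 1) G" using G(1) by (simp add: weak_deriv_def)
    then have i: "(\<lambda>x. indicator (ball 0 1) x *\<^sub>R G x) \<in> borel_measurable lebesgue"
      unfolding set_integrable_def by (rule borel_measurable_integrable)
    have "negligible (sphere (0 :: real^'d) 1)" by (rule negligible_sphere)
    then have "sphere (0 :: real^'d) 1 \<in> null_sets lebesgue" by (simp add: negligible_iff_null_sets)
    then have "AE x in lebesgue. x \<notin> sphere (0 :: real^'d) 1" by (rule AE_not_in)
    then have "AE x in lebesgue. indicator (ball 0 1) x *\<^sub>R G x = indicator (cball 0 1) x *\<^sub>R G x"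
    proof eventually_elim
      fix x :: "real^'d" assume "x \<notin> sphere 0 1"
      then have "x \<in> cball 0 1 \<longleftrightarrow> x \<in> ball 0 1" by auto
      then show "indicator (ball 0 1) x *\<^sub>R G x = indicator (cball 0 1) x *\<^sub>R G x"
        unfolding indicator_def by simp
    qed
    then have "(\<lambda>x. indicator (cball 0 1) x *\<^sub>R G x) \<in> borel_measurable lebesgue"
      by (rule borel_measurable_AE[OF i])
    then show ?thesis by (subst borel_measurable_restrict_space_iff) (auto simp: mult.commute)
  qed
  ultimately show "\<exists>G. weak_deriv w q G \<and> G \<in> borel_measurable (lebesgue_on (cball 0 1)) \<and>
     (AE x in lebesgue_on (cball 0 1). \<bar>G x\<bar> \<le> \<delta>)" using G(1) by blast
qed

lemma set_integrable_mult_test_fun: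
  fixes f \<phi> :: "real^'d::finite \<Rightarrow> real"
  assumes "set_integrable lebesgue (ball 0 1) f" "test_fun \<phi>"
  shows "set_integrable lebesgue (ball 0 1) (\<lambda>x. f x * \<phi> x)"
proof -
  obtain B where B: "B \<ge> 0" "\<And>x. \<bar>\<phi> x\<bar> \<le> B" using test_fun_bounded[OF assms(2)] by blast
  have i: "integrable lebesgue (\<lambda>x. indicator (ball 0 1) x *\<^sub>R f x)" using assms(1) by (simp add: set_integrable_def)
  have m: "\<phi> \<in> borel_measurable lebesgue"
    using test_fun_borel[OF assms(2)] by (intro measurable_completion) simp
  have "integrable lebesgue (\<lambda>x. (indicator (ball 0 1) x *\<^sub>R f x) * \<phi> x)"
  proof (rule Bochner_Integration.integrable_bound)
    show "integrable lebesgue (\<lambda>x. B * (indicator (ball 0 1) x *\<^sub>R f x))" using i by (rule integrable_mult_right)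
    show "(\<lambda>x. (indicator (ball 0 1) x *\<^sub>R f x) * \<phi> x) \<in> borel_measurable lebesgue"
      using borel_measurable_integrable[OF i] m by (rule borel_measurable_times)
    show "AE x in lebesgue. norm ((indicator (ball 0 1) x *\<^sub>R f x) * \<phi> x) \<le> norm (B * (indicator (ball 0 1) x *\<^sub>R f x))"
    proof (rule AE_I2)
      fix x
      have "\<bar>indicator (ball 0 1) x * f x\<bar> * \<bar>\<phi> x\<bar> \<le> \<bar>indicator (ball 0 1) x * f x\<bar> * B"
        using B by (intro mult_left_mono) auto
      then show "norm ((indicator (ball 0 1) x *\<^sub>R f x) * \<phi> x) \<le> norm (B * (indicator (ball 0 1) x *\<^sub>R f x))"
        using B(1) by (simp add: abs_mult mult_ac)
    qed
  qed
  then show ?thesis by (simp add: set_integrable_def mult.assoc)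
qed

lemma weak_deriv_lincomb:
  fixes f g :: "real^'d::finite \<Rightarrow> real"
  assumes f: "weak_deriv w f F" and g: "weak_deriv w g G"
  shows "weak_deriv w (\<lambda>x. c * f x + e * g x) (\<lambda>x. c * F x + e * G x)"
  unfolding weak_deriv_def
proof (intro conjI allI impI)
  have i: "set_integrable lebesgue (ball 0 1) f" "set_integrable lebesgue (ball 0 1) F"
    "set_integrable lebesgue (ball 0 1) g" "set_integrable lebesgue (ball 0 1) G"
    using f g by (auto simp: weak_deriv_def)
  then show "set_integrable lebesgue (ball 0 1) (\<lambda>x. c * f x + e * g x)"
    "set_integrable lebesgue (ball 0 1) (\<lambda>x. c * F x + e * G x)"
    by (auto intro!: set_integral_add(1) set_integrable_mult_right)
  fix \<phi> :: "real^'d \<Rightarrow> real" assume \<phi>: "test_fun \<phi>"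
  have lin: "(LINT x : ball 0 1 | lebesgue. (c * f x + e * g x) * \<psi> x)
     = c * (LINT x : ball 0 1 | lebesgue. f x * \<psi> x) + e * (LINT x : ball 0 1 | lebesgue. g x * \<psi> x)"
    if "set_integrable lebesgue (ball 0 1) f" "set_integrable lebesgue (ball 0 1) g" "test_fun \<psi>"
    for f g \<psi> :: "real^'d \<Rightarrow> real"
  proof -
    have "(LINT x : ball 0 1 | lebesgue. (c * f x + e * g x) * \<psi> x)
      = (LINT x : ball 0 1 | lebesgue. c * (f x * \<psi> x) + e * (g x * \<psi> x))"
      by (simp add: distrib_right mult.assoc)
    also have "\<dots> = (LINT x : ball 0 1 | lebesgue. c * (f x * \<psi> x)) + (LINT x : ball 0 1 | lebesgue. e * (g x * \<psi> x))"
      using that by (intro set_integral_add(2) set_integrable_mult_right set_integrable_mult_test_fun)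
    finally show ?thesis by simp
  qed
  have "(LINT x : ball 0 1 | lebesgue. f x * iter_pd w \<phi> x) = (-1) ^ length w * (LINT x : ball 0 1 | lebesgue. F x * \<phi> x)"
    "(LINT x : ball 0 1 | lebesgue. g x * iter_pd w \<phi> x) = (-1) ^ length w * (LINT x : ball 0 1 | lebesgue. G x * \<phi> x)"
    using f g \<phi> by (auto simp: weak_deriv_def)
  then show "(LINT x : ball 0 1 | lebesgue. (c * f x + e * g x) * iter_pd w \<phi> x)
     = (-1) ^ length w * (LINT x : ball 0 1 | lebesgue. (c * F x + e * G x) * \<phi> x)"
    unfolding lin[OF i(1,3) test_fun_iter_pd[OF \<phi>]] lin[OF i(2,4) \<phi>] by (simp add: algebra_simps)
qed

lemma wbound_add:
  fixes p q :: "real^'d::finite \<Rightarrow> real"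
  assumes "wbound m p \<delta>" "wbound m q \<epsilon>"
  shows "wbound m (\<lambda>x. p x + q x) (\<delta> + \<epsilon>)"
  unfolding wbound_def
proof (intro allI impI)
  fix w :: "'d list" assume w: "length w \<le> m"
  obtain F where F: "weak_deriv w p F" "F \<in> borel_measurable (lebesgue_on (cball 0 1))"
    "AE x in lebesgue_on (cball 0 1). \<bar>F x\<bar> \<le> \<delta>" using assms(1) w unfolding wbound_def by blast
  obtain G where G: "weak_deriv w q G" "G \<in> borel_measurable (lebesgue_on (cball 0 1))"
    "AE x in lebesgue_on (cball 0 1). \<bar>G x\<bar> \<le> \<epsilon>" using assms(2) w unfolding wbound_def by blast
  have "weak_deriv w (\<lambda>x. p x + q x) (\<lambda>x. F x + G x)"
    using weak_deriv_lincomb[OF F(1) G(1), of 1 1] by simp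
  moreover have "(\<lambda>x. F x + G x) \<in> borel_measurable (lebesgue_on (cball 0 1))"
    using F(2) G(2) by (rule borel_measurable_add)
  moreover have "AE x in lebesgue_on (cball 0 1). \<bar>F x + G x\<bar> \<le> \<delta> + \<epsilon>"
    using F(3) G(3) by eventually_elim linarith
  ultimately show "\<exists>G. weak_deriv w (\<lambda>x. p x + q x) G \<and> G \<in> borel_measurable (lebesgue_on (cball 0 1)) \<and>
     (AE x in lebesgue_on (cball 0 1). \<bar>G x\<bar> \<le> \<delta> + \<epsilon>)" by blast
qed

lemma wbound_scale:
  fixes p :: "real^'d::finite \<Rightarrow> real"
  assumes "wbound m p \<delta>" "c \<ge> 0"
  shows "wbound m (\<lambda>x. c * p x) (c * \<delta>)"
  unfolding wbound_def
proof (intro allI impI)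
  fix w :: "'d list" assume w: "length w \<le> m"
  obtain F where F: "weak_deriv w p F" "F \<in> borel_measurable (lebesgue_on (cball 0 1))"
    "AE x in lebesgue_on (cball 0 1). \<bar>F x\<bar> \<le> \<delta>" using assms(1) w unfolding wbound_def by blast
  have "weak_deriv w (\<lambda>x. c * p x) (\<lambda>x. c * F x)"
    using weak_deriv_lincomb[OF F(1) F(1), of c 0] by simp
  moreover have "(\<lambda>x. c * F x) \<in> borel_measurable (lebesgue_on (cball 0 1))"
    using F(2) by (intro borel_measurable_times borel_measurable_const)
  moreover have "AE x in lebesgue_on (cball 0 1). \<bar>c * F x\<bar> \<le> c * \<delta>"
    using F(3) by eventually_elim (use assms(2) in \<open>simp add: abs_mult mult_left_mono\<close>)
  ultimately show "\<exists>G. weak_deriv w (\<lambda>x. c * p x) G \<and> G \<in> borel_measurable (lebesgue_on (cball 0 1)) \<and>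
     (AE x in lebesgue_on (cball 0 1). \<bar>G x\<bar> \<le> c * \<delta>)" by blast
qed

lemma weak_deriv_ridge:
  fixes \<omega> :: "real^'d::finite"
  assumes \<omega>: "norm \<omega> = 1" "\<bar>b\<bar> \<le> 1" and w: "length w \<le> k"
  shows "weak_deriv w (\<lambda>x. sigma_k k (\<omega> \<bullet> x + b))
     (\<lambda>x. fact k / fact (k - length w) * wmono w \<omega> * sigma_k (k - length w) (\<omega> \<bullet> x + b))"
proof -
  have si: "set_integrable lebesgue (ball 0 1) (\<lambda>x. c * sigma_k r (\<omega> \<bullet> x + b))" for c r
    unfolding set_integrable_def
  proof (rule integrableI_bounded_set_indicator[where B = "\<bar>c\<bar> * 2 ^ r"])
    have "(\<lambda>x. c * sigma_k r (\<omega> \<bullet> x + b)) \<in> borel_measurable borel"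
      by (intro borel_measurable_times borel_measurable_const ridge_borel)
    then show "(\<lambda>x. c * sigma_k r (\<omega> \<bullet> x + b)) \<in> borel_measurable lebesgue"
      by (intro measurable_completion) simp
    show "emeasure lebesgue (ball (0 :: real^'d) 1) < \<infinity>"
      using emeasure_bounded_finite[of "ball (0 :: real^'d) 1"] by simp
    show "AE x in lebesgue. x \<in> ball 0 1 \<longrightarrow> norm (c * sigma_k r (\<omega> \<bullet> x + b)) \<le> \<bar>c\<bar> * 2 ^ r"
    proof (rule AE_I2, rule impI)
      fix x :: "real^'d" assume x: "x \<in> ball 0 1"
      have "\<bar>sigma_k r (\<omega> \<bullet> x + b)\<bar> \<le> 2 ^ r"
        using abs_affine_le[OF \<omega>, of x 1] x by (intro abs_sigma_k_le) simp
      then show "norm (c * sigma_k r (\<omega> \<bullet> x + b)) \<le> \<bar>c\<bar> * 2 ^ r"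
        by (simp add: abs_mult mult_left_mono)
    qed
  qed simp
  \<comment> \<open>Test functions vanish off the open ball, so the set integral agrees with the
    integral over the whole space, for which integration by parts was proved.\<close>
  have to_lborel: "(LINT x : ball 0 1 | lebesgue. (c * sigma_k r (\<omega> \<bullet> x + b)) * \<psi> x)
     = (LINT x|lborel. (c * sigma_k r (\<omega> \<bullet> x + b)) * \<psi> x)" if \<psi>: "test_fun \<psi>" for c r \<psi>
  proof -
    have eq: "(\<lambda>x. indicator (ball 0 1) x *\<^sub>R (c * sigma_k r (\<omega> \<bullet> x + b) * \<psi> x)) = (\<lambda>x. c * sigma_k r (\<omega> \<bullet> x + b) * \<psi> x)"
    proof
      fix x
      show "indicator (ball 0 1) x *\<^sub>R (c * sigma_k r (\<omega> \<bullet> x + b) * \<psi> x) = c * sigma_k r (\<omega> \<bullet> x + b) * \<psi> x"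
        using test_fun_outside[OF \<psi>, of x] by (cases "x \<in> ball 0 1") simp_all
    qed
    have "(\<lambda>x. c * sigma_k r (\<omega> \<bullet> x + b) * \<psi> x) \<in> borel_measurable borel"
      by (intro borel_measurable_times borel_measurable_const ridge_borel test_fun_borel[OF \<psi>])
    then show ?thesis unfolding set_lebesgue_integral_def eq by (intro integral_completion) simp
  qed
  show ?thesis
    unfolding weak_deriv_def
  proof (intro conjI allI impI)
    show "set_integrable lebesgue (ball 0 1) (\<lambda>x. sigma_k k (\<omega> \<bullet> x + b))" using si[of 1 k] by simp
    show "set_integrable lebesgue (ball 0 1) (\<lambda>x. fact k / fact (k - length w) * wmono w \<omega> * sigma_k (k - length w) (\<omega> \<bullet> x + b))"
      by (rule si)
    fix \<phi> :: "real^'d \<Rightarrow> real" assume \<phi>: "test_fun \<phi>"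
    show "(LINT x : ball 0 1 | lebesgue. sigma_k k (\<omega> \<bullet> x + b) * iter_pd w \<phi> x) =
      (-1) ^ length w * (LINT x : ball 0 1 | lebesgue. fact k / fact (k - length w) * wmono w \<omega> * sigma_k (k - length w) (\<omega> \<bullet> x + b) * \<phi> x)"
      using to_lborel[OF test_fun_iter_pd[OF \<phi>], of 1 k w] to_lborel[OF \<phi>, of "fact k / fact (k - length w) * wmono w \<omega>" "k - length w"]
        ridge_iterated_parts[OF \<omega> \<phi> w] by simp
  qed
qed

lemma weak_deriv_zero: "weak_deriv w (\<lambda>x. 0) (\<lambda>x. 0)"
  by (simp add: weak_deriv_def set_integrable_def set_lebesgue_integral_def)

lemma weak_deriv_sum:
  assumes "finite I" "\<And>i. i \<in> I \<Longrightarrow> weak_deriv w (f i) (F i)"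
  shows "weak_deriv w (\<lambda>x. \<Sum>i\<in>I. a i * f i x) (\<lambda>x. \<Sum>i\<in>I. a i * F i x)"
  using assms
proof (induction I rule: finite_induct)
  case (insert i I)
  then have "weak_deriv w (\<lambda>x. a i * f i x + 1 * (\<Sum>i\<in>I. a i * f i x)) (\<lambda>x. a i * F i x + 1 * (\<Sum>i\<in>I. a i * F i x))"
    by (intro weak_deriv_lincomb) auto
  then show ?case using insert.hyps by simp
qed (simp add: weak_deriv_zero)

text \<open>The omitted factor k! / (k - |w|)! returns here and is at most k!. The explicit weak
  derivative obeys its bound at every point of the closed ball, hence almost everywhere.\<close>

lemma wbound_ridge_sum:
  fixes \<omega> :: "'i \<Rightarrow> real^'d::finite"
  assumes adm: "admissible I \<omega> b" and m: "m \<le> k"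
    and bd: "\<And>w x. length w \<le> m \<Longrightarrow> x \<in> cball 0 1 \<Longrightarrow> \<bar>ridge_sum I \<omega> b k a w x\<bar> \<le> \<delta>"
  shows "wbound m (\<lambda>x. \<Sum>i\<in>I. a i * sigma_k k (\<omega> i \<bullet> x + b i)) (fact k * \<delta>)"
  unfolding wbound_def
proof (intro allI impI)
  fix w :: "'d list" assume w: "length w \<le> m"
  have fin: "finite I" using adm by (simp add: admissible_def)
  let ?c = "fact k / fact (k - length w) :: real"
  define G where "G = (\<lambda>x. ?c * ridge_sum I \<omega> b k a w x)"
  have "weak_deriv w (\<lambda>x. \<Sum>i\<in>I. a i * sigma_k k (\<omega> i \<bullet> x + b i))
     (\<lambda>x. \<Sum>i\<in>I. a i * (?c * wmono w (\<omega> i) * sigma_k (k - length w) (\<omega> i \<bullet> x + b i)))"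
    using adm w m by (intro weak_deriv_sum fin weak_deriv_ridge) (auto simp: admissible_def)
  also have "(\<lambda>x. \<Sum>i\<in>I. a i * (?c * wmono w (\<omega> i) * sigma_k (k - length w) (\<omega> i \<bullet> x + b i))) = G"
    unfolding G_def ridge_sum_def sum_distrib_left by (intro ext sum.cong refl) (simp only: mult_ac)
  finally have 1: "weak_deriv w (\<lambda>x. \<Sum>i\<in>I. a i * sigma_k k (\<omega> i \<bullet> x + b i)) G" .
  have "G \<in> borel_measurable borel"
    unfolding G_def ridge_sum_def
    by (intro borel_measurable_times borel_measurable_const borel_measurable_sum ridge_borel)
  then have "G \<in> borel_measurable lebesgue" by (intro measurable_completion) simp
  then have 2: "G \<in> borel_measurable (lebesgue_on (cball 0 1))" by (rule measurable_restrict_space1)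
  have "\<bar>G x\<bar> \<le> fact k * \<delta>" if x: "x \<in> cball 0 1" for x
  proof -
    have "?c \<le> fact k" by (simp add: divide_le_eq)
    then show ?thesis unfolding G_def abs_mult using bd[OF w x] by (intro mult_mono) auto
  qed
  then have 3: "AE x in lebesgue_on (cball 0 1). \<bar>G x\<bar> \<le> fact k * \<delta>" by (intro AE_I2) auto
  from 1 2 3 show "\<exists>G. weak_deriv w (\<lambda>x. \<Sum>i\<in>I. a i * sigma_k k (\<omega> i \<bullet> x + b i)) G \<and>
     G \<in> borel_measurable (lebesgue_on (cball 0 1)) \<and> (AE x in lebesgue_on (cball 0 1). \<bar>G x\<bar> \<le> fact k * \<delta>)" by blast
qed

section \<open>Sparse sums as members of the dictionary classes\<close>

lemma dict_P_nonempty: "\<exists>h. h \<in> (dict_P k :: (real^'d::finite \<Rightarrow> real) set)"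
proof -
  have "norm (axis undefined 1 :: real^'d) = 1" by simp
  then have "(\<lambda>x. sigma_k k ((axis undefined 1 :: real^'d) \<bullet> x + 0)) \<in> dict_P k"
    unfolding dict_P_def by fastforce
  then show ?thesis by blast
qed

text \<open>\<open>Sigma_nM\<close> asks for n dictionary elements, so the nonzero terms are
  renumbered and the remaining places filled with a fixed element and coefficient 0.\<close>

lemma sparse_sum_in_Sigma_nM:
  fixes h :: "nat \<Rightarrow> real^'d::finite \<Rightarrow> real"
  assumes h: "\<And>i. i < N \<Longrightarrow> h i \<in> dict_P k" and card: "card {i\<in>{..<N}. a i \<noteq> 0} \<le> n"
    and mass: "(\<Sum>i<N. \<bar>a i\<bar>) \<le> M"
  shows "(\<lambda>x. \<Sum>i<N. a i * h i x) \<in> Sigma_nM n M (dict_P k)"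
proof -
  define S where "S = {i\<in>{..<N}. a i \<noteq> 0}"
  define s where "s = card S"
  have fin: "finite S" by (simp add: S_def)
  obtain f where f: "bij_betw f {..<s} S" using ex_bij_betw_nat_finite[OF fin] unfolding s_def atLeast0LessThan by blast
  obtain h0 :: "real^'d \<Rightarrow> real" where h0: "h0 \<in> dict_P k" using dict_P_nonempty by blast
  define a' where "a' = (\<lambda>j. if j < s then a (f j) else 0)"
  define h' where "h' = (\<lambda>j. if j < s then h (f j) else h0)"
  have sn: "s \<le> n" using card by (simp add: s_def S_def)
  have key: "(\<Sum>j<n. G (a' j) (h' j)) = (\<Sum>i<N. G (a i) (h i))" if G: "\<And>h. G 0 h = (0::real)" for G
  proof -
    have "(\<Sum>j<n. G (a' j) (h' j)) = (\<Sum>j<s. G (a' j) (h' j))"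
      using sn G by (intro sum.mono_neutral_right) (auto simp: a'_def)
    also have "\<dots> = (\<Sum>j<s. G (a (f j)) (h (f j)))" by (intro sum.cong) (auto simp: a'_def h'_def)
    also have "\<dots> = (\<Sum>i\<in>S. G (a i) (h i))" by (rule sum.reindex_bij_betw[OF f])
    also have "\<dots> = (\<Sum>i<N. G (a i) (h i))" using G by (intro sum.mono_neutral_left) (auto simp: S_def)
    finally show ?thesis .
  qed
  have "h' j \<in> dict_P k" for j
    using h0 h bij_betwE[OF f] by (auto simp: h'_def S_def)
  moreover have "(\<Sum>j<n. \<bar>a' j\<bar>) \<le> M" using key[of "\<lambda>a h. \<bar>a\<bar>"] mass by simp
  moreover have "(\<lambda>x. \<Sum>i<N. a i * h i x) = (\<lambda>x. \<Sum>j<n. a' j * h' j x)"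
  proof
    fix x show "(\<Sum>i<N. a i * h i x) = (\<Sum>j<n. a' j * h' j x)" using key[of "\<lambda>a h. a * h x"] by simp
  qed
  ultimately show ?thesis unfolding Sigma_nM_def by blast
qed

lemma Sigma_nM_scale:
  assumes "q \<in> Sigma_nM n M D" "c \<ge> 0"
  shows "(\<lambda>x. c * q x) \<in> Sigma_nM n (c * M) D"
proof -
  obtain a h where q: "q = (\<lambda>x. \<Sum>i<n. a i * h i x)" "\<forall>i<n. h i \<in> D" "(\<Sum>i<n. \<bar>a i\<bar>) \<le> M"
    using assms(1) unfolding Sigma_nM_def by blast
  have "(\<lambda>x. c * q x) = (\<lambda>x. \<Sum>i<n. (c * a i) * h i x)" by (simp add: q(1) sum_distrib_left mult.assoc)
  moreover have "(\<Sum>i<n. \<bar>c * a i\<bar>) \<le> c * M"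
    using q(3) assms(2) by (simp add: abs_mult sum_distrib_left[symmetric] mult_left_mono)
  ultimately show ?thesis unfolding Sigma_nM_def using q(2)
    by (intro CollectI exI[of _ "\<lambda>i. c * a i"] exI[of _ h] conjI)
qed

lemma Sigma_nM_mono: "q \<in> Sigma_nM n M D \<Longrightarrow> M \<le> M' \<Longrightarrow> q \<in> Sigma_nM n M' D"
  unfolding Sigma_nM_def by (blast intro: order_trans)

lemma Sigma_nM_subset: "Sigma_nM n M D \<subseteq> Sigma_n n D"
  unfolding Sigma_nM_def Sigma_n_def by blast

lemma Sigma_nM_ridge_form:
  assumes "h \<in> Sigma_nM N 1 (dict_P k :: (real^'d::finite \<Rightarrow> real) set)"
  obtains a b and \<omega> :: "nat \<Rightarrow> real^'d" where "admissible {..<N} \<omega> b" "(\<Sum>i<N. \<bar>a i\<bar>) \<le> 1"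
    "h = (\<lambda>x. \<Sum>i<N. a i * sigma_k k (\<omega> i \<bullet> x + b i))"
    "\<And>i. i < N \<Longrightarrow> (\<lambda>x. sigma_k k (\<omega> i \<bullet> x + b i)) \<in> dict_P k"
proof -
  obtain a H where H: "h = (\<lambda>x. \<Sum>i<N. a i * H i x)" "\<forall>i<N. H i \<in> (dict_P k :: (real^'d \<Rightarrow> real) set)" "(\<Sum>i<N. \<bar>a i\<bar>) \<le> 1"
    using assms unfolding Sigma_nM_def by blast
  have "\<exists>\<omega> b. norm \<omega> = 1 \<and> \<bar>b\<bar> \<le> 1 \<and> H i = (\<lambda>x. sigma_k k (\<omega> \<bullet> x + b))" if i: "i < N" for i
  proof -
    obtain \<omega> b where "norm \<omega> = 1" "b \<in> {-1..1}" "H i = (\<lambda>x. sigma_k k (\<omega> \<bullet> x + b))"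
    proof -
      have "H i \<in> dict_P k" using H(2) i by blast
      then show thesis unfolding dict_P_def by (elim CollectE exE conjE) (rule that)
    qed
    then show ?thesis by (intro exI[of _ \<omega>] exI[of _ b]) auto
  qed
  then obtain \<omega> b where wb: "\<And>i. i < N \<Longrightarrow> norm (\<omega> i) = 1 \<and> \<bar>b i\<bar> \<le> 1 \<and> H i = (\<lambda>x. sigma_k k (\<omega> i \<bullet> x + b i))"
    by metis
  have "h = (\<lambda>x. \<Sum>i<N. a i * sigma_k k (\<omega> i \<bullet> x + b i))"
    unfolding H(1) using wb by (intro ext sum.cong) auto
  moreover have "(\<lambda>x. sigma_k k (\<omega> i \<bullet> x + b i)) \<in> dict_P k" if "i < N" for i
    using H(2) wb[OF that] that by metis
  moreover have "admissible {..<N} \<omega> b" using wb by (auto simp: admissible_def)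
  ultimately show thesis using H(3) by (intro that)
qed

section \<open>From finite combinations to the variation space\<close>

text \<open>A single approximant at distance below 1 gives a bound uniform over \<open>B1\<close>.
  By scaling, a function of variation norm 0 has Sobolev norm 0.\<close>

lemma B1_wbound:
  assumes "g \<in> B1 k (dict_P k :: (real^'d::finite \<Rightarrow> real) set)" "m \<le> k"
  shows "wbound m g (1 + fact k * 2 ^ k)"
proof -
  obtain N h where h: "h \<in> Sigma_nM N 1 (dict_P k :: (real^'d \<Rightarrow> real) set)" "W_norm k (\<lambda>x. g x - h x) < ereal 1"
    using assms(1) unfolding B1_def by (auto dest!: spec[of _ 1])
  obtain a b and \<omega> :: "nat \<Rightarrow> real^'d" where r: "admissible {..<N} \<omega> b" "(\<Sum>i<N. \<bar>a i\<bar>) \<le> 1"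
    "h = (\<lambda>x. \<Sum>i<N. a i * sigma_k k (\<omega> i \<bullet> x + b i))" using Sigma_nM_ridge_form[OF h(1)] by blast
  have "wbound m h (fact k * 2 ^ k)"
    unfolding r(3)
  proof (rule wbound_ridge_sum[OF r(1) assms(2)])
    fix w :: "'d list" and x :: "real^'d" assume x: "x \<in> cball 0 1"
    have "\<bar>ridge_sum {..<N} \<omega> b k a w x\<bar> \<le> 2 ^ k * (\<Sum>i<N. \<bar>a i\<bar>)" by (rule abs_ridge_sum_le[OF r(1) x])
    also have "\<dots> \<le> 2 ^ k * 1" using r(2) by (intro mult_left_mono) auto
    finally show "\<bar>ridge_sum {..<N} \<omega> b k a w x\<bar> \<le> 2 ^ k" by simp
  qed
  from wbound_add[OF wbound_of_W_norm[OF h(2) assms(2)] this] show ?thesis by simp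
qed

text \<open>\<open>g\<close> is first replaced, in the norm of order k, by a combination of
  uncontrolled length with error equal to the target rate. Sparsifying it costs k! K times the rate,
  whatever the length, hence the constant 1 + k! K.\<close>

lemma B1_approximation:
  fixes k :: nat
  obtains C :: real where "C > 0"
    "\<And>(g :: real^'d::finite \<Rightarrow> real) m n. g \<in> B1 k (dict_P k) \<Longrightarrow> m \<le> k \<Longrightarrow> n \<ge> 1 \<Longrightarrow>
      \<exists>q\<in>Sigma_nM n 1 (dict_P k). wbound m (\<lambda>x. g x - q x) (C * real n powr (- ridge_rate CARD('d) k m))"
proof -
  obtain K where K: "K > 0" and approx: "\<And>(I :: nat set) (\<omega> :: nat \<Rightarrow> real^'d) b a m n.
    admissible I \<omega> b \<and> n \<ge> 1 \<and> m \<le> k \<and> (\<Sum>i\<in>I. \<bar>a i\<bar>) \<le> 1 \<Longrightarrow>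
    \<exists>a'. card {i\<in>I. a' i \<noteq> 0} \<le> n \<and> (\<Sum>i\<in>I. \<bar>a' i\<bar>) \<le> 1 \<and>
       ridge_close I \<omega> b k m a a' (K * real n powr (- ridge_rate CARD('d) k m))"
    using sparse_ridge_approximation[where 'i = nat and 'd = 'd and k = k] by blast
  show thesis
  proof (rule that[of "1 + fact k * K"])
    show "1 + fact k * K > 0" using K by (simp add: add_pos_pos)
    fix g :: "real^'d \<Rightarrow> real" and m n assume g: "g \<in> B1 k (dict_P k)" and m: "m \<le> k" and n: "(n::nat) \<ge> 1"
    define \<epsilon> where "\<epsilon> = real n powr (- ridge_rate CARD('d) k m)"
    have "\<epsilon> > 0" using n by (simp add: \<epsilon>_def)
    then obtain N h where h: "h \<in> Sigma_nM N 1 (dict_P k :: (real^'d \<Rightarrow> real) set)" "W_norm k (\<lambda>x. g x - h x) < ereal \<epsilon>"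
      using g unfolding B1_def by blast
    obtain a b and \<omega> :: "nat \<Rightarrow> real^'d" where r: "admissible {..<N} \<omega> b" "(\<Sum>i<N. \<bar>a i\<bar>) \<le> 1"
      "h = (\<lambda>x. \<Sum>i<N. a i * sigma_k k (\<omega> i \<bullet> x + b i))"
      "\<And>i. i < N \<Longrightarrow> (\<lambda>x. sigma_k k (\<omega> i \<bullet> x + b i)) \<in> dict_P k" using Sigma_nM_ridge_form[OF h(1)] by blast
    obtain a' where a': "card {i\<in>{..<N}. a' i \<noteq> 0} \<le> n" "(\<Sum>i<N. \<bar>a' i\<bar>) \<le> 1"
       "ridge_close {..<N} \<omega> b k m a a' (K * \<epsilon>)"
      using approx[of "{..<N}" \<omega> b n m a] r(1,2) n m unfolding \<epsilon>_def by blast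
    define q where "q = (\<lambda>x. \<Sum>i<N. a' i * sigma_k k (\<omega> i \<bullet> x + b i))"
    have q: "q \<in> Sigma_nM n 1 (dict_P k)"
      unfolding q_def by (rule sparse_sum_in_Sigma_nM[OF r(4) a'(1,2)])
    have "wbound m (\<lambda>x. \<Sum>i<N. (a i - a' i) * sigma_k k (\<omega> i \<bullet> x + b i)) (fact k * (K * \<epsilon>))"
      using a'(3) by (intro wbound_ridge_sum[OF r(1) m]) (simp add: ridge_sum_diff ridge_close_def)
    then have "wbound m (\<lambda>x. h x - q x) (fact k * (K * \<epsilon>))"
      unfolding r(3) q_def by (simp add: left_diff_distrib sum_subtractf)
    from wbound_add[OF wbound_of_W_norm[OF h(2) m] this]
    have "wbound m (\<lambda>x. g x - q x) ((1 + fact k * K) * \<epsilon>)" by (simp add: distrib_right mult.assoc)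
    with q show "\<exists>q\<in>Sigma_nM n 1 (dict_P k). wbound m (\<lambda>x. g x - q x) ((1 + fact k * K) * real n powr (- ridge_rate CARD('d) k m))"
      unfolding \<epsilon>_def by blast
  qed
qed

theorem theorem3:
  fixes k :: nat
  shows "\<exists>C::real. C > 0 \<and>
    (\<forall>m \<le> k. \<forall>(f :: real^'d::finite \<Rightarrow> real) (n::nat). in_K1 k (dict_P k) f \<and> n \<ge> 1 \<longrightarrow>
       (INF fn \<in> Sigma_n n (dict_P k). W_norm m (\<lambda>x. f x - fn x))
         \<le> ereal (C * K1_norm k (dict_P k) f *
                  real n powr (- 1/2 - (2 * (real k - real m) + 1) / (2 * real CARD('d)))) \<and>
       (f \<in> B1 k (dict_P k) \<longrightarrow>
          (\<exists>fn \<in> Sigma_nM n 1 (dict_P k). W_norm m (\<lambda>x. f x - fn x)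
            \<le> ereal (C * K1_norm k (dict_P k) f *
                  real n powr (- 1/2 - (2 * (real k - real m) + 1) / (2 * real CARD('d)))))))"
proof -
  obtain C :: real where C: "C > 0" and approx:
    "\<And>(g :: real^'d \<Rightarrow> real) m n. g \<in> B1 k (dict_P k) \<Longrightarrow> m \<le> k \<Longrightarrow> n \<ge> 1 \<Longrightarrow>
      \<exists>q\<in>Sigma_nM n 1 (dict_P k). wbound m (\<lambda>x. g x - q x) (C * real n powr (- ridge_rate CARD('d) k m))"
    using B1_approximation[where 'd = 'd and k = k] by blast
  show ?thesis
  \<comment> \<open>The factor 2 serves the second claim: the infimum \<kappa> need not be attained,
    and mass at most 1 demands some s \<le> 1 in \<open>K1_set\<close>, which can be found with s
    \<le> 2 \<kappa> if \<kappa> > 0.\<close>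
  proof (intro exI[of _ "2 * C"] conjI allI impI)
    show "2 * C > 0" using C by simp
    fix m :: nat and f :: "real^'d \<Rightarrow> real" and n :: nat
    assume m: "m \<le> k" and "in_K1 k (dict_P k) f \<and> n \<ge> 1"
    then have ne: "K1_set k (dict_P k) f \<noteq> {}" and n: "n \<ge> 1" by (auto simp: in_K1_def)
    define q where "q = real n powr (- ridge_rate CARD('d) k m)"
    have q: "q > 0" using n by (simp add: q_def)
    have rate: "real n powr (- 1/2 - (2 * (real k - real m) + 1) / (2 * real CARD('d))) = q"
      using m by (simp add: q_def ridge_rate_def of_nat_diff)
    define \<kappa> where "\<kappa> = K1_norm k (dict_P k) f"
    have bdd: "bdd_below (K1_set k (dict_P k) f)" by (rule bdd_belowI[of _ 0]) (auto simp: K1_set_def)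
    have \<kappa>_nonneg: "\<kappa> \<ge> 0" unfolding \<kappa>_def K1_norm_def using ne by (rule cInf_greatest) (auto simp: K1_set_def)
    have scaled: "\<exists>p\<in>Sigma_nM n s (dict_P k). wbound m (\<lambda>x. f x - p x) (s * (C * q))"
      if s: "s \<in> K1_set k (dict_P k) f" for s
    proof -
      obtain g where g: "s > 0" "g \<in> B1 k (dict_P k)" "f = (\<lambda>x. s * g x)"
        using s unfolding K1_set_def by blast
      obtain p where p: "p \<in> Sigma_nM n 1 (dict_P k)" "wbound m (\<lambda>x. g x - p x) (C * q)"
        using approx[OF g(2) m n] unfolding q_def by blast
      have "(\<lambda>x. s * p x) \<in> Sigma_nM n s (dict_P k)" using Sigma_nM_scale[OF p(1), of s] g(1) by simp
      moreover have "wbound m (\<lambda>x. f x - s * p x) (s * (C * q))"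
        using wbound_scale[OF p(2), of s] g(1) unfolding g(3) by (simp add: right_diff_distrib)
      ultimately show ?thesis by (intro bexI[of _ "\<lambda>x. s * p x"])
    qed
    have near: "\<exists>s\<in>K1_set k (dict_P k) f. s < c" if "\<kappa> < c" for c
      using that ne unfolding \<kappa>_def K1_norm_def by (rule cInf_lessD[rotated])
    show "(INF fn\<in>Sigma_n n (dict_P k). W_norm m (\<lambda>x. f x - fn x))
         \<le> ereal (2 * C * K1_norm k (dict_P k) f *
                  real n powr (- 1/2 - (2 * (real k - real m) + 1) / (2 * real CARD('d))))"
      unfolding rate \<kappa>_def[symmetric]
    proof (rule ereal_le_epsilon2)
      fix e :: real assume e: "e > 0"
      have "\<kappa> < \<kappa> + e / (C * q)" using e C q by simp
      then obtain s where s: "s \<in> K1_set k (dict_P k) f" "s < \<kappa> + e / (C * q)" using near by blast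
      obtain p where p: "p \<in> Sigma_nM n s (dict_P k)" "wbound m (\<lambda>x. f x - p x) (s * (C * q))"
        using scaled[OF s(1)] by blast
      have "(INF fn\<in>Sigma_n n (dict_P k). W_norm m (\<lambda>x. f x - fn x)) \<le> W_norm m (\<lambda>x. f x - p x)"
        using p(1) Sigma_nM_subset by (intro INF_lower) blast
      also have "\<dots> \<le> ereal (s * (C * q))" by (rule W_norm_le_wbound[OF p(2)])
      also have "\<dots> \<le> ereal (2 * C * \<kappa> * q + e)"
      proof -
        have "s * (C * q) \<le> (\<kappa> + e / (C * q)) * (C * q)" using s(2) C q by (intro mult_right_mono) auto
        also have "\<dots> = C * \<kappa> * q + e" using C q by (simp add: field_simps)
        also have "\<dots> \<le> 2 * C * \<kappa> * q + e" using C q \<kappa>_nonneg by simp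
        finally show ?thesis by simp
      qed
      finally show "(INF fn\<in>Sigma_n n (dict_P k). W_norm m (\<lambda>x. f x - fn x)) \<le> ereal (2 * C * \<kappa> * q) + ereal e" by simp
    qed
    assume f: "f \<in> B1 k (dict_P k)"
    then have one: "1 \<in> K1_set k (dict_P k) f" unfolding K1_set_def by auto
    have \<kappa>_le: "\<kappa> \<le> 1" unfolding \<kappa>_def K1_norm_def by (rule cInf_lower[OF one bdd])
    show "\<exists>fn\<in>Sigma_nM n 1 (dict_P k). W_norm m (\<lambda>x. f x - fn x)
            \<le> ereal (2 * C * K1_norm k (dict_P k) f *
                  real n powr (- 1/2 - (2 * (real k - real m) + 1) / (2 * real CARD('d))))"
      unfolding rate \<kappa>_def[symmetric]
    \<comment> \<open>No s in \<open>K1_set\<close> satisfies s \<le> 2 \<kappa> when \<kappa> = 0.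
      Then \<open>f\<close> is s times an element of \<open>B1\<close> for arbitrarily small s, so
      its norm is 0 and the zero combination attains the bound.\<close>
    proof (cases "\<kappa> = 0")
      case True
      obtain h0 :: "real^'d \<Rightarrow> real" where h0: "h0 \<in> dict_P k" using dict_P_nonempty by blast
      have "(\<lambda>x. \<Sum>i<n. 0 * h0 x) \<in> Sigma_nM n 1 (dict_P k)"
        unfolding Sigma_nM_def using h0 by (intro CollectI exI[of _ "\<lambda>_. 0"] exI[of _ "\<lambda>_. h0"]) auto
      then have z: "(\<lambda>x :: real^'d. 0) \<in> Sigma_nM n 1 (dict_P k)" by simp
      define B :: real where "B = 1 + fact k * 2 ^ k"
      have B: "B > 0" unfolding B_def by (simp add: add_pos_pos)
      have "W_norm m f \<le> 0"
      proof (rule ereal_le_epsilon2)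
        fix e :: real assume e: "e > 0"
        have "\<kappa> < e / B" using True e B by simp
        then obtain s where s: "s \<in> K1_set k (dict_P k) f" "s < e / B" using near by blast
        obtain g where g: "s > 0" "g \<in> B1 k (dict_P k)" "f = (\<lambda>x. s * g x)"
          using s(1) unfolding K1_set_def by blast
        have "wbound m f (s * B)" unfolding g(3) B_def using B1_wbound[OF g(2) m] g(1) by (intro wbound_scale) auto
        then have "W_norm m f \<le> ereal (s * B)" by (rule W_norm_le_wbound)
        also have "\<dots> \<le> ereal e" using s(2) B by (simp add: pos_less_divide_eq less_imp_le)
        finally show "W_norm m f \<le> 0 + ereal e" by simp
      qed
      then show "\<exists>fn\<in>Sigma_nM n 1 (dict_P k). W_norm m (\<lambda>x. f x - fn x) \<le> ereal (2 * C * \<kappa> * q)"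
        using z True by (intro bexI[of _ "\<lambda>x. 0"]) (auto simp: zero_ereal_def)
    next
      case False
      then have pos: "\<kappa> > 0" using \<kappa>_nonneg by simp
      obtain s where s: "s \<in> K1_set k (dict_P k) f" "s \<le> 1" "s \<le> 2 * \<kappa>"
      proof (cases "\<kappa> < 1")
        case True
        then have "\<kappa> < min 1 (2 * \<kappa>)" using pos by simp
        then obtain s where "s \<in> K1_set k (dict_P k) f" "s < min 1 (2 * \<kappa>)" using near by blast
        then show thesis by (intro that[of s]) auto
      next
        case False
        then show thesis using one by (intro that[of 1]) auto
      qed
      obtain p where p: "p \<in> Sigma_nM n s (dict_P k)" "wbound m (\<lambda>x. f x - p x) (s * (C * q))"
        using scaled[OF s(1)] by blast
      have "W_norm m (\<lambda>x. f x - p x) \<le> ereal (s * (C * q))" by (rule W_norm_le_wbound[OF p(2)])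
      also have "\<dots> \<le> ereal (2 * C * \<kappa> * q)"
      proof -
        have "s * (C * q) \<le> (2 * \<kappa>) * (C * q)" using s(3) C q by (intro mult_right_mono) auto
        then show ?thesis by (simp add: mult_ac)
      qed
      finally show "\<exists>fn\<in>Sigma_nM n 1 (dict_P k). W_norm m (\<lambda>x. f x - fn x) \<le> ereal (2 * C * \<kappa> * q)"
        using Sigma_nM_mono[OF p(1) s(2)] by (rule bexI)
    qed
  qed
qed

end
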